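(* Let $k$ be a field of characteristic $p>0$, let $1\le m\le n$, let $R=k[x_{11},\dots,x_{mn}]$, let $X=[x_{ij}]$ be the $m\times n$ matrix of indeterminates, and let $I=I_m(X)$ be the ideal of $R$ generated by the maximal ($m\times m$) minors of $X$. Then $\operatorname{fpt}(I)=n-m+1$, the set of $F$-jumping numbers ($F$-thresholds) of $I$ is $\{N\in\mathbb{Z}\mid N\ge \operatorname{fpt}(I)\}$, and for every real $\lambda\ge \operatorname{fpt}(I)-1$, $$\tau(\lambda\bullet I)=I^{\lfloor\lambda\rfloor-\operatorname{fpt}(I)+1}=I^{\lfloor\lambda\rfloor-n+m}.$$ (In particular $\tau(\lambda\bullet I)=R$ for $0\le\lambda<n-m+1$.)
   Context: For an ideal $\mathfrak a$ of $R$ and $q=p^e$, the $e$-th root ideal $\mathfrak a^{[1/q]}$ is the unique smallest ideal $\mathfrak b$ of $R$ with $\mathfrak a\subseteq \mathfrak b^{[q]}$, where $\mathfrak b^{[q]}$ is the ideal generated by $q$-th powers of elements of $\mathfrak b$. Concretely, if $\mathcal B_e$ is a basis of $R$ as a module over $R^{q}=\{r^q: r\in R\}$ (for $k$ $F$-finite one may take $\alpha x^{u}$ with $\alpha$ in a $k^{q}$-basis of $k$ and monomials $x^u$ with all exponents $\le q-1$) and $\mathfrak a=(a_1,\dots,a_s)$ with $a_i=\sum_{\mu\in\mathcal B_e} g_{i\mu}^q\mu$, then $\mathfrak a^{[1/q]}=(g_{i\mu})$. For real $\lambda>0$, the generalized test ideal is $\tau(\lambda\bullet\mathfrak a)=\bigcup_{e\ge0}(\mathfrak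 a^{\lceil\lambda p^e\rceil})^{[1/p^e]}$, which equals $(\mathfrak a^{\lceil\lambda p^e\rceil})^{[1/p^e]}$ for $e\gg0$; and $\tau(0\bullet\mathfrak a)=R$. An $F$-jumping number of $\mathfrak a$ is a $\lambda>0$ with $\tau(\lambda\bullet\mathfrak a)\ne\tau((\lambda-\delta)\bullet\mathfrak a)$ for all $\delta>0$; the $F$-pure threshold is $\operatorname{fpt}(\mathfrak a)=\min\{\lambda>0:\tau(\lambda\bullet\mathfrak a)\ne R\}$. *)

theory Defs
  imports "HOL-Analysis.Analysis" "HOL-Library.Poly_Mapping"
begin

definition is_ideal :: "'a::comm_ring_1 set \<Rightarrow> bool" where
  "is_ideal I \<longleftrightarrow> 0 \<in> I \<and> (\<forall>x\<in>I. \<forall>y\<in>I. x + y \<in> I) \<and> (\<forall>r. \<forall>x\<in>I. r * x \<in> I)"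

definition ideal_gen :: "'a::comm_ring_1 set \<Rightarrow> 'a set" where
  "ideal_gen S = \<Inter> {I. is_ideal I \<and> S \<subseteq> I}"

fun ideal_pow :: "'a::comm_ring_1 set \<Rightarrow> nat \<Rightarrow> 'a set" where
  "ideal_pow a 0 = UNIV"
| "ideal_pow a (Suc n) = ideal_gen {x * y | x y. x \<in> ideal_pow a n \<and> y \<in> a}"

definition frob_pow :: "'a::comm_ring_1 set \<Rightarrow> nat \<Rightarrow> 'a set" where
  "frob_pow b q = ideal_gen {x ^ q | x. x \<in> b}"

definition root_ideal :: "'a::comm_ring_1 set \<Rightarrow> nat \<Rightarrow> 'a set" where
  "root_ideal a q = \<Inter> {b. is_ideal b \<and> a \<subseteq> frob_pow b q}"

text \<open>Generalized test ideal tau(lambda . a), with p = CHAR of the ring.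
  For lambda \<le> 0 the exponent is 0 and this gives R.\<close>
definition test_ideal :: "real \<Rightarrow> 'a::comm_ring_1 set \<Rightarrow> 'a set" where
  "test_ideal lam a =
     (\<Union>e::nat. root_ideal (ideal_pow a (nat \<lceil>lam * real (CHAR('a) ^ e)\<rceil>)) (CHAR('a) ^ e))"

definition F_jumping_number :: "'a::comm_ring_1 set \<Rightarrow> real \<Rightarrow> bool" where
  "F_jumping_number a lam \<longleftrightarrow> lam > 0 \<and>
     (\<forall>\<delta>>0. test_ideal lam a \<noteq> test_ideal (lam - \<delta>) a)"

definition fpt :: "'a::comm_ring_1 set \<Rightarrow> real" where
  "fpt a = (LEAST lam. lam > 0 \<and> test_ideal lam a \<noteq> UNIV)"

text \<open>Polynomials in variables indexed by 'm \<times> 'n (m = CARD('m), n = CARD('n)).\<close>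
type_synonym ('m, 'n, 'k) gpoly = "(('m \<times> 'n) \<Rightarrow>\<^sub>0 nat) \<Rightarrow>\<^sub>0 'k"

definition var :: "'m \<Rightarrow> 'n \<Rightarrow> ('m, 'n, 'k::comm_ring_1) gpoly" where
  "var i j = Poly_Mapping.single (Poly_Mapping.single (i, j) 1) 1"

definition max_minor :: "('m::finite \<Rightarrow> 'n::finite) \<Rightarrow> ('m, 'n, 'k::comm_ring_1) gpoly" where
  "max_minor f = det (\<chi> i j. var i (f j) :: ('m, 'n, 'k) gpoly ^'m^'m)"

definition maximal_minors_ideal :: "('m::finite, 'n::finite, 'k::comm_ring_1) gpoly set" where
  "maximal_minors_ideal = ideal_gen {max_minor f | f. inj f}"

end

(* For q = p^e the claim reduces to two statements about I = I_m(X).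

   Lower bound: let f be the product of the n-m+1 minors on consecutive columns. Its diagonal leading
   monomial is squarefree, so a p^{-e}-linear coordinate map sends h^q f^(q-1) to h. Hence
   I^N is contained in (I^K)^[1/q] whenever K <= Nq + (n-m+1)(q-1).

   Upper bound: I^((N+n-m)q) is contained in (I^N)^[q]. Let delta be the minor of the first m-1 columns
   and the last m-1 rows. After inverting delta, I is generated by n-m+1 elements and the pigeonhole
   principle applies. To remove delta one uses that it is a nonzerodivisor modulo I^N, which passes to
   the Frobenius power because R is free over R^q. For a weight selecting diagonals, every element of I^N
   has in top weight only multiples of products of N diagonals: products of minors times monomials straighten
   to standard ones, and standard ones have distinct leading monomials. The leading monomial of delta
   is coprime to all diagonals, whence delta f in I^N implies f in I^N. *)
theory Submission
  imports Defs
begin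

text \<open>The number n-m+1 enters twice, for unrelated reasons: it counts the windows of m
  consecutive columns, whose diagonals are pairwise disjoint, and it counts the generators that
  remain after inverting delta. Pigeonhole gains one generator, so the bounds meet: for N+n-m <=
  lambda < N+n-m+1 both give I^N, the upper bound for every e, the lower one through a single large
  e.

  The obstacle is that I^N might grow when saturated by delta. Excluding this requires the heaviest
  monomials of arbitrary elements of I^N, where cancellation can occur, and not only those of
  products of minors. This forces a complete straightening to a family with distinct leading
  monomials. Two relations suffice: shuffles of the columns of two minors sort the minors against
  each other, and Cramer's relation sorts a variable against a minor. Both are instances of
  \<open>exchange_relation\<close>, which rests on a sign-reversing involution and so holds in every
  characteristic.\<close>

section \<open>Exchange relations between determinants\<close>

text \<open>\<open>V j i\<close> is the entry in row \<open>i\<close> of column \<open>j\<close>.\<close>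

definition coldet :: "('m::finite \<Rightarrow> 'm \<Rightarrow> 'a::comm_ring_1) \<Rightarrow> 'a" where
  "coldet V = (\<Sum>p | p permutes UNIV. of_int (sign p) * (\<Prod>i\<in>UNIV. V (p i) i))"

lemma det_eq_coldet: "det (\<chi> i j. V j i) = coldet V"
  by (simp add: coldet_def det_def)

lemma coldet_eq_det: "coldet V = det (\<chi> i j. V j i)"
  by (simp add: det_eq_coldet)

lemma coldet_permute:
  assumes "p permutes UNIV"
  shows "coldet (\<lambda>i. V (p i)) = of_int (sign p) * coldet V"
  using det_permute_columns[OF assms, of "\<chi> i j. V j i"] by (simp add: coldet_eq_det)

lemma coldet_eq_0:
  assumes "j \<noteq> k" "V j = V k"
  shows "coldet V = 0"
  unfolding coldet_eq_det
  by (rule det_identical_columns[OF assms(1)]) (simp add: column_def assms(2))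

lemma of_int_sign_mult: "(of_int (sign p) :: 'a::comm_ring_1) * (of_int (sign p) * x) = x"
  by (metis mult.assoc mult_1 of_int_1 of_int_mult sign_idempotent)

text \<open>Pairs of determinants: the columns of the first one sit in the positions \<open>(i, True)\<close>, those of the second one in
  the positions \<open>(i, False)\<close>.\<close>

definition layered :: "('m \<times> bool \<Rightarrow> 'm \<times> bool) set" where
  "layered = {k. k permutes UNIV \<and> (\<forall>u. snd (k u) = snd u)}"

text \<open>The embedding of two copies of the symmetric group as a Young subgroup of the
  permutations of all positions; \<open>layered\<close> is its image
  (\<open>bij_layer_perm\<close>).\<close>

definition layer_perm :: "('m \<Rightarrow> 'm) \<times> ('m \<Rightarrow> 'm) \<Rightarrow> 'm \<times> bool \<Rightarrow> 'm \<times> bool" where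
  "layer_perm r = map_permutation UNIV (\<lambda>i. (i, True)) (fst r) \<circ> map_permutation UNIV (\<lambda>i. (i, False)) (snd r)"

lemma layer_perm_apply:
  "layer_perm r (i, b) = (if b then (fst r i, True) else (snd r i, False))"
proof -
  have *: "map_permutation UNIV (\<lambda>i. (i, b)) p (j, b') = (if b = b' then (p j, b) else (j, b'))"
    for p :: "'a \<Rightarrow> 'a" and j :: 'a and b b' :: bool
  proof (cases "b = b'")
    case True
    have "inj (\<lambda>i::'a. (i, b))" by (auto intro: injI)
    from map_permutation_apply[OF this, of j p] True show ?thesis by (auto simp: inv_into_f_f)
  next
    case False
    then show ?thesis by (auto simp: map_permutation_def restrict_id_def)
  qed
  show ?thesis by (auto simp: layer_perm_def *)
qed

lemma sign_layer_perm:
  fixes r :: "('m::finite \<Rightarrow> 'm) \<times> ('m \<Rightarrow> 'm)"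
  assumes "fst r permutes UNIV" "snd r permutes UNIV"
  shows "layer_perm r permutes UNIV" "sign (layer_perm r) = sign (fst r) * sign (snd r)"
proof -
  have i: "inj (\<lambda>i::'m. (i, b))" for b :: bool by (auto intro: injI)
  have p: "map_permutation UNIV (\<lambda>i. (i, b)) q permutes range (\<lambda>i. (i, b))" if "q permutes UNIV"
    for q :: "'m \<Rightarrow> 'm" and b :: bool
    using i that by (metis bij_betw_imageI map_permutation_permutes)
  have p': "permutation (map_permutation UNIV (\<lambda>i. (i, b)) q)" if "q permutes UNIV"
    for q :: "'m \<Rightarrow> 'm" and b :: bool
    using p[OF that, of b] permutation_permutes by (metis finite)
  show "sign (layer_perm r) = sign (fst r) * sign (snd r)"
    using assms i by (simp add: layer_perm_def sign_compose p' sign_map_permutation)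
  show "layer_perm r permutes UNIV"
    unfolding layer_perm_def
    by (rule permutes_compose; rule permutes_subset[OF p]) (use assms in auto)
qed

lemma bij_layer_perm:
  "bij_betw layer_perm ({p. p permutes UNIV} \<times> {p. p permutes (UNIV::'m::finite set)}) layered"
proof -
  have "inj_on layer_perm ({p. p permutes UNIV} \<times> {p. p permutes (UNIV::'m set)})"
  proof (rule inj_onI)
    fix r s :: "('m \<Rightarrow> 'm) \<times> ('m \<Rightarrow> 'm)" assume "layer_perm r = layer_perm s"
    hence "layer_perm r (i, b) = layer_perm s (i, b)" for i b by simp
    from this[of _ True] this[of _ False] show "r = s"
      by (auto simp: layer_perm_apply prod_eq_iff)
  qed
  moreover have "k \<in> layer_perm ` ({p. p permutes UNIV} \<times> {p. p permutes (UNIV::'m set)})"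
    if k: "k \<in> layered" for k
  proof -
    define r where "r = (\<lambda>b i. fst (k (i, b)))"
    have kr: "k (i, b) = (r b i, b)" for i b
      using k by (auto simp: layered_def r_def prod_eq_iff)
    have "inj k" using k by (auto simp: layered_def permutes_inj)
    hence "inj (r b)" for b
      by (intro injI) (metis kr inj_eq prod.inject)
    hence "r b permutes UNIV" for b
      by (intro bij_imp_permutes) (auto simp: bij_def finite_UNIV_inj_surj)
    moreover have "k = layer_perm (r True, r False)"
      by (rule ext) (auto simp: layer_perm_apply kr split: prod.splits)
    ultimately show ?thesis by auto
  qed
  moreover have "layer_perm r \<in> layered"
    if "r \<in> {p. p permutes UNIV} \<times> {p. p permutes (UNIV::'m set)}" for r
    using sign_layer_perm[of r] that by (auto simp: layered_def layer_perm_apply)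
  ultimately show ?thesis by (auto simp: bij_betw_def)
qed

text \<open>Along \<open>bij_layer_perm\<close> the sign and the product over positions both split
  into the two layers. A column is evaluated in the row given by the first component of the position
  that it occupies.\<close>

lemma coldet_mult_expand:
  fixes h :: "'m::finite \<times> bool \<Rightarrow> 'm \<Rightarrow> 'a::comm_ring_1"
  shows "(\<Sum>k\<in>layered. of_int (sign k) * (\<Prod>u\<in>UNIV. h (k u) (fst u)))
     = coldet (\<lambda>i. h (i, True)) * coldet (\<lambda>i. h (i, False))"
proof -
  have "(\<Sum>k\<in>layered. of_int (sign k) * (\<Prod>u\<in>UNIV. h (k u) (fst u)))
    = (\<Sum>r\<in>{p. p permutes (UNIV::'m set)} \<times> {p. p permutes (UNIV::'m set)}.
        of_int (sign (layer_perm r)) * (\<Prod>u\<in>UNIV. h (layer_perm r u) (fst u)))"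
    by (rule sum.reindex_bij_betw[OF bij_layer_perm, symmetric])
  also have "\<dots> = (\<Sum>r\<in>{p. p permutes (UNIV::'m set)} \<times> {p. p permutes (UNIV::'m set)}.
        (of_int (sign (fst r)) * (\<Prod>i\<in>UNIV. h (fst r i, True) i)) *
        (of_int (sign (snd r)) * (\<Prod>i\<in>UNIV. h (snd r i, False) i)))"
  proof (rule sum.cong[OF refl])
    fix r assume r: "r \<in> {p. p permutes (UNIV::'m set)} \<times> {p. p permutes (UNIV::'m set)}"
    have "(\<Prod>u\<in>UNIV. h (layer_perm r u) (fst u))
      = (\<Prod>i\<in>UNIV. \<Prod>b\<in>UNIV. h (layer_perm r (i, b)) i)"
      by (simp add: prod.cartesian_product split_def)
    also have "\<dots> = (\<Prod>i\<in>UNIV. h (fst r i, True) i) * (\<Prod>i\<in>UNIV. h (snd r i, False) i)"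
      by (simp add: UNIV_bool layer_perm_apply prod.distrib mult.commute)
    finally show "of_int (sign (layer_perm r)) * (\<Prod>u\<in>UNIV. h (layer_perm r u) (fst u)) =
        (of_int (sign (fst r)) * (\<Prod>i\<in>UNIV. h (fst r i, True) i)) *
        (of_int (sign (snd r)) * (\<Prod>i\<in>UNIV. h (snd r i, False) i))"
      using r sign_layer_perm[of r] by (auto simp: mult_ac)
  qed
  also have "\<dots> = coldet (\<lambda>i. h (i, True)) * coldet (\<lambda>i. h (i, False))"
    by (simp add: coldet_def sum_product sum.cartesian_product split_def)
  finally show ?thesis .
qed

text \<open>In every summand two columns from \<open>T\<close> are evaluated in the same row; interchanging them reverses the sign.\<close>

lemma exchange_signed_sum_zero:
  fixes h :: "'m::finite \<times> bool \<Rightarrow> 'm \<Rightarrow> 'a::comm_ring_1"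
  assumes T: "card T > CARD('m)"
  defines "Z \<equiv> {p. p permutes UNIV \<and> (\<forall>u. p u \<notin> T \<longrightarrow> snd (p u) = snd u)}"
  shows "(\<Sum>p\<in>Z. of_int (sign p) * (\<Prod>u\<in>UNIV. h (p u) (fst u))) = 0"
proof -
  define t where "t p = of_int (sign p) * (\<Prod>u\<in>UNIV. h (p u) (fst u))" for p
  define R where "R p r \<longleftrightarrow> p (r, True) \<in> T \<and> p (r, False) \<in> T" for p :: "'m \<times> bool \<Rightarrow> 'm \<times> bool" and r
  \<comment> \<open>The row is chosen from the predicate \<open>R p\<close> alone, which the
    interchange leaves invariant. Hence \<open>flip p\<close> chooses the same row again and
    \<open>flip\<close> is an involution.\<close>
  define w where "w p = (SOME r. R p r)" for p
  define flip where "flip p = p \<circ> Transposition.transpose (w p, True) (w p, False)" for p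
  have Rw: "R p (w p)" if "p \<in> Z" for p
  proof -
    have p: "p permutes UNIV" using that by (simp add: Z_def)
    have "\<exists>r. R p r"
    proof (rule ccontr)
      assume n: "\<not> ?thesis"
      have "inj_on fst (p -` T)"
      proof (rule inj_onI)
        fix x y assume xy: "x \<in> p -` T" "y \<in> p -` T" "fst x = fst y"
        show "x = y"
        proof (rule ccontr)
          assume "x \<noteq> y"
          with xy have "R p (fst x)" unfolding R_def
            by (cases x; cases y; cases "snd x"; cases "snd y") auto
          with n show False by auto
        qed
      qed
      hence "card (p -` T) \<le> CARD('m)" by (rule card_inj_on_le) auto
      moreover have "card (p -` T) = card T"
        using p by (intro card_vimage_inj) (auto simp: permutes_inj permutes_surj)
      ultimately show False using T by simp
    qed
    thus ?thesis unfolding w_def by (rule someI_ex)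
  qed
  have R_flip: "R (flip p) = R p" if "p \<in> Z" for p
    using Rw[OF that] by (auto simp: R_def flip_def Transposition.transpose_def fun_eq_iff)
  have w_flip: "w (flip p) = w p" if "p \<in> Z" for p
    using R_flip[OF that] by (simp add: w_def)
  have flip_flip: "flip (flip p) = p" if "p \<in> Z" for p
    unfolding flip_def[of "flip p"] w_flip[OF that] by (simp add: flip_def comp_assoc)
  have flip_Z: "flip p \<in> Z" if p: "p \<in> Z" for p
  proof -
    have pU: "p permutes UNIV" and pT: "\<And>u. p u \<notin> T \<Longrightarrow> snd (p u) = snd u"
      using p unfolding Z_def by blast+
    have "flip p permutes UNIV"
      unfolding flip_def by (rule permutes_compose[OF permutes_swap_id pU]) simp_all
    moreover have "snd (flip p u) = snd u" if u: "flip p u \<notin> T" for u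
    proof -
      have "p (w p, True) \<in> T" "p (w p, False) \<in> T" using Rw[OF p] by (simp_all add: R_def)
      hence "u \<noteq> (w p, True)" "u \<noteq> (w p, False)" using u by (auto simp: flip_def)
      hence "flip p u = p u" by (simp add: flip_def transpose_apply_other)
      thus ?thesis using pT u by simp
    qed
    ultimately show ?thesis by (simp add: Z_def del: split_paired_All)
  qed
  have perm: "permutation p" if "p \<in> Z" for p
    using that unfolding Z_def permutation_permutes by (metis (no_types, lifting) finite mem_Collect_eq)
  have sgn_flip: "sign (flip p) = - sign p" if "p \<in> Z" for p
    using perm[OF that] by (simp add: flip_def sign_compose sign_swap_id permutation_swap_id)
  have t_flip: "t (flip p) = - t p" if "p \<in> Z" for p
  proof -
    have tr: "Transposition.transpose (w p, True) (w p, False) permutes UNIV" by (simp add: permutes_swap_id)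
    have "(\<Prod>u\<in>UNIV. h (flip p u) (fst u)) =
      (\<Prod>u\<in>UNIV. h (flip p (Transposition.transpose (w p, True) (w p, False) u)) (fst (Transposition.transpose (w p, True) (w p, False) u)))"
      by (rule prod.permute[OF tr, unfolded comp_def])
    also have "\<dots> = (\<Prod>u\<in>UNIV. h (p u) (fst u))"
      by (intro prod.cong refl) (auto simp: flip_def Transposition.transpose_def)
    finally show ?thesis using sgn_flip[OF that] by (simp add: t_def)
  qed
  \<comment> \<open>Matching even with odd permutations makes the sum vanish outright;
    \<open>t_flip\<close> alone would only show that twice the sum is zero, which says nothing in
    characteristic 2.\<close>
  define A where "A = {p\<in>Z. sign p = 1}"
  define B where "B = {p\<in>Z. sign p = -1}"
  have ZAB: "Z = A \<union> B" "A \<inter> B = {}"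
  proof -
    have "sign p = 1 \<or> sign p = -1" for p :: "'m \<times> bool \<Rightarrow> 'm \<times> bool"
      by (rule sign_cases[of p]) auto
    thus "Z = A \<union> B" "A \<inter> B = {}" by (auto simp: A_def B_def)
  qed
  have bij: "bij_betw flip A B"
    by (rule bij_betw_byWitness[where f' = flip])
      (auto simp: A_def B_def flip_flip sgn_flip flip_Z)
  have fin: "finite A" "finite B" by auto
  have "(\<Sum>p\<in>Z. t p) = (\<Sum>p\<in>A. t p) + (\<Sum>p\<in>B. t p)"
    using ZAB fin by (simp add: sum.union_disjoint)
  also have "(\<Sum>p\<in>B. t p) = (\<Sum>p\<in>A. t (flip p))"
    by (rule sum.reindex_bij_betw[OF bij, symmetric])
  also have "\<dots> = - (\<Sum>p\<in>A. t p)"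
    by (simp add: A_def t_flip sum_negf)
  finally show ?thesis by (simp add: t_def)
qed

text \<open>\<open>\<Sigma>\<close> is a transversal: by \<open>bij\<close> it realizes each
  possible set of columns from \<open>T\<close> in the top layer exactly once. Every permutation in
  the vanishing sum \<open>exchange_signed_sum_zero\<close> factors uniquely as
  \<open>s \<circ> k\<close> with \<open>s\<close> in \<open>\<Sigma>\<close> and \<open>k\<close>
  layered, and for fixed \<open>s\<close> the sum over \<open>k\<close> is a product of two
  determinants.\<close>

lemma exchange_relation:
  fixes h :: "'m::finite \<times> bool \<Rightarrow> 'm \<Rightarrow> 'a::comm_ring_1"
  assumes T: "card T > CARD('m)"
    and perm: "\<And>s. s \<in> \<Sigma> \<Longrightarrow> s permutes T"
    and bij: "bij_betw (\<lambda>s. s ` (T \<inter> UNIV \<times> {True})) \<Sigma> {S. S \<subseteq> T \<and> card S = card (T \<inter> UNIV \<times> {True})}"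
  shows "(\<Sum>s\<in>\<Sigma>. of_int (sign s) * coldet (\<lambda>i. h (s (i, True))) * coldet (\<lambda>i. h (s (i, False)))) = 0"
proof -
  note [simp del] = split_paired_All split_paired_Ex
  define top where "top = (UNIV :: 'm set) \<times> {True}"
  define Z where "Z = {p. p permutes UNIV \<and> (\<forall>u. p u \<notin> T \<longrightarrow> snd (p u) = snd u)}"
  define t where "t p = of_int (sign p) * (\<Prod>u\<in>UNIV. h (p u) (fst u))" for p
  have permU: "s permutes UNIV" if "s \<in> \<Sigma>" for s
    using permutes_subset[OF perm[OF that]] by auto
  have top_int: "s ` top \<inter> T = s ` (T \<inter> top)" if "s \<in> \<Sigma>" for s
    using perm[OF that] by (auto simp: permutes_in_image)
  have top_diff: "s ` (top - T) = top - T" if "s \<in> \<Sigma>" for s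
    using perm[OF that] by (auto simp: permutes_not_in image_iff)
  have "bij_betw (\<lambda>(s, k). s \<circ> k) (\<Sigma> \<times> layered) Z"
    unfolding bij_betw_def
  proof (intro conjI inj_onI equalityI subsetI)
    fix x y assume x: "x \<in> \<Sigma> \<times> layered" and y: "y \<in> \<Sigma> \<times> layered"
      and eq: "(case x of (s, k) \<Rightarrow> s \<circ> k) = (case y of (s, k) \<Rightarrow> s \<circ> k)"
    obtain s k s' k' where xy: "x = (s, k)" "y = (s', k')" by (cases x; cases y)
    have k: "k \<in> layered" "k' \<in> layered" and s: "s \<in> \<Sigma>" "s' \<in> \<Sigma>" using x y xy by auto
    have kt: "k ` top = top" if "k \<in> layered" for k
    proof
      have sk: "\<And>u. snd (k u) = snd u" and surj: "surj k"
        using that permutes_surj[of k UNIV] by (simp_all add: layered_def)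
      have top: "u \<in> top \<longleftrightarrow> snd u" for u by (simp add: top_def mem_Times_iff)
      show "k ` top \<subseteq> top" by (simp add: image_subset_iff Ball_def top sk)
      show "top \<subseteq> k ` top"
      proof
        fix u assume "u \<in> top"
        obtain v where v: "u = k v"
          using surj by (metis surjD)
        have "snd v = snd u" by (simp add: v sk)
        thus "u \<in> k ` top" using v \<open>u \<in> top\<close> by (cases v) (auto simp: top_def)
      qed
    qed
    have "s ` top = s' ` top" 
    proof -
      have "(s \<circ> k) ` top = (s' \<circ> k') ` top" using eq xy by simp
      thus ?thesis by (simp only: image_comp[symmetric] kt[OF k(1)] kt[OF k(2)])
    qed
    hence "s ` (T \<inter> top) = s' ` (T \<inter> top)"
      using top_int[OF s(1)] top_int[OF s(2)] by simp
    with s have "s = s'" using inj_onD[OF bij_betw_imp_inj_on[OF bij]] by (simp add: top_def)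
    moreover have "k = k'"
    proof (rule ext)
      fix u
      have "s (k u) = s (k' u)" using eq unfolding xy \<open>s = s'\<close>[symmetric] by (simp add: fun_eq_iff)
      thus "k u = k' u" using permutes_inj[OF permU[OF s(1)]] by (simp add: inj_eq)
    qed
    ultimately show "x = y" using xy by simp
  next
    fix p assume "p \<in> (\<lambda>(s, k). s \<circ> k) ` (\<Sigma> \<times> layered)"
    then obtain s k where sk: "s \<in> \<Sigma>" "k \<in> layered" "p = s \<circ> k" by auto
    have "snd (p u) = snd u" if "p u \<notin> T" for u
    proof -
      have "k u \<notin> T" using that permutes_in_image[OF perm[OF sk(1)]] by (simp add: sk(3))
      hence "p u = k u" using permutes_not_in[OF perm[OF sk(1)]] by (simp add: sk(3))
      thus ?thesis using sk(2) unfolding layered_def by simp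
    qed
    moreover have "p permutes UNIV"
      using sk(2) permutes_compose[of k UNIV s] permU[OF sk(1)] by (simp add: layered_def sk(3))
    ultimately show "p \<in> Z" by (simp add: Z_def del: split_paired_All)
  next
    fix p assume p: "p \<in> Z"
    hence pU: "p permutes UNIV" and pT: "\<And>u. p u \<notin> T \<Longrightarrow> snd (p u) = snd u" unfolding Z_def by blast+
    have d: "p ` top - T = top - T"
    proof
      show "p ` top - T \<subseteq> top - T" using pT by (force simp: top_def mem_Times_iff)
      show "top - T \<subseteq> p ` top - T"
      proof
        fix u assume u: "u \<in> top - T"
        obtain v where v: "u = p v" using permutes_surj[OF pU] by (metis surjD)
        have "snd v = snd u" using pT[of v] v u by auto
        thus "u \<in> p ` top - T" using v u by (cases v) (auto simp: top_def)
      qed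
    qed
    have cp: "card (p ` top) = card top"
      by (rule card_image) (meson inj_on_subset permutes_inj[OF pU] subset_UNIV)
    have split: "card X = card (X \<inter> T) + card (X - T)" for X :: "('m \<times> bool) set"
      by (subst card_Un_disjoint[symmetric]) (auto intro: arg_cong[where f = card])
    \<comment> \<open>Outside \<open>T\<close> no column changes its layer, so \<open>p\<close> puts
      as many columns from \<open>T\<close> into the top layer as were there before; this subset
      selects the representative \<open>s\<close>.\<close>
    have "card (p ` top \<inter> T) = card (T \<inter> top)"
      using split[of top] split[of "p ` top"] d cp by (simp add: Int_commute)
    hence "p ` top \<inter> T \<in> (\<lambda>s. s ` (T \<inter> top)) ` \<Sigma>"
      unfolding bij_betw_imp_surj_on[OF bij, folded top_def] by simp
    then obtain s where s: "s \<in> \<Sigma>" "s ` (T \<inter> top) = p ` top \<inter> T"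
      by (elim imageE) simp
    have st: "s ` top = p ` top"
    proof -
      have "s ` top = s ` (T \<inter> top) \<union> s ` (top - T)" by blast
      also have "\<dots> = p ` top" using s(2) top_diff[OF s(1)] d by auto
      finally show ?thesis .
    qed
    define k where "k = inv s \<circ> p"
    have sp: "s permutes UNIV" using permU s by auto
    have pk: "p = s \<circ> k" using permutes_inv_o(1)[OF sp] by (simp add: k_def comp_assoc[symmetric])
    have kU: "k permutes UNIV" unfolding k_def by (intro permutes_compose pU permutes_inv sp)
    have "k u \<in> top \<longleftrightarrow> u \<in> top" for u
    proof -
      have "k u \<in> top \<longleftrightarrow> s (k u) \<in> s ` top"
        using permutes_inj[OF sp] by (simp add: inj_image_mem_iff)
      also have "\<dots> \<longleftrightarrow> p u \<in> p ` top" by (simp add: st pk)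
      also have "\<dots> \<longleftrightarrow> u \<in> top" using permutes_inj[OF pU] by (simp add: inj_image_mem_iff)
      finally show ?thesis .
    qed
    hence "snd (k u) = snd u" for u by (simp add: top_def mem_Times_iff) 
    hence "k \<in> layered" using kU by (simp add: layered_def del: split_paired_All)
    thus "p \<in> (\<lambda>(s, k). s \<circ> k) ` (\<Sigma> \<times> layered)"
      using s(1) pk by (intro image_eqI[of _ _ "(s, k)"]) simp_all
  qed
  from sum.reindex_bij_betw[OF this, of t]
  have "(\<Sum>(s, k)\<in>\<Sigma> \<times> layered. t (s \<circ> k)) = (\<Sum>p\<in>Z. t p)"
    by (simp only: split_def)
  also have "\<dots> = 0" unfolding t_def Z_def by (rule exchange_signed_sum_zero[OF T])
  finally have "(\<Sum>s\<in>\<Sigma>. \<Sum>k\<in>layered. t (s \<circ> k)) = 0" by (simp add: sum.cartesian_product)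
  moreover have "(\<Sum>k\<in>layered. t (s \<circ> k)) =
      of_int (sign s) * coldet (\<lambda>i. h (s (i, True))) * coldet (\<lambda>i. h (s (i, False)))"
    if "s \<in> \<Sigma>" for s
  proof -
    have ps: "permutation s" by (rule permutes_imp_permutation[OF finite permU[OF that]])
    have "(\<Sum>k\<in>layered. t (s \<circ> k)) =
      (\<Sum>k\<in>layered. of_int (sign s) * (of_int (sign k) * (\<Prod>u\<in>UNIV. (\<lambda>u. h (s u)) (k u) (fst u))))"
    proof (rule sum.cong[OF refl])
      fix k :: "'m \<times> bool \<Rightarrow> 'm \<times> bool" assume "k \<in> layered"
      hence "k permutes UNIV" unfolding layered_def by blast
      hence "permutation k" by (rule permutes_imp_permutation[OF finite])
      thus "t (s \<circ> k) = of_int (sign s) * (of_int (sign k) * (\<Prod>u\<in>UNIV. (\<lambda>u. h (s u)) (k u) (fst u)))"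
        by (simp add: t_def sign_compose ps mult.assoc)
    qed
    also have "\<dots> = of_int (sign s) * (coldet (\<lambda>i. h (s (i, True))) * coldet (\<lambda>i. h (s (i, False))))"
      by (subst sum_distrib_left[symmetric], subst coldet_mult_expand) simp
    finally show ?thesis by (simp add: mult.assoc)
  qed
  ultimately show ?thesis by simp
qed

text \<open>Splitting quantifiers over positions makes the automation loop.\<close>

declare split_paired_All [simp del] split_paired_Ex [simp del]

lemma ex_permutes_image_eq:
  assumes "finite T" "A \<subseteq> T" "S \<subseteq> T" "card S = card A"
  shows "\<exists>s. s permutes T \<and> s ` A = S"
proof -
  have fin: "finite A" "finite S" using assms finite_subset by auto
  obtain f where f: "bij_betw f A S"
    using finite_same_card_bij[OF fin] assms(4) by auto
  have "card (T - A) = card (T - S)"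
    using assms fin by (simp add: card_Diff_subset)
  then obtain g where g: "bij_betw g (T - A) (T - S)"
    using finite_same_card_bij[of "T - A" "T - S"] assms(1) by auto
  define s where "s x = (if x \<in> A then f x else if x \<in> T then g x else x)" for x
  have "bij_betw s A S" using f by (rule bij_betw_cong[THEN iffD1, rotated]) (simp add: s_def)
  moreover have "bij_betw s (T - A) (T - S)"
    using g by (rule bij_betw_cong[THEN iffD1, rotated]) (simp add: s_def)
  ultimately have "bij_betw s (A \<union> (T - A)) (S \<union> (T - S))"
    by (rule bij_betw_combine) auto
  hence "bij_betw s T T" using assms(2,3) by (simp add: Un_absorb1)
  hence "s permutes T" by (rule bij_imp_permutes) (use assms(2) in \<open>auto simp: s_def\<close>)
  moreover have "s ` A = S" using \<open>bij_betw s A S\<close> by (simp add: bij_betw_def)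
  ultimately show ?thesis by blast
qed

text \<open>The form used for straightening: the transversal is chosen to contain the identity for
  the set \<open>P \<times> {True}\<close> itself, so the trivial shuffle can be isolated, and all
  remaining shuffles really move this set.\<close>

lemma coldet_exchange:
  fixes h :: "'m::finite \<times> bool \<Rightarrow> 'm \<Rightarrow> 'a::comm_ring_1"
  assumes PQ: "card P + card Q > CARD('m)"
  defines "T \<equiv> P \<times> {True} \<union> Q \<times> {False}"
  obtains \<Sigma> where "\<And>s. s \<in> \<Sigma> \<Longrightarrow> s permutes T" "\<And>s. s \<in> \<Sigma> \<Longrightarrow> s ` (P \<times> {True}) \<noteq> P \<times> {True}"
    "coldet (\<lambda>i. h (i, True)) * coldet (\<lambda>i. h (i, False)) =
     (\<Sum>s\<in>\<Sigma>. of_int (- sign s) * (coldet (\<lambda>i. h (s (i, True))) * coldet (\<lambda>i. h (s (i, False)))))"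
proof -
  define A where "A = P \<times> {True}"
  define F where "F = {S. S \<subseteq> T \<and> card S = card A}"
  have A: "T \<inter> UNIV \<times> {True} = A" by (auto simp: T_def A_def)
  have "card T = card P + card Q"
    unfolding T_def by (subst card_Un_disjoint) (auto simp: card_cartesian_product)
  hence T: "card T > CARD('m)" using PQ by simp
  have AF: "A \<in> F" by (auto simp: F_def A_def T_def)
  have "\<forall>S\<in>F. \<exists>s. s permutes T \<and> s ` A = S \<and> (S = A \<longrightarrow> s = id)"
  proof
    fix S assume S: "S \<in> F"
    show "\<exists>s. s permutes T \<and> s ` A = S \<and> (S = A \<longrightarrow> s = id)"
    proof (cases "S = A")
      case True thus ?thesis by (intro exI[of _ id]) (auto simp: permutes_id)
    next
      case False
      have "A \<subseteq> T" by (auto simp: A_def T_def)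
      thus ?thesis using ex_permutes_image_eq[of T A S] S False by (auto simp: F_def)
    qed
  qed
  then obtain r where r: "\<And>S. S \<in> F \<Longrightarrow> r S permutes T" "\<And>S. S \<in> F \<Longrightarrow> r S ` A = S" "r A = id"
    using AF by metis
  have inj: "inj_on r F" by (rule inj_on_inverseI[where g = "\<lambda>s. s ` A"]) (simp add: r)
  define E where "E s = of_int (sign s) * coldet (\<lambda>i. h (s (i, True))) * coldet (\<lambda>i. h (s (i, False)))" for s
  have "(\<Sum>s\<in>r ` F. E s) = 0" unfolding E_def
  proof (rule exchange_relation[OF T])
    show "bij_betw (\<lambda>s. s ` (T \<inter> UNIV \<times> {True})) (r ` F) {S. S \<subseteq> T \<and> card S = card (T \<inter> UNIV \<times> {True})}"
      unfolding A F_def[symmetric] using r(2) by (auto simp: bij_betw_def inj_on_def image_image)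
  qed (use r(1) in auto)
  moreover have "r ` F = insert id (r ` (F - {A}))" using AF r(3) by (metis insert_Diff image_insert)
  moreover have "id \<notin> r ` (F - {A})"
  proof
    assume "id \<in> r ` (F - {A})"
    then obtain S where S: "S \<in> F" "S \<noteq> A" "r S = id" by (elim imageE DiffE) (metis singletonI)
    with r(2)[OF S(1)] show False by simp
  qed
  ultimately have "E id + (\<Sum>s\<in>r ` (F - {A}). E s) = 0" by (simp add: sum.insert)
  hence "E id = (\<Sum>s\<in>r ` (F - {A}). - E s)" by (simp add: sum_negf eq_neg_iff_add_eq_0)
  moreover have "E id = coldet (\<lambda>i. h (i, True)) * coldet (\<lambda>i. h (i, False))" by (simp add: E_def)
  ultimately have "coldet (\<lambda>i. h (i, True)) * coldet (\<lambda>i. h (i, False)) =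
     (\<Sum>s\<in>r ` (F - {A}). of_int (- sign s) * (coldet (\<lambda>i. h (s (i, True))) * coldet (\<lambda>i. h (s (i, False)))))"
    by (simp add: E_def mult.assoc)
  moreover have "s permutes T" "s ` A \<noteq> A" if "s \<in> r ` (F - {A})" for s
    using that r by auto
  ultimately show thesis using that[of "r ` (F - {A})"] by (auto simp: A_def)
qed

text \<open>The case in which \<open>T\<close> consists of all columns of \<open>f\<close> and one
  column of \<open>g\<close>. Subsets of size m are complements of points, so the identity and the
  transpositions with \<open>(s, False)\<close> form a transversal.\<close>

lemma coldet_single_exchange:
  fixes f g :: "'m::finite \<Rightarrow> 'm \<Rightarrow> 'a::comm_ring_1"
  shows "coldet f * coldet g = (\<Sum>l\<in>UNIV. coldet (f(l := g s)) * coldet (g(s := f l)))"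
proof -
  define h where "h u = (if snd u then f (fst u) else g (fst u))" for u
  define T where "T = insert (s, False) ((UNIV :: 'm set) \<times> {True})"
  define \<tau> where "\<tau> l = Transposition.transpose (l, True) (s, False)" for l
  define E where "E s = of_int (sign s) * coldet (\<lambda>i. h (s (i, True))) * coldet (\<lambda>i. h (s (i, False)))" for s
  have A: "T \<inter> UNIV \<times> {True} = UNIV \<times> {True}" by (auto simp: T_def)
  have T: "card T = Suc CARD('m)" by (auto simp: T_def card_cartesian_product)
  have \<tau>_image: "\<tau> l ` (UNIV \<times> {True}) = T - {(l, True)}" for l
    by (auto simp: \<tau>_def T_def Transposition.transpose_def image_iff)
  have id_notin: "id \<notin> range \<tau>"
  proof
    assume "id \<in> range \<tau>"
    then obtain l where "id = \<tau> l" by auto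
    hence "id (l, True) = \<tau> l (l, True)" by simp
    thus False by (simp add: \<tau>_def)
  qed
  have inj: "inj \<tau>"
  proof (rule injI)
    fix l l' assume "\<tau> l = \<tau> l'"
    hence "\<tau> l (s, False) = \<tau> l' (s, False)" by simp
    thus "l = l'" by (simp add: \<tau>_def)
  qed
  have "(\<Sum>s\<in>insert id (range \<tau>). E s) = 0" unfolding E_def
  proof (rule exchange_relation)
    show "card T > CARD('m)" by (simp add: T)
    show "s permutes T" if "s \<in> insert id (range \<tau>)" for s
      using that by (auto simp: \<tau>_def T_def permutes_id intro!: permutes_swap_id)
    have "inj_on (\<lambda>s. s ` (UNIV \<times> {True})) (insert id (range \<tau>))"
    proof (rule inj_onI)
      fix a b assume ab: "a \<in> insert id (range \<tau>)" "b \<in> insert id (range \<tau>)"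
        "a ` (UNIV \<times> {True}) = b ` (UNIV \<times> {True})"
      have id_image: "id ` (UNIV \<times> {True}) = T - {(s, False)}" by (auto simp: T_def)
      have "\<exists>x\<in>T. c ` (UNIV \<times> {True}) = T - {x} \<and> c = (if snd x then \<tau> (fst x) else id)"
        if c: "c \<in> insert id (range \<tau>)" for c
      proof (cases "c = id")
        case True
        thus ?thesis using id_image by (intro bexI[of _ "(s, False)"]) (simp_all add: T_def)
      next
        case False
        then obtain l where "c = \<tau> l" using c by blast
        thus ?thesis using \<tau>_image by (intro bexI[of _ "(l, True)"]) (simp_all add: T_def)
      qed
      from this[OF ab(1)] this[OF ab(2)] obtain x y where
        x: "x \<in> T" "a ` (UNIV \<times> {True}) = T - {x}" "a = (if snd x then \<tau> (fst x) else id)" and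
        y: "y \<in> T" "b ` (UNIV \<times> {True}) = T - {y}" "b = (if snd y then \<tau> (fst y) else id)" by metis
      have "x = y" using x(1,2) y(1,2) ab(3) by blast
      thus "a = b" using x(3) y(3) by simp
    qed
    moreover have "S \<in> (\<lambda>s. s ` (UNIV \<times> {True})) ` insert id (range \<tau>)"
      if S: "S \<subseteq> T" "card S = CARD('m)" for S
    proof -
      have "card (T - S) = 1" using S by (simp add: card_Diff_subset finite_subset T)
      then obtain x where x: "T - S = {x}" by (auto simp: card_1_singleton_iff)
      hence Sx: "S = T - {x}" and xT: "x \<in> T" using S(1) by auto
      show ?thesis
      proof (cases "x = (s, False)")
        case True
        hence "S = id ` (UNIV \<times> {True})" using Sx by (auto simp: T_def)
        thus ?thesis by blast
      next
        case False
        then obtain l where "x = (l, True)" using xT by (auto simp: T_def)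
        thus ?thesis using \<tau>_image Sx by blast
      qed
    qed
    moreover have "c ` (UNIV \<times> {True}) \<subseteq> T \<and> card (c ` (UNIV \<times> {True})) = CARD('m)"
      if c: "c \<in> insert id (range \<tau>)" for c
    proof (cases "c = id")
      case True
      thus ?thesis by (simp add: T_def card_cartesian_product subset_insertI)
    next
      case False
      then obtain l where "c = \<tau> l" using c by blast
      moreover have "card (T - {(l, True)}) = CARD('m)" by (subst card_Diff_singleton) (simp_all add: T_def T[unfolded T_def])
      ultimately show ?thesis using \<tau>_image[of l] by simp
    qed
    ultimately show "bij_betw (\<lambda>s. s ` (T \<inter> UNIV \<times> {True})) (insert id (range \<tau>))
       {S. S \<subseteq> T \<and> card S = card (T \<inter> UNIV \<times> {True})}"
      unfolding A bij_betw_def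
    proof (intro conjI equalityI subsetI)
      assume inj: "inj_on (\<lambda>s. s ` (UNIV \<times> {True})) (insert id (range \<tau>))"
      show "inj_on (\<lambda>s. s ` (UNIV \<times> {True})) (insert id (range \<tau>))" by (rule inj)
    next
      assume *: "\<And>S. S \<subseteq> T \<Longrightarrow> card S = CARD('m) \<Longrightarrow> S \<in> (\<lambda>s. s ` (UNIV \<times> {True})) ` insert id (range \<tau>)"
      fix S assume "S \<in> {S. S \<subseteq> T \<and> card S = card (UNIV \<times> {True} :: ('m \<times> bool) set)}"
      thus "S \<in> (\<lambda>s. s ` (UNIV \<times> {True})) ` insert id (range \<tau>)"
        by (intro *) (simp_all add: card_cartesian_product)
    next
      assume *: "\<And>c. c \<in> insert id (range \<tau>) \<Longrightarrow>
        c ` (UNIV \<times> {True}) \<subseteq> T \<and> card (c ` (UNIV \<times> {True})) = CARD('m)"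
      fix S assume "S \<in> (\<lambda>s. s ` (UNIV \<times> {True})) ` insert id (range \<tau>)"
      thus "S \<in> {S. S \<subseteq> T \<and> card S = card (UNIV \<times> {True} :: ('m \<times> bool) set)}"
        using * by (elim imageE) (simp add: card_cartesian_product)
    qed
  qed
  hence "E id + (\<Sum>l\<in>UNIV. E (\<tau> l)) = 0"
    using id_notin inj by (simp add: sum.insert sum.reindex)
  moreover have "E id = coldet f * coldet g" by (simp add: E_def h_def)
  moreover have "E (\<tau> l) = - (coldet (f(l := g s)) * coldet (g(s := f l)))" for l
  proof -
    have "(\<lambda>i. h (\<tau> l (i, True))) = f(l := g s)" "(\<lambda>i. h (\<tau> l (i, False))) = g(s := f l)"
      by (auto simp: h_def \<tau>_def Transposition.transpose_def)
    thus ?thesis by (simp add: E_def \<tau>_def sign_swap_id)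
  qed
  ultimately show ?thesis by (simp add: sum_negf)
qed

section \<open>Leading monomials\<close>

abbreviation "lookup \<equiv> Poly_Mapping.lookup"
abbreviation "keys \<equiv> Poly_Mapping.keys"

text \<open>The index types carry no order. An arbitrary enumeration starting at 0 supplies one, and
  all notions of diagonal, first columns or increasing columns refer to it; the ideal itself is
  defined without it.\<close>

definition rk :: "'a::finite \<Rightarrow> nat" where
  "rk = (SOME f. bij_betw f UNIV {..<CARD('a)})"

lemma bij_rk: "bij_betw (rk :: 'a::finite \<Rightarrow> nat) UNIV {..<CARD('a)}"
proof -
  have "\<exists>f :: 'a \<Rightarrow> nat. bij_betw f UNIV {..<CARD('a)}"
    by (metis ex_bij_betw_finite_nat finite lessThan_atLeast0)
  thus ?thesis unfolding rk_def by (rule someI_ex)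
qed

lemma rk_eq_iff [simp]: "rk x = rk y \<longleftrightarrow> x = y"
  using bij_rk by (metis bij_betw_imp_inj_on injD)

lemma rk_less: "rk (x :: 'a::finite) < CARD('a)"
  using bij_betwE[OF bij_rk] by blast

definition unrk :: "nat \<Rightarrow> 'a::finite" where
  "unrk = inv rk"

lemma unrk_rk [simp]: "unrk (rk x) = x"
  by (simp add: unrk_def inv_f_f inj_def)

lemma rk_unrk [simp]: "k < CARD('a) \<Longrightarrow> rk (unrk k :: 'a::finite) = k"
  unfolding unrk_def by (rule f_inv_into_f) (use bij_rk in \<open>auto simp: bij_betw_def\<close>)

text \<open>As \<open>(i, j) \<mapsto> i j\<close> is strictly supermodular, the unique monomial of largest weight of a minor is its diagonal
  (\<open>strict_rearrangement\<close>).\<close>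

definition wt :: "('m::finite \<times> 'n::finite \<Rightarrow>\<^sub>0 nat) \<Rightarrow> nat" where
  "wt v = (\<Sum>u\<in>UNIV. lookup v u * (Suc (rk (fst u)) * Suc (rk (snd u))))"

lemma wt_add: "wt (v + w) = wt v + wt w"
  by (simp add: wt_def lookup_add sum.distrib distrib_right)

lemma wt_zero [simp]: "wt 0 = 0"
  by (simp add: wt_def)

lemma wt_single: "wt (Poly_Mapping.single (i, j) k) = k * (Suc (rk i) * Suc (rk j))"
proof -
  have "wt (Poly_Mapping.single (i, j) k) =
    (\<Sum>u\<in>UNIV. if u = (i, j) then k * (Suc (rk (fst u)) * Suc (rk (snd u))) else 0)"
    unfolding wt_def by (intro sum.cong refl) (auto simp: lookup_single when_def)
  thus ?thesis by (simp add: sum.delta)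
qed

lemma wt_sum: "wt (\<Sum>a\<in>A. v a) = (\<Sum>a\<in>A. wt (v a))"
  by (induction A rule: infinite_finite_induct) (simp_all add: wt_add)

definition low :: "nat \<Rightarrow> ('m::finite, 'n::finite, 'k::comm_ring_1) gpoly set" where
  "low c = {g. \<forall>v. lookup g v \<noteq> 0 \<longrightarrow> wt v < c}"

lemma low_zero [simp]: "0 \<in> low c"
  by (simp add: low_def)

lemma low_add: "g \<in> low c \<Longrightarrow> h \<in> low c \<Longrightarrow> g + h \<in> low c"
  by (auto simp: low_def lookup_add) (metis add.right_neutral)

lemma low_uminus: "g \<in> low c \<Longrightarrow> - g \<in> low c"
  by (auto simp: low_def)

lemma low_sum: "(\<And>a. a \<in> A \<Longrightarrow> g a \<in> low c) \<Longrightarrow> (\<Sum>a\<in>A. g a) \<in> low c"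
  by (induction A rule: infinite_finite_induct) (auto intro: low_add)

lemma low_mono: "g \<in> low c \<Longrightarrow> c \<le> d \<Longrightarrow> g \<in> low d"
  by (force simp: low_def)

text \<open>\<open>low (Suc c)\<close> means weight at most \<open>c\<close>; a strict bound on one
  factor is enough.\<close>

lemma low_mult:
  assumes "g \<in> low (Suc c)" "h \<in> low d"
  shows "g * h \<in> low (c + d)"
proof -
  have "wt v < c + d" if "lookup (g * h) v \<noteq> 0" for v
  proof -
    have "v \<in> keys (g * h)" using that by (simp add: in_keys_iff)
    then obtain a b where ab: "v = a + b" "a \<in> keys g" "b \<in> keys h" using keys_mult by blast
    hence "wt a < Suc c" "wt b < d" using assms by (auto simp: low_def in_keys_iff)
    thus ?thesis by (simp add: ab wt_add)
  qed
  thus ?thesis by (simp add: low_def)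
qed

lemma low_single: "wt v < c \<Longrightarrow> Poly_Mapping.single v a \<in> low c"
  by (auto simp: low_def lookup_single when_def)

text \<open>\<open>lt g v\<close>: the monomial \<open>v\<close> occurs in \<open>g\<close> with coefficient \<open>1\<close>, all others have smaller weight. The weight is not a
  total order on monomials, so this is not available for every \<open>g\<close>.\<close>

definition lt :: "('m::finite, 'n::finite, 'k::comm_ring_1) gpoly \<Rightarrow> ('m \<times> 'n \<Rightarrow>\<^sub>0 nat) \<Rightarrow> bool" where
  "lt g v \<longleftrightarrow> g - Poly_Mapping.single v 1 \<in> low (wt v)"

lemma lt_single: "lt (Poly_Mapping.single v 1) v"
  by (simp add: lt_def)

lemma lt_one: "lt 1 0"
  using lt_single[of 0] by simp

lemma lt_low: "lt g v \<Longrightarrow> g \<in> low (Suc (wt v))"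
proof -
  assume "lt g v"
  hence "(g - Poly_Mapping.single v 1) + Poly_Mapping.single v 1 \<in> low (Suc (wt v))"
    unfolding lt_def by (intro low_add low_single) (auto elim: low_mono)
  thus ?thesis by simp
qed

lemma lt_mult:
  assumes "lt g v" "lt h w"
  shows "lt (g * h) (v + w)"
proof -
  have "g * h - Poly_Mapping.single (v + w) 1 =
    g * (h - Poly_Mapping.single w 1) + Poly_Mapping.single w 1 * (g - Poly_Mapping.single v 1)"
    by (simp add: algebra_simps mult_single)
  moreover have "g * (h - Poly_Mapping.single w 1) \<in> low (wt v + wt w)"
    using lt_low[OF assms(1)] assms(2) by (intro low_mult) (simp_all add: lt_def)
  moreover have "Poly_Mapping.single w 1 * (g - Poly_Mapping.single v 1) \<in> low (wt w + wt v)"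
    using assms(1) by (intro low_mult low_single) (simp_all add: lt_def)
  ultimately show ?thesis by (auto simp: lt_def wt_add add.commute intro: low_add)
qed

lemma lt_prod: "(\<And>a. a \<in> A \<Longrightarrow> lt (g a) (v a)) \<Longrightarrow> lt (\<Prod>a\<in>A. g a) (\<Sum>a\<in>A. v a)"
  by (induction A rule: infinite_finite_induct) (auto simp: lt_one[simplified] intro: lt_mult)

lemma lt_power: "lt g v \<Longrightarrow> lt (g ^ k) (\<Sum>i<k. v)"
  using lt_prod[of "{..<k}" "\<lambda>_. g" "\<lambda>_. v"] by simp

lemma lt_lookup:
  assumes "lt g v" "wt v \<le> wt w"
  shows "lookup g w = (if w = v then 1 else 0)"
proof -
  have "lookup (g - Poly_Mapping.single v 1) w = 0"
    using assms by (auto simp: lt_def low_def not_less)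
  thus ?thesis by (auto simp: lookup_minus lookup_single when_def split: if_splits)
qed

lemma lookup_single_zero_mult:
  fixes s :: "('v::monoid_add) \<Rightarrow>\<^sub>0 'k::comm_ring_1"
  shows "lookup (Poly_Mapping.single 0 c * s) w = c * lookup s w"
  by (simp add: mult_map_scale_conv_mult[symmetric] Poly_Mapping.map.rep_eq when_def)

text \<open>At an exponent at least as heavy as all leading monomials the lower terms are invisible,
  and distinct leading monomials leave at most one contribution.\<close>

lemma lt_combination_lookup:
  fixes s :: "'b \<Rightarrow> ('m::finite, 'n::finite, 'k::comm_ring_1) gpoly"
  assumes F: "finite F" and lt: "\<And>a. a \<in> F \<Longrightarrow> lt (s a) (v a)" and inj: "inj_on v F"
    and W: "\<And>a. a \<in> F \<Longrightarrow> wt (v a) \<le> wt w"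
  shows "lookup (\<Sum>a\<in>F. Poly_Mapping.single 0 (c a) * s a) w = (\<Sum>a\<in>{a\<in>F. v a = w}. c a)"
    and "b \<in> F \<Longrightarrow> v b = w \<Longrightarrow> lookup (\<Sum>a\<in>F. Poly_Mapping.single 0 (c a) * s a) w = c b"
proof -
  have "lookup (\<Sum>a\<in>F. Poly_Mapping.single 0 (c a) * s a) w = (\<Sum>a\<in>F. if v a = w then c a else 0)"
    unfolding lookup_sum lookup_single_zero_mult
    by (intro sum.cong refl) (auto simp: lt_lookup[OF lt W])
  also have "\<dots> = (\<Sum>a\<in>{a\<in>F. v a = w}. c a)"
    by (simp add: sum.inter_filter F)
  finally show *: "lookup (\<Sum>a\<in>F. Poly_Mapping.single 0 (c a) * s a) w = (\<Sum>a\<in>{a\<in>F. v a = w}. c a)" .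
  assume "b \<in> F" "v b = w"
  hence "{a\<in>F. v a = w} = {b}" using inj by (auto simp: inj_on_def)
  thus "lookup (\<Sum>a\<in>F. Poly_Mapping.single 0 (c a) * s a) w = c b" unfolding * by simp
qed

text \<open>The summands of maximal weight cannot cancel, since their leading monomials differ. Each
  is therefore visible in the sum, whose only monomial of top weight is \<open>w\<close>. This gives
  weight control over a linear combination after the fact.\<close>

lemma lt_combination_bound:
  fixes s :: "'b \<Rightarrow> ('m::finite, 'n::finite, 'k::comm_ring_1) gpoly"
  assumes F: "finite F" and lt: "\<And>a. a \<in> F \<Longrightarrow> lt (s a) (v a)" and inj: "inj_on v F"
    and c: "\<And>a. a \<in> F \<Longrightarrow> c a \<noteq> 0"
    and g: "lt (\<Sum>a\<in>F. Poly_Mapping.single 0 (c a) * s a) w" and b: "b \<in> F"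
  shows "v b = w \<or> wt (v b) < wt w"
proof -
  let ?g = "\<Sum>a\<in>F. Poly_Mapping.single 0 (c a) * s a"
  obtain a where a: "a \<in> F" "\<And>b. b \<in> F \<Longrightarrow> wt (v b) \<le> wt (v a)"
  proof -
    have "Max ((\<lambda>a. wt (v a)) ` F) \<in> (\<lambda>a. wt (v a)) ` F" using F b by (intro Max_in) auto
    then obtain a where "a \<in> F" "Max ((\<lambda>a. wt (v a)) ` F) = wt (v a)" by blast
    thus thesis using that[of a] F by (metis Max_ge finite_imageI imageI)
  qed
  have va: "lookup ?g (v a') = c a'" if "a' \<in> F" "wt (v a') = wt (v a)" for a'
    using that a by (intro lt_combination_lookup(2)[OF F lt inj]) auto
  have le: "v a' = w \<or> wt (v a') < wt w" if "a' \<in> F" "wt (v a') = wt (v a)" for a'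
    using va[OF that] c[OF that(1)] lt_lookup[OF g, of "v a'"] by (auto split: if_splits)
  have "wt (v a) = wt w"
  proof (rule ccontr)
    assume "wt (v a) \<noteq> wt w"
    hence "wt (v a) < wt w" using le[OF a(1)] by auto
    hence "lookup ?g w = (\<Sum>a\<in>{a\<in>F. v a = w}. c a)" 
      using a(2) by (intro lt_combination_lookup(1)[OF F lt inj]) force+
    also have "{a\<in>F. v a = w} = {}" using a(2) \<open>wt (v a) < wt w\<close> by force
    finally show False using lt_lookup[OF g order.refl] by simp
  qed
  thus ?thesis using le[OF b] a(2)[OF b] by force
qed

section \<open>Diagonals as leading monomials of minors\<close>

definition expm :: "('m::finite \<Rightarrow> 'n) \<Rightarrow> ('m \<times> 'n \<Rightarrow>\<^sub>0 nat)" where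
  "expm f = (\<Sum>i\<in>UNIV. Poly_Mapping.single (i, f i) 1)"

lemma lookup_expm: "lookup (expm f) (i, j) = (if j = f i then 1 else 0)"
proof -
  have "lookup (expm f) (i, j) = (\<Sum>i'\<in>UNIV. if i' = i then (if j = f i then 1 else 0) else 0)"
    unfolding expm_def lookup_sum by (intro sum.cong refl) (auto simp: lookup_single when_def)
  thus ?thesis by (simp add: sum.delta)
qed

lemma wt_expm: "wt (expm f) = (\<Sum>i\<in>UNIV. Suc (rk i) * Suc (rk (f i)))"
  by (simp add: expm_def wt_sum wt_single)

lemma prod_single:
  "(\<Prod>a\<in>A. Poly_Mapping.single (v a) (1 :: 'k::comm_ring_1)) = Poly_Mapping.single (\<Sum>a\<in>A. v a :: 'v::comm_monoid_add) 1"
  by (induction A rule: infinite_finite_induct) (simp_all add: mult_single)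

lemma prod_var: "(\<Prod>i\<in>UNIV. var i (f i)) = Poly_Mapping.single (expm f) (1 :: 'k::comm_ring_1)"
  by (simp add: var_def prod_single expm_def)

text \<open>Any permutation other than the identity is strictly improved by a transposition that
  repairs its first non-fixed index, so the maximum over the finite set of permutations is attained
  only at the identity. The sequence \<open>b\<close> is left general because minors and
  \<open>corner_minor\<close> need different ones.\<close>

lemma strict_rearrangement:
  fixes b :: "'m::finite \<Rightarrow> nat"
  assumes b: "\<And>i j. rk i < rk j \<Longrightarrow> b i < b j" and p: "p permutes UNIV" "p \<noteq> id"
  shows "(\<Sum>i\<in>UNIV. Suc (rk i) * b (p i)) < (\<Sum>i\<in>UNIV. Suc (rk i) * b i)"
proof -
  define V where "V q = (\<Sum>i\<in>UNIV. Suc (rk i) * b (q i))" for q :: "'m \<Rightarrow> 'm"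
  have step: "\<exists>q'. q' permutes UNIV \<and> V q < V q'" if q: "q permutes UNIV" "q \<noteq> id" for q
  proof -
    have "\<exists>i. q i \<noteq> i" using q(2) by (auto simp: fun_eq_iff)
    then obtain i where i: "q i \<noteq> i" "\<And>j. q j \<noteq> j \<Longrightarrow> rk i \<le> rk j"
      using ex_has_least_nat[of "\<lambda>i. q i \<noteq> i" _ "rk :: 'm \<Rightarrow> nat"] by blast
    have injq: "q x = q y \<longleftrightarrow> x = y" for x y using permutes_inj[OF q(1)] by (simp add: inj_eq)
    obtain i' where i': "q i' = i" using permutes_surj[OF q(1)] by (metis surjD)
    have "q (q i) \<noteq> q i" using i(1) by (simp add: injq)
    hence 1: "rk i < rk (q i)" using i by (metis le_neq_implies_less rk_eq_iff)
    have "q i' \<noteq> i'" using i(1) i' by metis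
    hence 2: "rk i < rk i'" using i(2)[of i'] i' by (metis le_neq_implies_less rk_eq_iff)
    define q' where "q' = q \<circ> Transposition.transpose i i'"
    have q'p: "q' permutes UNIV" unfolding q'_def by (rule permutes_compose[OF permutes_swap_id q(1)]) auto
    have ne: "i' \<noteq> i" using 2 by auto
    have U: "(UNIV :: 'm set) = insert i (insert i' (UNIV - {i, i'}))" by auto
    have split: "V r = Suc (rk i) * b (r i) + (Suc (rk i') * b (r i') +
       (\<Sum>j\<in>UNIV - {i, i'}. Suc (rk j) * b (r j)))" for r
      unfolding V_def by (subst U) (use ne in \<open>simp add: sum.insert del: insert_UNIV\<close>)
    have rest: "(\<Sum>j\<in>UNIV - {i, i'}. Suc (rk j) * b (q' j)) = (\<Sum>j\<in>UNIV - {i, i'}. Suc (rk j) * b (q j))"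
      by (intro sum.cong refl) (auto simp: q'_def transpose_apply_other)
    obtain d where d: "rk i' = rk i + d" "d > 0" using 2 less_imp_add_positive by metis
    obtain e where e: "b (q i) = b i + e" "e > 0" using b[OF 1] less_imp_add_positive by metis
    have "V q < V q'"
      unfolding split[of q] split[of q'] rest using d e i' by (simp add: q'_def algebra_simps)
    thus ?thesis using q'p by blast
  qed
  have fin: "finite (V ` {q. q permutes UNIV})" by simp
  have "V p \<in> V ` {q. q permutes UNIV}" using p(1) by blast
  then obtain q where q: "q permutes UNIV" "Max (V ` {q. q permutes UNIV}) = V q"
    using Max_in[OF fin] by blast
  have max: "V r \<le> V q" if "r permutes UNIV" for r
    using Max_ge[OF fin, of "V r"] that q(2) by simp
  have "q = id" using step[OF q(1)] max by (metis not_le)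
  moreover from step[OF p] obtain p' where "p' permutes UNIV" "V p < V p'" by blast
  ultimately have "V p < V id" using max[of p'] by simp
  thus ?thesis by (simp add: V_def)
qed

definition incr :: "('m::finite \<Rightarrow> 'n::finite) \<Rightarrow> bool" where
  "incr f \<longleftrightarrow> (\<forall>i j. rk i < rk j \<longrightarrow> rk (f i) < rk (f j))"

lemma incr_inj: "incr f \<Longrightarrow> inj f"
  unfolding incr_def inj_def by (metis less_irrefl linorder_neqE_nat rk_eq_iff)

lemma max_minor_coldet: "max_minor f = coldet (\<lambda>j i. var i (f j))"
  by (simp add: max_minor_def det_eq_coldet)

lemma of_int_sign_single: "of_int (sign p) * x = (if sign p = 1 then x else - x :: 'a::comm_ring_1)"
  by (rule sign_cases[of p]) simp_all

lemma lt_max_minor: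
  assumes "incr (f :: 'm::finite \<Rightarrow> 'n::finite)"
  shows "lt (max_minor f :: ('m, 'n, 'k::comm_ring_1) gpoly) (expm f)"
proof -
  let ?t = "\<lambda>p. of_int (sign p) * Poly_Mapping.single (expm (\<lambda>i. f (p i))) (1::'k)"
  have "max_minor f = (\<Sum>p | p permutes (UNIV :: 'm set). ?t p)"
    by (simp add: max_minor_coldet coldet_def prod_var)
  also have "\<dots> = ?t id + (\<Sum>p\<in>{p. p permutes (UNIV :: 'm set)} - {id}. ?t p)"
    by (rule sum.remove) (auto simp: permutes_id)
  finally have "max_minor f - Poly_Mapping.single (expm f) 1 = (\<Sum>p\<in>{p. p permutes (UNIV :: 'm set)} - {id}. ?t p)"
    by simp
  also have "\<dots> \<in> low (wt (expm f))"
  proof (rule low_sum)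
    fix p assume p: "p \<in> {p. p permutes (UNIV :: 'm set)} - {id}"
    have "wt (expm (\<lambda>i. f (p i))) < wt (expm f)"
      unfolding wt_expm by (rule strict_rearrangement) (use p assms in \<open>auto simp: incr_def\<close>)
    thus "?t p \<in> low (wt (expm f))"
      unfolding of_int_sign_single by (auto intro: low_single low_uminus)
  qed
  finally show ?thesis by (simp add: lt_def)
qed

section \<open>Straightening products of maximal minors\<close>

interpretation kv: vector_space
  "\<lambda>(c :: 'k::field) (g :: ('m::finite, 'n::finite, 'k) gpoly). Poly_Mapping.single 0 c * g"
  by standard (simp_all add: algebra_simps single_add mult_single flip: mult.assoc)

lemma max_minor_permute:
  "p permutes UNIV \<Longrightarrow> max_minor (\<lambda>i. f (p i)) = of_int (sign p) * max_minor f"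
  unfolding max_minor_coldet by (rule coldet_permute)

lemma max_minor_not_inj: "\<not> inj f \<Longrightarrow> max_minor f = 0"
  unfolding max_minor_coldet inj_def by (auto intro: coldet_eq_0)

text \<open>Sorting: \<open>pos i\<close> counts the smaller columns, and the inverse of this
  ranking puts the columns in order.\<close>

lemma ex_incr_permutation:
  fixes f :: "'m::finite \<Rightarrow> 'n::finite"
  assumes "inj f"
  shows "\<exists>p. p permutes UNIV \<and> incr (\<lambda>i. f (p i))"
proof -
  define pos where "pos i = card {j. rk (f j) < rk (f i)}" for i
  have mono: "pos i < pos j" if "rk (f i) < rk (f j)" for i j
    unfolding pos_def by (rule psubset_card_mono) (use that in auto)
  have inj: "inj pos"
  proof (rule injI)
    fix i j assume "pos i = pos j"
    hence "rk (f i) = rk (f j)" using mono[of i j] mono[of j i] by (metis less_irrefl linorder_neqE_nat)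
    thus "i = j" using assms by (simp add: inj_eq)
  qed
  have less: "pos i < CARD('m)" for i
    unfolding pos_def by (rule psubset_card_mono) auto
  define q where "q i = (unrk (pos i) :: 'm)" for i
  have rq: "rk (q i) = pos i" for i using less by (simp add: q_def)
  have "inj q" using inj by (metis injD injI rq)
  hence q: "q permutes UNIV" by (intro bij_imp_permutes) (auto simp: bij_def finite_UNIV_inj_surj)
  have "rk (f (inv q i)) < rk (f (inv q j))" if "rk i < rk j" for i j
  proof (rule ccontr)
    assume "\<not> ?thesis"
    hence "pos (inv q j) \<le> pos (inv q i)"
      using mono[of "inv q j" "inv q i"] by (cases "rk (f (inv q j)) = rk (f (inv q i))") (use assms in \<open>auto simp: inj_eq\<close>)
    thus False using that by (simp add: rq[symmetric] permutes_inverses[OF q])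
  qed
  thus ?thesis using permutes_inv[OF q] by (intro exI[of _ "inv q"]) (simp add: incr_def)
qed

section \<open>Products of minors and standard pairs\<close>

definition minors_prod :: "nat \<Rightarrow> (nat \<Rightarrow> 'm \<Rightarrow> 'n) \<Rightarrow> ('m::finite, 'n::finite, 'k::comm_ring_1) gpoly" where
  "minors_prod N D = (\<Prod>k<N. max_minor (D k))"

definition lexp :: "nat \<Rightarrow> (nat \<Rightarrow> 'm::finite \<Rightarrow> 'n::finite) \<Rightarrow> ('m \<times> 'n \<Rightarrow>\<^sub>0 nat)" where
  "lexp N D = (\<Sum>k<N. expm (D k))"

definition rows_incr :: "nat \<Rightarrow> (nat \<Rightarrow> 'm::finite \<Rightarrow> 'n::finite) \<Rightarrow> bool" where
  "rows_incr N D \<longleftrightarrow> (\<forall>k<N. incr (D k))"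

definition chain :: "nat \<Rightarrow> (nat \<Rightarrow> 'm::finite \<Rightarrow> 'n::finite) \<Rightarrow> bool" where
  "chain N D \<longleftrightarrow> rows_incr N D \<and> (\<forall>k i. Suc k < N \<longrightarrow> rk (D k i) \<le> rk (D (Suc k) i))"

text \<open>No variable of the monomial \<open>u\<close> can be traded for a smaller entry of a row of \<open>D\<close>. This selects one pair
  \<open>(u, D)\<close> for each leading monomial (\<open>standard_unique\<close>).\<close>

definition standard :: "nat \<Rightarrow> ('m \<times> 'n \<Rightarrow>\<^sub>0 nat) \<Rightarrow> (nat \<Rightarrow> 'm::finite \<Rightarrow> 'n::finite) \<Rightarrow> bool" where
  "standard N u D \<longleftrightarrow> chain N D \<and> (\<forall>k<N. \<forall>i j. lookup u (i, j) \<noteq> 0 \<longrightarrow>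
     \<not> ((\<forall>i'. rk i' < rk i \<longrightarrow> rk (D k i') < rk j) \<and> rk j < rk (D k i)))"

lemma lt_minors_prod: "rows_incr N D \<Longrightarrow> lt (minors_prod N D) (lexp N D)"
  unfolding minors_prod_def lexp_def by (rule lt_prod) (simp add: rows_incr_def lt_max_minor)

lemma lookup_lexp: "lookup (lexp N D) (i, j) = card {k. k < N \<and> D k i = j}"
proof -
  have "lookup (lexp N D) (i, j) = (\<Sum>k<N. if D k i = j then 1 else 0)"
    unfolding lexp_def lookup_sum by (intro sum.cong refl) (auto simp: lookup_expm)
  also have "\<dots> = (\<Sum>k\<in>{k\<in>{..<N}. D k i = j}. 1)" by (rule sum.inter_filter[symmetric]) simp
  finally show ?thesis by simp
qed

lemma chain_mono:
  assumes "chain N D" "k \<le> k'" "k' < N"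
  shows "rk (D k i) \<le> rk (D k' i)"
  using assms(2,3)
proof (induction k' rule: dec_induct)
  case (step l)
  have "rk (D l i) \<le> rk (D (Suc l) i)" using assms(1) step by (simp add: chain_def)
  thus ?case using step by simp
qed simp

text \<open>Let \<open>a\<close> be the smaller entry \<open>D k i\<close>. Since \<open>D'\<close>
  is weakly increasing in \<open>k\<close>, it has \<open>a\<close> in position \<open>i\<close>
  only before \<open>k\<close>, where both agree; so \<open>D\<close> contains it more often.
  Equality of the exponents then forces the variable \<open>(i, a)\<close> to divide
  \<open>u'\<close>, where it could be traded for \<open>D' k i\<close>, contrary to
  \<open>standard N u' D'\<close>.\<close>

lemma standard_unique_step:
  assumes D: "standard N u D" and D': "standard N u' D'" and eq: "u + lexp N D = u' + lexp N D'"
    and k: "k < N"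
    and IH1: "\<And>i'. rk i' < rk i \<Longrightarrow> D k i' = D' k i'"
    and IH2: "\<And>k'. k' < k \<Longrightarrow> D k' i = D' k' i"
  shows "\<not> rk (D k i) < rk (D' k i)"
proof
  assume less: "rk (D k i) < rk (D' k i)"
  define a where "a = D k i"
  have ch: "chain N D" "chain N D'" using D D' by (simp_all add: standard_def)
  have "{k'. k' < N \<and> D' k' i = a} \<subset> {k'. k' < N \<and> D k' i = a}"
  proof
    show "{k'. k' < N \<and> D' k' i = a} \<subseteq> {k'. k' < N \<and> D k' i = a}"
    proof
      fix k' assume "k' \<in> {k'. k' < N \<and> D' k' i = a}"
      hence k': "k' < N" "D' k' i = a" by simp_all
      have "k' < k"
      proof (rule ccontr)
        assume "\<not> k' < k"
        hence "rk (D' k i) \<le> rk (D' k' i)" using chain_mono[OF ch(2), of k k' i] k'(1) by simp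
        thus False using less k' by (simp add: a_def)
      qed
      thus "k' \<in> {k'. k' < N \<and> D k' i = a}" using IH2 k' by simp
    qed
    have "k \<in> {k'. k' < N \<and> D k' i = a} - {k'. k' < N \<and> D' k' i = a}"
      using k less by (auto simp: a_def)
    thus "{k'. k' < N \<and> D' k' i = a} \<noteq> {k'. k' < N \<and> D k' i = a}" by blast
  qed
  hence "card {k'. k' < N \<and> D' k' i = a} < card {k'. k' < N \<and> D k' i = a}"
    by (intro psubset_card_mono) auto
  moreover have "lookup u (i, a) + card {k'. k' < N \<and> D k' i = a} = lookup u' (i, a) + card {k'. k' < N \<and> D' k' i = a}"
    using arg_cong[OF eq, of "\<lambda>v. lookup v (i, a)"] by (simp add: lookup_add lookup_lexp)
  ultimately have "lookup u' (i, a) \<noteq> 0" by simp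
  moreover have "incr (D k)" using ch(1) k by (simp add: chain_def rows_incr_def)
  hence "\<forall>i'. rk i' < rk i \<longrightarrow> rk (D' k i') < rk a" unfolding incr_def a_def using IH1 by metis
  ultimately show False using D' k less unfolding standard_def a_def by blast
qed

lemma standard_unique:
  assumes D: "standard N u D" and D': "standard N u' D'" and eq: "u + lexp N D = u' + lexp N D'"
    and k: "k < N"
  shows "D k i = D' k i"
  using k
proof (induction "rk i" arbitrary: i k rule: less_induct)
  case (less i)
  note IH = less(1)
  from less(2) show ?case
  proof (induction k rule: less_induct)
    case (less k)
    have "\<not> rk (D k i) < rk (D' k i)"
      by (rule standard_unique_step[OF D D' eq]) (use IH less in auto)
    moreover have "\<not> rk (D' k i) < rk (D k i)"
      by (rule standard_unique_step[OF D' D eq[symmetric]]) (use IH less in auto)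
    ultimately show ?case by (metis linorder_neqE_nat rk_eq_iff)
  qed
qed

lemma prod_split_pair:
  fixes F :: "nat \<Rightarrow> 'a::comm_monoid_mult"
  assumes "Suc k < N"
  shows "(\<Prod>j<N. F j) = F k * F (Suc k) * (\<Prod>j\<in>{..<N} - {k, Suc k}. F j)"
proof -
  have "{..<N} = insert k (insert (Suc k) ({..<N} - {k, Suc k}))" using assms by auto
  hence "(\<Prod>j<N. F j) = (\<Prod>j\<in>insert k (insert (Suc k) ({..<N} - {k, Suc k})). F j)" by simp
  thus ?thesis by (simp add: mult.assoc)
qed

lemma sum_split_pair:
  fixes F :: "nat \<Rightarrow> 'a::comm_monoid_add"
  assumes "Suc k < N"
  shows "(\<Sum>j<N. F j) = F k + F (Suc k) + (\<Sum>j\<in>{..<N} - {k, Suc k}. F j)"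
proof -
  have "{..<N} = insert k (insert (Suc k) ({..<N} - {k, Suc k}))" using assms by auto
  hence "(\<Sum>j<N. F j) = (\<Sum>j\<in>insert k (insert (Suc k) ({..<N} - {k, Suc k})). F j)" by simp
  thus ?thesis by (simp add: add.assoc)
qed

lemma span_sign: "x \<in> kv.span S \<Longrightarrow> of_int (sign p) * x \<in> kv.span S"
  unfolding of_int_sign_single by (simp add: kv.span_neg)

text \<open>The descent in the straightening algorithm: \<open>f\<close>, \<open>g\<close> are consecutive rows that violate the chain
  condition in position \<open>s\<close>, and \<open>\<sigma>\<close> is a nontrivial shuffle from the exchange relation.\<close>

lemma shuffle_rank_sum_less:
  fixes f g :: "'m::finite \<Rightarrow> 'n::finite"
  defines "lab \<equiv> \<lambda>u. if snd u then f (fst u) else g (fst u)"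
  assumes f: "incr f" and g: "incr g" and s: "rk (g s) < rk (f s)"
    and \<sigma>: "\<sigma> permutes ({i. rk s \<le> rk i} \<times> {True} \<union> {i. rk i \<le> rk s} \<times> {False})"
    and ne: "\<sigma> ` ({i. rk s \<le> rk i} \<times> {True}) \<noteq> {i. rk s \<le> rk i} \<times> {True}"
  shows "(\<Sum>i\<in>UNIV. rk (lab (\<sigma> (i, True)))) < (\<Sum>i\<in>UNIV. rk (f i))"
    "(\<Sum>i\<in>UNIV. rk (lab (\<sigma> (i, True)))) + (\<Sum>i\<in>UNIV. rk (lab (\<sigma> (i, False)))) = (\<Sum>i\<in>UNIV. rk (f i)) + (\<Sum>i\<in>UNIV. rk (g i))"
proof -
  define P where "P = {i :: 'm. rk s \<le> rk i}"
  define A where "A = P \<times> {True}"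
  define B where "B = \<sigma> ` A"
  let ?r = "\<lambda>u. rk (lab u)"
  have inj: "inj \<sigma>" using permutes_inj[OF \<sigma>] .
  have cardB: "card B = card A" unfolding B_def by (rule card_image) (rule inj_on_subset[OF inj], simp)
  have fin: "finite A" "finite B" by simp_all
  have BT: "B \<subseteq> A \<union> {i. rk i \<le> rk s} \<times> {False}"
  proof
    fix u assume "u \<in> B"
    then obtain v where "u = \<sigma> v" "v \<in> A" unfolding B_def by blast
    thus "u \<in> A \<union> {i. rk i \<le> rk s} \<times> {False}"
      using permutes_in_image[OF \<sigma>, of v] by (simp add: A_def P_def mem_Times_iff)
  qed
  have d: "card (A - B) = card (B - A)"
    using cardB fin by (metis card_Diff_subset_Int finite_Int Int_commute)
  have "A \<noteq> B" using ne by (simp add: A_def B_def P_def)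
  hence "\<not> A \<subseteq> B" using cardB fin by (metis card_subset_eq)
  hence pos: "card (A - B) > 0" by (simp add: card_gt_0_iff)
  \<comment> \<open>Columns entering the upper row come from positions up to \<open>s\<close> of
    \<open>g\<close> and have rank at most \<open>rk (g s)\<close>; columns leaving it come from
    positions from \<open>s\<close> on of \<open>f\<close> and have rank at least
    \<open>rk (f s)\<close>.\<close>
  have "sum ?r (B - A) \<le> of_nat (card (B - A)) * rk (g s)"
  proof (rule sum_bounded_above)
    fix u assume "u \<in> B - A"
    hence "\<not> snd u" "rk (fst u) \<le> rk s" using BT by (auto simp: mem_Times_iff)
    thus "?r u \<le> rk (g s)"
      using g by (cases "fst u = s") (auto simp: lab_def incr_def less_le)
  qed
  also have "\<dots> < of_nat (card (B - A)) * rk (f s)" using pos d s by simp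
  also have "\<dots> = of_nat (card (A - B)) * rk (f s)" using d by simp
  also have "\<dots> \<le> sum ?r (A - B)"
  proof (rule sum_bounded_below)
    fix u assume "u \<in> A - B"
    hence "snd u" "rk s \<le> rk (fst u)" by (auto simp: mem_Times_iff A_def P_def)
    thus "rk (f s) \<le> ?r u"
      using f by (cases "fst u = s") (auto simp: lab_def incr_def less_le)
  qed
  finally have lt: "sum ?r (B - A) < sum ?r (A - B)" .
  have "sum ?r B = sum ?r (B \<inter> A) + sum ?r (B - A)" "sum ?r A = sum ?r (A \<inter> B) + sum ?r (A - B)"
    using fin by (metis sum.Int_Diff)+
  with lt have lt: "sum ?r B < sum ?r A" by (simp add: Int_commute)
  have "sum ?r B = (\<Sum>u\<in>A. ?r (\<sigma> u))"
    unfolding B_def by (simp add: sum.reindex inj_on_subset[OF inj])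
  moreover have "sum F A = (\<Sum>i\<in>P. F (i, True))" for F :: "'m \<times> bool \<Rightarrow> nat"
  proof -
    have "A = (\<lambda>i. (i, True)) ` P" by (auto simp: A_def)
    thus ?thesis by (simp add: sum.reindex inj_on_def)
  qed
  ultimately have lt: "(\<Sum>i\<in>P. ?r (\<sigma> (i, True))) < (\<Sum>i\<in>P. rk (f i))"
    using lt by (simp add: lab_def)
  have split: "sum F UNIV = sum F P + sum F (- P)" for F :: "'m \<Rightarrow> nat"
    using sum.union_disjoint[of P "- P" F] by (simp add: Compl_partition)
  have "(\<Sum>i\<in>- P. ?r (\<sigma> (i, True))) = (\<Sum>i\<in>- P. rk (f i))"
  proof (rule sum.cong[OF refl])
    fix i assume "i \<in> - P"
    hence "\<sigma> (i, True) = (i, True)" by (intro permutes_not_in[OF \<sigma>]) (simp add: P_def)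
    thus "?r (\<sigma> (i, True)) = rk (f i)" by (simp add: lab_def)
  qed
  thus "(\<Sum>i\<in>UNIV. ?r (\<sigma> (i, True))) < (\<Sum>i\<in>UNIV. rk (f i))"
    using lt by (simp add: split)
  have \<sigma>U: "\<sigma> permutes UNIV" by (rule permutes_subset[OF \<sigma>]) simp
  have U: "sum F UNIV = (\<Sum>i\<in>UNIV. F (i, True)) + (\<Sum>i\<in>UNIV. F (i, False))" for F :: "'m \<times> bool \<Rightarrow> nat"
  proof -
    have "sum F UNIV = (\<Sum>i\<in>UNIV. \<Sum>b\<in>UNIV. F (i, b))" by (simp add: sum.cartesian_product split_def)
    thus ?thesis by (simp add: UNIV_bool sum.distrib add.commute)
  qed
  have "(\<Sum>i\<in>UNIV. ?r (\<sigma> (i, True))) + (\<Sum>i\<in>UNIV. ?r (\<sigma> (i, False))) = (\<Sum>u\<in>UNIV. ?r (\<sigma> u))"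
    by (simp add: U)
  also have "\<dots> = (\<Sum>u\<in>UNIV. ?r u)"
    using sum.permute[OF \<sigma>U, of ?r] by (simp add: comp_def)
  also have "\<dots> = (\<Sum>i\<in>UNIV. rk (f i)) + (\<Sum>i\<in>UNIV. rk (g i))" by (simp add: U lab_def)
  finally show "(\<Sum>i\<in>UNIV. ?r (\<sigma> (i, True))) + (\<Sum>i\<in>UNIV. ?r (\<sigma> (i, False))) = (\<Sum>i\<in>UNIV. rk (f i)) + (\<Sum>i\<in>UNIV. rk (g i))" .
qed

text \<open>A nontrivial shuffle moves rank from row \<open>k\<close> to row \<open>Suc k\<close>
  and preserves the total. The decreasing factor \<open>N - k\<close> in the measure turns this into
  a descent; sorting the new rows costs only signs.\<close>

lemma minors_prod_in_span_chain:
  fixes D :: "nat \<Rightarrow> 'm::finite \<Rightarrow> 'n::finite"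
  assumes "rows_incr N D"
  shows "(minors_prod N D :: ('m, 'n, 'k::field) gpoly) \<in> kv.span {minors_prod N D' | D'. chain N D'}"
  using assms
proof (induction "\<Sum>k<N. (N - k) * (\<Sum>i\<in>UNIV. rk (D k i))" arbitrary: D rule: less_induct)
  case (less D)
  let ?S = "{minors_prod N D' | D'. chain N D'} :: ('m, 'n, 'k) gpoly set"
  show ?case
  proof (cases "chain N D")
    case True
    thus ?thesis by (intro kv.span_base) blast
  next
    case False
    then obtain k s where k: "Suc k < N" and s: "rk (D (Suc k) s) < rk (D k s)"
      using less(2) by (auto simp: chain_def not_le)
    define f g where "f = D k" and "g = D (Suc k)"
    have fg: "incr f" "incr g" using less(2) k by (simp_all add: rows_incr_def f_def g_def)
    \<comment> \<open>The two sets overlap exactly in \<open>s\<close>, so together they have m + 1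
      positions, the least number to which the exchange relation applies.\<close>
    define P Q where "P = {i::'m. rk s \<le> rk i}" and "Q = {i::'m. rk i \<le> rk s}"
    have "P \<union> Q = UNIV" "P \<inter> Q = {s}" by (auto simp: P_def Q_def)
    hence PQ: "card P + card Q > CARD('m)" using card_Un_Int[of P Q] by simp
    define lab where "lab = (\<lambda>u. if snd u then f (fst u) else g (fst u))"
    define h where "h u i = (var i (lab u) :: ('m, 'n, 'k) gpoly)" for u i
    obtain \<Sigma> where \<Sigma>: "\<And>\<sigma>. \<sigma> \<in> \<Sigma> \<Longrightarrow> \<sigma> permutes (P \<times> {True} \<union> Q \<times> {False})"
      "\<And>\<sigma>. \<sigma> \<in> \<Sigma> \<Longrightarrow> \<sigma> ` (P \<times> {True}) \<noteq> P \<times> {True}"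
      and ex: "coldet (\<lambda>i. h (i, True)) * coldet (\<lambda>i. h (i, False)) =
       (\<Sum>\<sigma>\<in>\<Sigma>. of_int (- sign \<sigma>) * (coldet (\<lambda>i. h (\<sigma> (i, True))) * coldet (\<lambda>i. h (\<sigma> (i, False)))))"
      by (rule coldet_exchange[OF PQ, of h], rule that)
    define f' g' where "f' \<sigma> i = lab (\<sigma> (i, True))" and "g' \<sigma> i = lab (\<sigma> (i, False))"
      for \<sigma> :: "'m \<times> bool \<Rightarrow> 'm \<times> bool" and i
    have mm: "coldet (\<lambda>i. h (\<sigma> (i, True))) = max_minor (f' \<sigma>)" "coldet (\<lambda>i. h (\<sigma> (i, False))) = max_minor (g' \<sigma>)" for \<sigma>
      by (simp_all add: max_minor_coldet h_def[abs_def] f'_def g'_def)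
    have mm0: "coldet (\<lambda>i. h (i, True)) = max_minor f" "coldet (\<lambda>i. h (i, False)) = max_minor g"
      by (simp_all add: max_minor_coldet h_def[abs_def] lab_def)
    define R where "R = (\<Prod>j\<in>{..<N} - {k, Suc k}. max_minor (D j) :: ('m, 'n, 'k) gpoly)"
    have "minors_prod N D = max_minor f * max_minor g * R"
      unfolding minors_prod_def R_def f_def g_def by (rule prod_split_pair[OF k])
    also have "\<dots> = (\<Sum>\<sigma>\<in>\<Sigma>. of_int (- sign \<sigma>) * (max_minor (f' \<sigma>) * max_minor (g' \<sigma>) * R))"
      unfolding ex[unfolded mm0, unfolded mm] by (simp add: sum_distrib_right mult.assoc)
    also have "\<dots> \<in> kv.span ?S"
    proof (rule kv.span_sum)
      fix \<sigma> assume \<sigma>: "\<sigma> \<in> \<Sigma>"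
      have "max_minor (f' \<sigma>) * max_minor (g' \<sigma>) * R \<in> kv.span ?S"
      proof (cases "inj (f' \<sigma>) \<and> inj (g' \<sigma>)")
        case False
        hence "max_minor (f' \<sigma>) * max_minor (g' \<sigma>) * R = 0"
          by (auto simp: max_minor_not_inj)
        thus ?thesis by (simp add: kv.span_zero)
      next
        case True
        obtain p where p: "p permutes UNIV" "incr (\<lambda>i. f' \<sigma> (p i))" using ex_incr_permutation True by blast
        obtain q where q: "q permutes UNIV" "incr (\<lambda>i. g' \<sigma> (q i))" using ex_incr_permutation True by blast
        define D' where "D' = D(k := \<lambda>i. f' \<sigma> (p i), Suc k := \<lambda>i. g' \<sigma> (q i))"
        have rest: "j \<noteq> k \<Longrightarrow> j \<noteq> Suc k \<Longrightarrow> D' j = D j" for j by (simp add: D'_def)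
        have kk: "D' k = (\<lambda>i. f' \<sigma> (p i))" "D' (Suc k) = (\<lambda>i. g' \<sigma> (q i))" by (simp_all add: D'_def)
        have D'incr: "rows_incr N D'"
          using less(2) p(2) q(2) by (auto simp: rows_incr_def D'_def)
        have sums: "(\<Sum>i\<in>UNIV. rk (f' \<sigma> (p i))) = (\<Sum>i\<in>UNIV. rk (f' \<sigma> i))"
          "(\<Sum>i\<in>UNIV. rk (g' \<sigma> (q i))) = (\<Sum>i\<in>UNIV. rk (g' \<sigma> i))"
          using sum.permute[OF p(1), of "\<lambda>i. rk (f' \<sigma> i)"] sum.permute[OF q(1), of "\<lambda>i. rk (g' \<sigma> i)"]
          by (simp_all add: comp_def)
        have sl: "(\<Sum>i\<in>UNIV. rk (f' \<sigma> i)) < (\<Sum>i\<in>UNIV. rk (f i))"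
          "(\<Sum>i\<in>UNIV. rk (f' \<sigma> i)) + (\<Sum>i\<in>UNIV. rk (g' \<sigma> i)) = (\<Sum>i\<in>UNIV. rk (f i)) + (\<Sum>i\<in>UNIV. rk (g i))"
          unfolding f'_def g'_def lab_def
          using shuffle_rank_sum_less[OF fg, of s \<sigma>] \<Sigma>[OF \<sigma>] s by (simp_all add: P_def Q_def f_def g_def)
        have rsum: "(\<Sum>j\<in>{..<N} - {k, Suc k}. (N - j) * (\<Sum>i\<in>UNIV. rk (D' j i))) =
          (\<Sum>j\<in>{..<N} - {k, Suc k}. (N - j) * (\<Sum>i\<in>UNIV. rk (D j i)))"
          by (intro sum.cong refl) (simp add: rest)
        obtain c where c: "N - k = Suc c" "N - Suc k = c" using k by (metis Suc_diff_Suc Suc_lessD)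
        have "(\<Sum>j<N. (N - j) * (\<Sum>i\<in>UNIV. rk (D' j i))) < (\<Sum>j<N. (N - j) * (\<Sum>i\<in>UNIV. rk (D j i)))"
          unfolding sum_split_pair[OF k] rsum kk sums c f_def[symmetric] g_def[symmetric]
          using sl by (simp add: algebra_simps flip: distrib_left)
        from less(1)[OF this D'incr] have "minors_prod N D' \<in> kv.span ?S" .
        hence *: "of_int (sign p) * (of_int (sign q) * minors_prod N D') \<in> kv.span ?S" by (intro span_sign)
        have "minors_prod N D' = (of_int (sign p) * max_minor (f' \<sigma>)) * (of_int (sign q) * max_minor (g' \<sigma>)) * R"
          unfolding minors_prod_def prod_split_pair[OF k] kk max_minor_permute[OF p(1)] max_minor_permute[OF q(1)] R_def
          by (intro arg_cong2[where f = "(*)"] refl prod.cong) (simp add: rest)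
        hence "of_int (sign p) * (of_int (sign q) * minors_prod N D') = 
          (of_int (sign p) * (of_int (sign p) * max_minor (f' \<sigma>))) * (of_int (sign q) * (of_int (sign q) * max_minor (g' \<sigma>))) * R"
          by (simp only: mult_ac)
        thus ?thesis using * unfolding of_int_sign_mult by simp
      qed
      hence "of_int (sign \<sigma>) * (max_minor (f' \<sigma>) * max_minor (g' \<sigma>) * R) \<in> kv.span ?S" by (rule span_sign)
      from kv.span_neg[OF this]
      show "of_int (- sign \<sigma>) * (max_minor (f' \<sigma>) * max_minor (g' \<sigma>) * R) \<in> kv.span ?S" by simp
    qed
    finally show ?thesis .
  qed
qed

text \<open>The shuffles are not followed by weight. The bound is recovered from the result: chains
  have distinct leading monomials, so no term heavier than the product itself can be
  present.\<close>

lemma minors_prod_in_span_chain_le: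
  fixes D :: "nat \<Rightarrow> 'm::finite \<Rightarrow> 'n::finite"
  assumes D: "rows_incr N D"
  shows "(minors_prod N D :: ('m, 'n, 'k::field) gpoly) \<in> kv.span {minors_prod N D' | D'. chain N D' \<and>
     (lexp N D' = lexp N D \<or> wt (lexp N D') < wt (lexp N D))}"
    (is "?g \<in> kv.span ?S")
proof -
  obtain t r where t: "finite t" "t \<subseteq> {minors_prod N D' | D'. chain N D'}"
    "?g = (\<Sum>a\<in>t. Poly_Mapping.single 0 (r a) * a)"
    using minors_prod_in_span_chain[OF D, where 'k = 'k] unfolding kv.span_explicit by auto
  define F where "F = {a\<in>t. r a \<noteq> 0}"
  have g: "?g = (\<Sum>a\<in>F. Poly_Mapping.single 0 (r a) * a)"
    unfolding t(3) F_def by (rule sum.mono_neutral_right) (use t(1) in auto)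
  have "\<forall>a\<in>F. \<exists>D'. chain N D' \<and> a = minors_prod N D'" using t(2) by (auto simp: F_def)
  then obtain E where E: "\<And>a. a \<in> F \<Longrightarrow> chain N (E a)" "\<And>a. a \<in> F \<Longrightarrow> a = minors_prod N (E a)" by metis
  \<comment> \<open>Without a monomial factor the trading condition in \<open>standard\<close> is
    vacuous, so \<open>standard_unique\<close> covers chains.\<close>
  have std: "standard N 0 (E a)" if "a \<in> F" for a using E(1)[OF that] by (simp add: standard_def)
  have inj: "inj_on (\<lambda>a. lexp N (E a)) F"
  proof (rule inj_onI)
    fix a b assume ab: "a \<in> F" "b \<in> F" "lexp N (E a) = lexp N (E b)"
    hence "E a k = E b k" if "k < N" for k
      using standard_unique[OF std std _ that, of a b] by auto
    hence "minors_prod N (E a) = (minors_prod N (E b) :: ('m, 'n, 'k) gpoly)" by (simp add: minors_prod_def)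
    thus "a = b" using E(2) ab by metis
  qed
  have lt: "lt a (lexp N (E a))" if "a \<in> F" for a
    using lt_minors_prod[of N "E a"] E(1)[OF that] by (subst E(2)[OF that]) (simp add: chain_def)
  have ltD: "lt (\<Sum>a\<in>F. Poly_Mapping.single 0 (r a) * a) (lexp N D)"
    unfolding g[symmetric] by (rule lt_minors_prod[OF D])
  have "lexp N (E b) = lexp N D \<or> wt (lexp N (E b)) < wt (lexp N D)" if "b \<in> F" for b
    by (rule lt_combination_bound[OF _ lt inj _ _ that, of r])
      (use t(1) ltD in \<open>auto simp: F_def\<close>)
  hence "F \<subseteq> ?S" using E by blast
  thus ?thesis unfolding g
    by (intro kv.span_sum kv.span_scale kv.span_base) auto
qed

section \<open>Powers of the ideal of maximal minors\<close>

lemma is_ideal_ideal_gen: "is_ideal (ideal_gen S)"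
  unfolding is_ideal_def ideal_gen_def by blast

lemma ideal_gen_superset: "S \<subseteq> ideal_gen S"
  unfolding ideal_gen_def by blast

lemma ideal_gen_least: "is_ideal J \<Longrightarrow> S \<subseteq> J \<Longrightarrow> ideal_gen S \<subseteq> J"
  unfolding ideal_gen_def by blast

lemma is_idealD:
  assumes "is_ideal J"
  shows "0 \<in> J" "x \<in> J \<Longrightarrow> y \<in> J \<Longrightarrow> x + y \<in> J" "x \<in> J \<Longrightarrow> r * x \<in> J" "x \<in> J \<Longrightarrow> x * r \<in> J"
    "x \<in> J \<Longrightarrow> - x \<in> J" "x \<in> J \<Longrightarrow> y \<in> J \<Longrightarrow> x - y \<in> J"
proof -
  show 1: "0 \<in> J" "\<And>x y. x \<in> J \<Longrightarrow> y \<in> J \<Longrightarrow> x + y \<in> J" "\<And>x r. x \<in> J \<Longrightarrow> r * x \<in> J"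
    using assms by (auto simp: is_ideal_def)
  show 2: "x * r \<in> J" if "x \<in> J" for x r using 1(3)[OF that, of r] by (simp add: mult.commute)
  show 3: "- x \<in> J" if "x \<in> J" for x using 1(3)[OF that, of "-1"] by simp
  show "x - y \<in> J" if "x \<in> J" "y \<in> J" for x y using 1(2)[OF that(1) 3[OF that(2)]] by simp
qed

lemma is_ideal_sum: "is_ideal J \<Longrightarrow> (\<And>a. a \<in> A \<Longrightarrow> g a \<in> J) \<Longrightarrow> (\<Sum>a\<in>A. g a) \<in> J"
  by (induction A rule: infinite_finite_induct) (simp_all add: is_idealD(1,2))

lemma is_ideal_ideal_pow: "is_ideal (ideal_pow a n)"
proof (cases n)
  case 0
  thus ?thesis by (simp add: is_ideal_def)
qed (simp add: is_ideal_ideal_gen)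

lemma ideal_pow_mult:
  assumes "x \<in> ideal_pow a m" "y \<in> ideal_pow a n"
  shows "x * y \<in> ideal_pow a (m + n)"
  using assms(2)
proof (induction n arbitrary: y)
  case 0
  thus ?case using is_idealD(4)[OF is_ideal_ideal_pow assms(1)] by simp
next
  case (Suc n)
  note J = is_idealD[OF is_ideal_ideal_pow[of a "m + Suc n"]]
  have "is_ideal {y. x * y \<in> ideal_pow a (m + Suc n)}"
    unfolding is_ideal_def using J by (auto simp: distrib_left mult.left_commute)
  moreover have "{y * z |y z. y \<in> ideal_pow a n \<and> z \<in> a} \<subseteq> {y. x * y \<in> ideal_pow a (m + Suc n)}"
  proof safe
    fix y z assume "y \<in> ideal_pow a n" "z \<in> a"
    hence "(x * y) * z \<in> ideal_gen {x * y |x y. x \<in> ideal_pow a (m + n) \<and> y \<in> a}"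
      using Suc.IH by (intro subsetD[OF ideal_gen_superset]) blast
    thus "x * (y * z) \<in> ideal_pow a (m + Suc n)" by (simp add: mult.assoc)
  qed
  ultimately have "ideal_pow a (Suc n) \<subseteq> {y. x * y \<in> ideal_pow a (m + Suc n)}"
    unfolding ideal_pow.simps(2)[of a n] by (rule ideal_gen_least)
  thus ?case using Suc.prems by blast
qed

lemma ideal_pow_one:
  assumes "x \<in> a"
  shows "x \<in> ideal_pow a 1"
proof -
  have "1 * x \<in> ideal_gen {x * y |x y. x \<in> ideal_pow a 0 \<and> y \<in> a}"
    using assms by (intro subsetD[OF ideal_gen_superset] CollectI exI[of _ 1] exI[of _ x]) simp
  thus ?thesis by simp
qed

lemma ideal_pow_antimono: "m \<le> n \<Longrightarrow> ideal_pow a n \<subseteq> ideal_pow a m"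
proof (induction n rule: dec_induct)
  case (step n)
  have "ideal_pow a (Suc n) \<subseteq> ideal_pow a n"
    by (simp, rule ideal_gen_least[OF is_ideal_ideal_pow]) (auto intro: is_idealD(4)[OF is_ideal_ideal_pow])
  thus ?case using step by blast
qed simp

lemma ideal_pow_prod:
  assumes "finite A" "\<And>i. i \<in> A \<Longrightarrow> x i \<in> a"
  shows "(\<Prod>i\<in>A. x i) \<in> ideal_pow a (card A)"
  using assms
proof (induction A rule: finite_induct)
  case (insert i A)
  have "(\<Prod>i\<in>A. x i) * x i \<in> ideal_pow a (card A + 1)"
    using insert by (intro ideal_pow_mult ideal_pow_one) auto
  thus ?case using insert by (simp add: mult.commute del: ideal_pow.simps)
qed simp_all

lemma poly_mapping_sum_single:
  fixes g :: "'v \<Rightarrow>\<^sub>0 'k::comm_monoid_add"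
  shows "g = (\<Sum>v\<in>keys g. Poly_Mapping.single v (lookup g v))"
proof (rule poly_mapping_eqI)
  fix w
  have "lookup (\<Sum>v\<in>keys g. Poly_Mapping.single v (lookup g v)) w = (\<Sum>v\<in>keys g. if v = w then lookup g w else 0)"
    unfolding lookup_sum by (intro sum.cong refl) (auto simp: lookup_single when_def)
  thus "lookup g w = lookup (\<Sum>v\<in>keys g. Poly_Mapping.single v (lookup g v)) w"
    by (simp add: sum.delta' in_keys_iff)
qed

section \<open>Cramer's relation between a variable and a minor\<close>

lemma coldet_unit:
  fixes v :: "'m::finite \<Rightarrow> 'a::comm_ring_1"
  shows "coldet ((\<lambda>k r. if r = k then 1 else 0)(i := v)) = v i"
proof -
  let ?V = "(\<lambda>k r. if r = k then 1 else 0)(i := v)"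
  have z: "(\<Prod>r\<in>UNIV. ?V (p r) r) = 0" if p: "p permutes UNIV" "p \<noteq> id" for p
  proof -
    obtain r where r: "p r \<noteq> r" using p(2) by (auto simp: fun_eq_iff)
    have "\<exists>r. p r \<noteq> r \<and> p r \<noteq> i"
    proof (cases "p r = i")
      case True
      have "p (p r) \<noteq> p r" "p (p r) \<noteq> p r" using r permutes_inj[OF p(1)] by (metis injD)+
      thus ?thesis using True by metis
    qed (use r in auto)
    then obtain r' where "p r' \<noteq> r'" "p r' \<noteq> i" by blast
    hence "\<exists>r\<in>UNIV. ?V (p r) r = 0" by (intro bexI[of _ r']) auto
    thus ?thesis by (rule prod_zero[OF finite])
  qed
  have "coldet ?V = (\<Sum>p | p permutes (UNIV :: 'm set). if p = id then (\<Prod>r\<in>UNIV. ?V r r) else 0)"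
    unfolding coldet_def
  proof (rule sum.cong[OF refl])
    fix p :: "'m \<Rightarrow> 'm" assume "p \<in> {p. p permutes UNIV}"
    thus "of_int (sign p) * (\<Prod>r\<in>UNIV. ?V (p r) r) = (if p = id then (\<Prod>r\<in>UNIV. ?V r r) else 0)"
      using z[of p] by (cases "p = id") (simp_all del: fun_upd_apply)
  qed
  also have "\<dots> = (\<Prod>r\<in>UNIV. ?V r r)" by (simp add: sum.delta permutes_id)
  also have "\<dots> = ?V i i * (\<Prod>r\<in>UNIV - {i}. ?V r r)" by (rule prod.remove) auto
  also have "(\<Prod>r\<in>UNIV - {i}. ?V r r) = 1" by (rule prod.neutral) auto
  finally have "coldet ?V = ?V i i * 1" .
  thus ?thesis by (simp only: fun_upd_same mult_1_right)
qed

text \<open>By \<open>coldet_unit\<close> the variable is the determinant of a unit matrix with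
  column \<open>i\<close> replaced by column \<open>j\<close> of indeterminates. Exchanging that
  column with column \<open>f l\<close> leaves the entry \<open>(i, f l)\<close> as the second
  determinant.\<close>

lemma var_mult_max_minor:
  "var i j * max_minor f = (\<Sum>l\<in>UNIV. var i (f l) * (max_minor (f(l := j)) :: ('m::finite, 'n::finite, 'k::comm_ring_1) gpoly))"
proof -
  let ?F = "\<lambda>l r. var r (f l) :: ('m, 'n, 'k) gpoly"
  let ?G = "(\<lambda>k r. if r = k then 1 else 0)(i := \<lambda>r. var r j :: ('m, 'n, 'k) gpoly)"
  have "coldet ?F * coldet ?G = (\<Sum>l\<in>UNIV. coldet (?F(l := ?G i)) * coldet (?G(i := ?F l)))"
    by (rule coldet_single_exchange)
  moreover have "coldet (?F(l := ?G i)) = max_minor (f(l := j))" for l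
    unfolding max_minor_coldet by (rule arg_cong[where f = coldet]) auto
  moreover have "coldet (?G(i := ?F l)) = var i (f l)" for l
    using coldet_unit[of i "?F l"] by simp
  ultimately show ?thesis
    unfolding max_minor_coldet[of f] coldet_unit by (simp add: mult.commute)
qed

lemma card_rk_less: "card {x :: 'm::finite. rk x < rk (i :: 'm)} = rk i"
proof -
  have "rk ` {x :: 'm. rk x < rk i} = {..<rk i}"
  proof
    show "{..<rk i} \<subseteq> rk ` {x :: 'm. rk x < rk i}"
    proof
      fix r assume "r \<in> {..<rk i}"
      hence "rk (unrk r :: 'm) = r" using rk_less[of i] by simp
      thus "r \<in> rk ` {x :: 'm. rk x < rk i}" using \<open>r \<in> _\<close> by (metis imageI lessThan_iff mem_Collect_eq)
    qed
  qed auto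
  moreover have "inj_on rk {x :: 'm. rk x < rk i}" by (auto simp: inj_on_def)
  ultimately show ?thesis by (metis card_image card_lessThan)
qed

text \<open>An order statistic: sorting preserves the number of smaller values, and in the sorted
  sequence this number is the rank of the position.\<close>

lemma incr_permuted_value:
  fixes p :: "'m::finite \<Rightarrow> 'm" and g :: "'m \<Rightarrow> 'n::finite" and i :: 'm
  assumes p: "p permutes UNIV" and h: "incr (\<lambda>x. g (p x))" and a: "{x. rk (g x) < rk (g a)} = {x. rk x < rk i}"
  shows "g (p i) = g a"
proof -
  define b where "b = inv p a"
  have pb: "p b = a" by (simp add: b_def permutes_inverses[OF p])
  have "rk x < rk b \<longleftrightarrow> rk (g (p x)) < rk (g a)" for x
    using h pb unfolding incr_def by (cases "rk x" "rk b" rule: linorder_cases) force+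
  hence "{x. rk x < rk b} = {x. rk (g (p x)) < rk (g a)}" by (simp only:)
  also have "\<dots> = p -` {x. rk x < rk i}" using a by auto
  finally have "card {x :: 'm. rk x < rk b} = card (p -` {x :: 'm. rk x < rk i})" by (simp only:)
  also have "\<dots> = card {x :: 'm. rk x < rk i}"
    by (rule card_vimage_inj[OF permutes_inj[OF p]]) (simp add: permutes_surj[OF p])
  finally have "card {x :: 'm. rk x < rk b} = card {x :: 'm. rk x < rk i}" .
  hence "b = i" by (simp add: card_rk_less)
  thus ?thesis using pb by simp
qed

text \<open>Tie-breaker for the straightening induction: Cramer's relation has a term with unchanged
  leading monomial, in which the variable and the minor have traded columns.\<close>

definition colsum :: "('m::finite \<times> 'n::finite \<Rightarrow>\<^sub>0 nat) \<Rightarrow> nat" where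
  "colsum v = (\<Sum>u\<in>UNIV. lookup v u * rk (snd u))"

lemma colsum_add: "colsum (v + w) = colsum v + colsum w"
  by (simp add: colsum_def lookup_add sum.distrib distrib_right)

lemma colsum_sum: "colsum (\<Sum>a\<in>A. v a) = (\<Sum>a\<in>A. colsum (v a))"
  unfolding colsum_def lookup_sum sum_distrib_right by (rule sum.swap)

lemma colsum_single: "colsum (Poly_Mapping.single (i, j) k) = k * rk j"
proof -
  have "colsum (Poly_Mapping.single (i, j) k) = (\<Sum>u\<in>UNIV. if u = (i, j) then k * rk (snd u) else 0)"
    unfolding colsum_def by (intro sum.cong refl) (auto simp: lookup_single when_def)
  thus ?thesis by (simp add: sum.delta)
qed

lemma colsum_expm: "colsum (expm f) = (\<Sum>i\<in>UNIV. rk (f i))"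
  by (simp add: expm_def colsum_sum colsum_single)

text \<open>The terms of Cramer's relation have pairwise distinct leading monomials (they already differ in
  row \<open>i\<close>), hence nothing cancels in top weight and all terms but the one with \<open>l = i\<close> have smaller weight.\<close>

lemma var_mult_max_minor_straighten:
  fixes f :: "'m::finite \<Rightarrow> 'n::finite"
  assumes f: "incr f" and below: "\<And>i'. rk i' < rk i \<Longrightarrow> rk (f i') < rk j" and above: "rk j < rk (f i)"
  obtains h c where "\<And>l. incr (h l)"
    "var i j * max_minor f = (\<Sum>l\<in>UNIV. Poly_Mapping.single 0 (c l) * (var i (f l) * (max_minor (h l) :: ('m, 'n, 'k::field) gpoly)))"
    "\<And>l. wt (Poly_Mapping.single (i, f l) 1 + expm (h l)) < wt (Poly_Mapping.single (i, j) 1 + expm f) \<or>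
      Poly_Mapping.single (i, f l) 1 + expm (h l) = Poly_Mapping.single (i, j) 1 + expm f \<and> colsum (expm (h l)) < colsum (expm f)"
proof -
  have lo: "rk (f x) < rk j \<longleftrightarrow> rk x < rk i" for x
    using below[of x] above f unfolding incr_def
    by (metis less_trans linorder_neqE_nat order_less_asym rk_eq_iff)
  have lo': "rk (f x) < rk (f i) \<longleftrightarrow> rk x < rk i" for x
    using f unfolding incr_def by (metis linorder_neqE_nat order_less_asym rk_eq_iff)
  have jf: "f x \<noteq> j" for x
  proof
    assume "f x = j"
    hence "rk (f x) < rk (f i)" "\<not> rk (f x) < rk j" using above by auto
    thus False using lo lo' by blast
  qed
  have injf: "f x = f y \<longleftrightarrow> x = y" for x y using incr_inj[OF f] by (simp add: inj_eq)
  have injl: "inj (f(l := j))" for l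
    using jf injf by (auto simp: inj_def)
  define p where "p l = (SOME p. p permutes UNIV \<and> incr (\<lambda>x. (f(l := j)) (p x)))" for l
  have "p l permutes UNIV \<and> incr (\<lambda>x. (f(l := j)) (p l x))" for l
    unfolding p_def by (rule someI_ex[OF ex_incr_permutation[OF injl]])
  hence p: "p l permutes UNIV" "incr (\<lambda>x. (f(l := j)) (p l x))" for l
    by (rule conjunct1, rule conjunct2)
  define h where "h l = (\<lambda>x. (f(l := j)) (p l x))" for l
  define c where "c l = (of_int (sign (p l)) :: 'k)" for l
  have h: "incr (h l)" for l unfolding h_def by (rule p(2))
  have mm: "max_minor (f(l := j)) = Poly_Mapping.single 0 (c l) * (max_minor (h l) :: ('m, 'n, 'k) gpoly)" for l
    unfolding h_def max_minor_permute[OF p(1)] c_def by (simp add: of_int_sign_mult)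
  have eq: "var i j * max_minor f = (\<Sum>l\<in>UNIV. Poly_Mapping.single 0 (c l) * (var i (f l) * (max_minor (h l) :: ('m, 'n, 'k) gpoly)))"
    by (subst var_mult_max_minor) (simp only: mm mult.left_commute)
  \<comment> \<open>By \<open>below\<close> and \<open>above\<close>, column \<open>j\<close>
    belongs between positions below \<open>i\<close> and \<open>i\<close> itself. If a column before
    position \<open>i\<close> is removed, \<open>j\<close> fills the gap and \<open>f i\<close>
    stays; otherwise \<open>j\<close> takes position \<open>i\<close>.\<close>
  have hi: "h l i = (if rk l < rk i then f i else j)" for l
  proof -
    have "h l i = (f(l := j)) (if rk l < rk i then i else l)"
      unfolding h_def
    proof (rule incr_permuted_value[OF p])
      have "rk ((f(l := j)) x) < rk ((f(l := j)) (if rk l < rk i then i else l)) \<longleftrightarrow> rk x < rk i" for x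
      proof (cases "rk l < rk i")
        case True
        hence "l \<noteq> i" by auto
        thus ?thesis using True lo'[of x] above by (cases "x = l") simp_all
      next
        case False
        thus ?thesis using lo[of x] by (cases "x = l") simp_all
      qed
      thus "{x. rk ((f(l := j)) x) < rk ((f(l := j)) (if rk l < rk i then i else l))} = {x. rk x < rk i}"
        by (simp only:)
    qed
    thus ?thesis by auto
  qed
  define M where "M l = Poly_Mapping.single (i, f l) (1::nat) + expm (h l)" for l
  define M0 where "M0 = Poly_Mapping.single (i, j) (1::nat) + expm f"
  have lM: "lookup (M l) (i, x) = (if x = f l then 1 else 0) + (if x = h l i then 1 else 0)" for l x
    by (auto simp: M_def lookup_add lookup_expm lookup_single when_def)
  \<comment> \<open>In matrix row \<open>i\<close> the exponent \<open>M l\<close> has the columns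
    \<open>f l\<close> and \<open>h l i\<close>. If \<open>M l = M l'\<close> with
    \<open>l \<noteq> l'\<close>, then \<open>f l\<close> must be \<open>h l' i\<close>; it is not
    \<open>j\<close>, so it is \<open>f i\<close>. The same with the roles reversed would give
    \<open>l' = i\<close> as well.\<close>
  have row_i: "l = i \<and> rk l' < rk i" if e: "M l = M l'" and ne: "l \<noteq> l'" for l l'
  proof -
    have "lookup (M l') (i, f l) \<noteq> 0" unfolding e[symmetric] lM by simp
    hence "f l = h l' i" using ne injf unfolding lM by (metis add_0)
    hence "rk l' < rk i" "f l = f i" using jf[of l] unfolding hi by (metis, metis)
    thus ?thesis using injf by simp
  qed
  have inj: "inj M"
    by (rule injI) (metis row_i less_irrefl)
  have lt_var: "lt (var i x :: ('m, 'n, 'k) gpoly) (Poly_Mapping.single (i, x) 1)" for i x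
    unfolding var_def by (rule lt_single)
  have lts: "lt (var i (f l) * (max_minor (h l) :: ('m, 'n, 'k) gpoly)) (M l)" for l
    unfolding M_def by (intro lt_mult lt_var lt_max_minor h)
  have lt0: "lt (\<Sum>l\<in>UNIV. Poly_Mapping.single 0 (c l) * (var i (f l) * (max_minor (h l) :: ('m, 'n, 'k) gpoly))) M0"
    unfolding M0_def eq[symmetric] by (intro lt_mult lt_var lt_max_minor f)
  have c0: "c l \<noteq> 0" for l unfolding c_def by (rule sign_cases[of "p l"]) simp_all
  have bound: "M l = M0 \<or> wt (M l) < wt M0" for l
    by (rule lt_combination_bound[OF finite lts inj_on_subset[OF inj] c0 lt0]) auto
  \<comment> \<open>For \<open>l \<noteq> i\<close> the variable \<open>(i, f l)\<close> does not
    occur in \<open>M0\<close>, so only the weight alternative of \<open>bound\<close> is left. For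
    \<open>l = i\<close> the minor receives \<open>j\<close> instead of the larger
    \<open>f i\<close>, and \<open>colsum\<close> drops.\<close>
  have "wt (M l) < wt M0 \<or> M l = M0 \<and> colsum (expm (h l)) < colsum (expm f)" for l
  proof (cases "l = i")
    case False
    have "M l \<noteq> M0"
    proof
      assume "M l = M0"
      hence "lookup M0 (i, f l) \<noteq> 0" using lM[of l "f l"] by simp
      moreover have "lookup M0 (i, f l) = 0"
        using jf[of l] injf[of l i] False
        by (simp add: M0_def lookup_add lookup_single lookup_expm when_def)
      ultimately show False by simp
    qed
    thus ?thesis using bound by blast
  next
    case True
    have "colsum (expm (h l)) = (\<Sum>x\<in>UNIV. rk ((f(l := j)) x))"
      unfolding colsum_expm h_def using sum.permute[OF p(1)[of l], of "\<lambda>x. rk ((f(l := j)) x)"] by (simp add: comp_def)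
    also have "\<dots> < (\<Sum>x\<in>UNIV. rk (f x))"
      by (rule sum_strict_mono_ex1) (use above True in auto)
    finally show ?thesis using bound[of l] unfolding colsum_expm by blast
  qed
  thus thesis unfolding M_def M0_def by (intro that[OF h eq])
qed

section \<open>Straightening monomials times products of minors\<close>

definition standard_elements :: "nat \<Rightarrow> ('m::finite, 'n::finite, 'k::comm_ring_1) gpoly set" where
  "standard_elements N = {Poly_Mapping.single u 1 * minors_prod N D | u D. standard N u D}"

lemma minors_prod_split:
  assumes "k < N"
  shows "minors_prod N D = max_minor (D k) * (\<Prod>j\<in>{..<N} - {k}. max_minor (D j))"
    "lexp N D = expm (D k) + (\<Sum>j\<in>{..<N} - {k}. expm (D j))"
  unfolding minors_prod_def lexp_def using assms by (simp_all add: prod.remove sum.remove)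

lemma mult_span:
  assumes "x \<in> kv.span T" "\<And>t. t \<in> T \<Longrightarrow> s * t \<in> kv.span S"
  shows "s * x \<in> kv.span S"
  using assms(1)
proof (induction rule: kv.span_induct)
  case base
  show ?case
    by (rule kv.subspaceI)
      (auto simp: kv.span_zero distrib_left mult.left_commute[of s] intro: kv.span_add kv.span_scale)
qed (use assms(2) in auto)

text \<open>Lexicographic descent on weight and \<open>colsum\<close>. First the minors are replaced
  by chains; a chain that is still not standard with \<open>u\<close> has a tradable variable, and
  Cramer's relation replaces the pair by pairs that are lighter, or equally heavy with smaller
  \<open>colsum\<close>.\<close>

lemma single_mult_minors_prod_in_span:
  fixes D :: "nat \<Rightarrow> 'm::finite \<Rightarrow> 'n::finite"
  assumes "rows_incr N D"
  shows "Poly_Mapping.single u 1 * (minors_prod N D :: ('m, 'n, 'k::field) gpoly) \<in> kv.span (standard_elements N)"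
  using assms
proof (induction "(wt (u + lexp N D), colsum (lexp N D))" arbitrary: u D
    rule: wf_induct_rule[OF wf_lex_prod[OF wf_less_than wf_less_than]])
  case (1 u D)
  let ?S = "standard_elements N :: ('m, 'n, 'k) gpoly set"
  have IH: "Poly_Mapping.single u' 1 * minors_prod N D' \<in> kv.span ?S"
    if "rows_incr N D'" "wt (u' + lexp N D') < wt (u + lexp N D) \<or>
      wt (u' + lexp N D') = wt (u + lexp N D) \<and> colsum (lexp N D') < colsum (lexp N D)" for u' D'
    using 1(1)[OF _ that(1), of u'] that(2) by auto
  \<comment> \<open>Equality of \<open>lexp\<close> keeps both components of the measure, so the
    induction hypothesis for \<open>D\<close> may be used for \<open>E\<close>. Chains with another
    \<open>lexp\<close> are lighter and need no further analysis.\<close>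
  have chain_case: "Poly_Mapping.single u 1 * minors_prod N E \<in> kv.span ?S"
    if E: "chain N E" and eq: "lexp N E = lexp N D" for E
  proof (cases "standard N u E")
    case True
    thus ?thesis by (intro kv.span_base) (auto simp: standard_elements_def)
  next
    case False
    then obtain k i j where k: "k < N" and uij: "lookup u (i, j) \<noteq> 0"
      and ij: "\<And>i'. rk i' < rk i \<Longrightarrow> rk (E k i') < rk j" "rk j < rk (E k i)"
      using E by (auto simp: standard_def)
    define u0 where "u0 = u - Poly_Mapping.single (i, j) 1"
    have u: "u = u0 + Poly_Mapping.single (i, j) 1"
    proof (rule poly_mapping_eqI)
      fix x show "lookup u x = lookup (u0 + Poly_Mapping.single (i, j) 1) x"
        using uij by (cases "x = (i, j)") (auto simp: u0_def lookup_add lookup_minus lookup_single when_def)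
    qed
    have rE: "rows_incr N E" using E by (simp add: chain_def)
    hence incrE: "incr (E k)" using k by (simp add: rows_incr_def)
    obtain h c where h: "\<And>l. incr (h l)"
      and rel: "var i j * max_minor (E k) = (\<Sum>l\<in>UNIV. Poly_Mapping.single 0 (c l) * (var i (E k l) * (max_minor (h l) :: ('m, 'n, 'k) gpoly)))"
      and less: "\<And>l. wt (Poly_Mapping.single (i, E k l) 1 + expm (h l)) < wt (Poly_Mapping.single (i, j) 1 + expm (E k)) \<or>
        Poly_Mapping.single (i, E k l) 1 + expm (h l) = Poly_Mapping.single (i, j) 1 + expm (E k) \<and> colsum (expm (h l)) < colsum (expm (E k))"
      by (rule var_mult_max_minor_straighten[OF incrE ij], blast, rule that)
    define R where "R = (\<Prod>j\<in>{..<N} - {k}. max_minor (E j) :: ('m, 'n, 'k) gpoly)"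
    define Re where "Re = (\<Sum>j\<in>{..<N} - {k}. expm (E j))"
    define E' where "E' l = E(k := h l)" for l
    have E': "minors_prod N (E' l) = max_minor (h l) * R" "lexp N (E' l) = expm (h l) + Re" for l
    proof -
      have "(\<Prod>j\<in>{..<N} - {k}. max_minor (E' l j) :: ('m, 'n, 'k) gpoly) = R"
        "(\<Sum>j\<in>{..<N} - {k}. expm (E' l j)) = Re"
        unfolding R_def Re_def by (intro prod.cong sum.cong refl; simp add: E'_def)+
      thus "minors_prod N (E' l) = max_minor (h l) * R" "lexp N (E' l) = expm (h l) + Re"
        unfolding minors_prod_split[OF k] by (simp_all add: E'_def)
    qed
    have EN: "lexp N E = expm (E k) + Re" unfolding Re_def by (rule minors_prod_split(2)[OF k])
    have s: "Poly_Mapping.single (u0 + Poly_Mapping.single (i, x) 1) (1::'k) = Poly_Mapping.single u0 1 * var i x" for x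
      by (simp add: var_def mult_single)
    have "Poly_Mapping.single u 1 * minors_prod N E = Poly_Mapping.single u0 1 * (var i j * max_minor (E k)) * R"
      unfolding minors_prod_split(1)[OF k] R_def u s by (simp only: mult.assoc)
    also have "\<dots> = (\<Sum>l\<in>UNIV. Poly_Mapping.single 0 (c l) *
       (Poly_Mapping.single (u0 + Poly_Mapping.single (i, E k l) 1) 1 * minors_prod N (E' l)))"
      unfolding rel s E' by (simp add: sum_distrib_left sum_distrib_right mult_ac)
    also have "\<dots> \<in> kv.span ?S"
    proof (intro kv.span_sum kv.span_scale IH)
      fix l
      show "rows_incr N (E' l)" using rE h by (simp add: rows_incr_def E'_def)
      have a: "u0 + Poly_Mapping.single (i, E k l) 1 + lexp N (E' l) =
        (u0 + Re) + (Poly_Mapping.single (i, E k l) 1 + expm (h l))"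
        by (simp add: E' ac_simps)
      have b: "u + lexp N D = (u0 + Re) + (Poly_Mapping.single (i, j) 1 + expm (E k))"
        unfolding eq[symmetric] EN u by (simp add: ac_simps)
      have d: "colsum (lexp N (E' l)) = colsum (expm (h l)) + colsum Re" by (simp add: E' colsum_add)
      have e: "colsum (lexp N D) = colsum (expm (E k)) + colsum Re" unfolding eq[symmetric] EN by (simp add: colsum_add)
      have cmp: "wt (Poly_Mapping.single (i, E k l) 1 + expm (h l)) < wt (Poly_Mapping.single (i, j) 1 + expm (E k)) \<or>
        wt (Poly_Mapping.single (i, E k l) 1 + expm (h l)) = wt (Poly_Mapping.single (i, j) 1 + expm (E k)) \<and>
        colsum (expm (h l)) < colsum (expm (E k))"
        using less[of l] by metis
      show "wt (u0 + Poly_Mapping.single (i, E k l) 1 + lexp N (E' l)) < wt (u + lexp N D) \<or>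
        wt (u0 + Poly_Mapping.single (i, E k l) 1 + lexp N (E' l)) = wt (u + lexp N D) \<and>
        colsum (lexp N (E' l)) < colsum (lexp N D)"
        using cmp unfolding a b d e wt_add[of "u0 + Re"] by simp
    qed
    finally show ?thesis .
  qed
  show ?case
  proof (rule mult_span[OF minors_prod_in_span_chain_le[OF 1(2)]])
    fix t :: "('m, 'n, 'k) gpoly"
    assume "t \<in> {minors_prod N D' |D'. chain N D' \<and> (lexp N D' = lexp N D \<or> wt (lexp N D') < wt (lexp N D))}"
    then obtain E where E: "t = minors_prod N E" "chain N E" "lexp N E = lexp N D \<or> wt (lexp N E) < wt (lexp N D)"
      by blast
    show "Poly_Mapping.single u 1 * t \<in> kv.span ?S"
    proof (cases "lexp N E = lexp N D")
      case True
      thus ?thesis using chain_case E by simp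
    next
      case False
      hence "wt (lexp N E) < wt (lexp N D)" using E(3) by blast
      thus ?thesis unfolding E(1) using E(2) by (intro IH) (simp_all add: chain_def wt_add)
    qed
  qed
qed

section \<open>A nonzerodivisor modulo all powers\<close>

lemma lookup_single_mult:
  fixes f :: "('v::cancel_comm_monoid_add) \<Rightarrow>\<^sub>0 'k::comm_ring_1"
  shows "lookup (Poly_Mapping.single y c * f) (y + v) = c * lookup f v"
proof -
  have "lookup (Poly_Mapping.single y c * f) (y + v) =
    lookup (\<Sum>w\<in>keys f. Poly_Mapping.single (y + w) (c * lookup f w)) (y + v)"
    by (subst poly_mapping_sum_single[of f]) (simp add: sum_distrib_left mult_single)
  also have "\<dots> = (\<Sum>w\<in>keys f. if w = v then c * lookup f w else 0)"
    unfolding lookup_sum by (intro sum.cong refl) (auto simp: lookup_single when_def)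
  finally show ?thesis by (simp add: sum.delta in_keys_iff)
qed

lemma max_minor_in_ideal: "inj f \<Longrightarrow> max_minor f \<in> maximal_minors_ideal"
  unfolding maximal_minors_ideal_def by (rule subsetD[OF ideal_gen_superset]) blast

lemma minors_prod_in_ideal_pow:
  assumes "rows_incr N D"
  shows "minors_prod N D \<in> ideal_pow maximal_minors_ideal N"
proof -
  have "(\<Prod>k\<in>{..<N}. max_minor (D k)) \<in> ideal_pow maximal_minors_ideal (card {..<N})"
    by (rule ideal_pow_prod) (use assms in \<open>auto simp: rows_incr_def intro: max_minor_in_ideal incr_inj\<close>)
  thus ?thesis by (simp add: minors_prod_def)
qed

text \<open>A monomial times a standard element is again a monomial times a product of minors and
  can be straightened; linearity does the rest.\<close>

lemma ideal_span_standard: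
  "is_ideal (kv.span (standard_elements N :: ('m::finite, 'n::finite, 'k::field) gpoly set))"
proof -
  let ?J = "kv.span (standard_elements N :: ('m, 'n, 'k) gpoly set)"
  have "r * x \<in> ?J" if x: "x \<in> ?J" for r x :: "('m, 'n, 'k) gpoly"
  proof -
    have "Poly_Mapping.single v (1::'k) * x \<in> ?J" for v
    proof (rule mult_span[OF x])
      fix t :: "('m, 'n, 'k) gpoly" assume "t \<in> standard_elements N"
      then obtain u D where t: "t = Poly_Mapping.single u 1 * minors_prod N D" "standard N u D"
        by (auto simp: standard_elements_def)
      have "Poly_Mapping.single v 1 * t = Poly_Mapping.single (v + u) 1 * minors_prod N D"
        by (simp add: t(1) mult_single flip: mult.assoc)
      moreover have "rows_incr N D" using t(2) by (simp add: standard_def chain_def)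
      ultimately show "Poly_Mapping.single v 1 * t \<in> ?J" by (simp add: single_mult_minors_prod_in_span)
    qed
    hence "(\<Sum>v\<in>keys r. Poly_Mapping.single 0 (lookup r v) * (Poly_Mapping.single v 1 * x)) \<in> ?J"
      by (intro kv.span_sum kv.span_scale)
    also have "(\<Sum>v\<in>keys r. Poly_Mapping.single 0 (lookup r v) * (Poly_Mapping.single v 1 * x)) = r * x"
      by (subst (3) poly_mapping_sum_single[of r]) (simp add: sum_distrib_right mult_single flip: mult.assoc)
    finally show ?thesis .
  qed
  thus ?thesis by (auto simp: is_ideal_def kv.span_zero intro: kv.span_add)
qed

lemma ideal_pow_subset_span:
  "ideal_pow maximal_minors_ideal N \<subseteq> kv.span (standard_elements N :: ('m::finite, 'n::finite, 'k::field) gpoly set)"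
proof (induction N)
  case 0
  have "Poly_Mapping.single 0 1 * minors_prod 0 undefined \<in> kv.span (standard_elements 0 :: ('m, 'n, 'k) gpoly set)"
    by (rule single_mult_minors_prod_in_span) (simp add: rows_incr_def)
  hence "1 \<in> kv.span (standard_elements 0 :: ('m, 'n, 'k) gpoly set)" by (simp add: minors_prod_def)
  from is_idealD(4)[OF ideal_span_standard this] show ?case by auto
next
  case (Suc N)
  let ?I = "ideal_pow maximal_minors_ideal N :: ('m, 'n, 'k) gpoly set"
  let ?J = "kv.span (standard_elements (Suc N) :: ('m, 'n, 'k) gpoly set)"
  have "is_ideal ?J" by (rule ideal_span_standard)
  note J = is_idealD[OF this]
  have gen: "x * max_minor f \<in> ?J" if x: "x \<in> ?I" and f: "inj f" for x f
  proof -
    obtain p where p: "p permutes UNIV" "incr (\<lambda>i. f (p i))" using ex_incr_permutation[OF f] by blast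
    define h where "h = (\<lambda>i. f (p i))"
    have mm: "(max_minor f :: ('m, 'n, 'k) gpoly) = of_int (sign p) * max_minor h"
      unfolding h_def max_minor_permute[OF p(1)] by (simp add: of_int_sign_mult)
    have "max_minor h * x \<in> ?J"
    proof (rule mult_span)
      show "x \<in> kv.span (standard_elements N)" using x Suc.IH by blast
      fix t :: "('m, 'n, 'k) gpoly" assume "t \<in> standard_elements N"
      then obtain u D where t: "t = Poly_Mapping.single u 1 * minors_prod N D" "standard N u D"
        by (auto simp: standard_elements_def)
      have "minors_prod (Suc N) (D(N := h)) = (minors_prod N D * max_minor h :: ('m, 'n, 'k) gpoly)"
        by (simp add: minors_prod_def)
      hence "max_minor h * t = Poly_Mapping.single u 1 * minors_prod (Suc N) (D(N := h))"
        by (simp add: t(1) mult_ac)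
      moreover have "rows_incr (Suc N) (D(N := h))"
        using t(2) p(2) by (auto simp: standard_def chain_def rows_incr_def h_def)
      ultimately show "max_minor h * t \<in> ?J" by (simp add: single_mult_minors_prod_in_span)
    qed
    hence "of_int (sign p) * (max_minor h * x) \<in> ?J" by (rule span_sign)
    thus ?thesis by (simp add: mm mult_ac)
  qed
  have "is_ideal {y. \<forall>x\<in>?I. x * y \<in> ?J}"
    unfolding is_ideal_def by (auto simp: distrib_left mult.left_commute intro: J(1-3))
  moreover have "{max_minor f | f. inj f} \<subseteq> {y. \<forall>x\<in>?I. x * y \<in> ?J}" using gen by blast
  ultimately have "ideal_gen {max_minor f | f. inj f} \<subseteq> {y. \<forall>x\<in>?I. x * y \<in> ?J}" by (rule ideal_gen_least)
  hence "maximal_minors_ideal \<subseteq> {y. \<forall>x\<in>?I. x * y \<in> ?J}"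
    by (simp only: maximal_minors_ideal_def[symmetric])
  hence "{x * y |x y. x \<in> ?I \<and> y \<in> maximal_minors_ideal} \<subseteq> ?J" by blast
  from ideal_gen_least[OF ideal_span_standard this] show ?case by simp
qed

text \<open>\<open>w\<close> is any heaviest monomial of \<open>g\<close>, not necessarily the only
  one. After dropping zero coefficients, the heaviest standard elements survive in \<open>g\<close>,
  so none is heavier than \<open>w\<close>, and the coefficient at \<open>w\<close> must come from
  one that leads there.\<close>

lemma ideal_pow_leading_monomial:
  fixes g :: "('m::finite, 'n::finite, 'k::field) gpoly"
  assumes g: "g \<in> ideal_pow maximal_minors_ideal N" and w: "lookup g w \<noteq> 0"
    and max: "\<And>v. lookup g v \<noteq> 0 \<Longrightarrow> wt v \<le> wt w"
  shows "\<exists>u D. standard N u D \<and> w = u + lexp N D"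
proof -
  have "g \<in> kv.span (standard_elements N)" using g ideal_pow_subset_span by blast
  then obtain t r where t: "finite t" "t \<subseteq> standard_elements N" "g = (\<Sum>a\<in>t. Poly_Mapping.single 0 (r a) * a)"
    unfolding kv.span_explicit by auto
  define F where "F = {a\<in>t. r a \<noteq> 0}"
  have F: "finite F" using t(1) by (simp add: F_def)
  have r: "r a \<noteq> 0" if "a \<in> F" for a using that by (simp add: F_def)
  have gF: "g = (\<Sum>a\<in>F. Poly_Mapping.single 0 (r a) * a)"
    unfolding t(3) F_def by (rule sum.mono_neutral_right) (use t(1) in auto)
  have "\<forall>a\<in>F. \<exists>u D. standard N u D \<and> a = Poly_Mapping.single u 1 * minors_prod N D"
    using t(2) unfolding F_def standard_elements_def by blast
  then obtain U E where E: "\<And>a. a \<in> F \<Longrightarrow> standard N (U a) (E a)"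
    "\<And>a. a \<in> F \<Longrightarrow> a = Poly_Mapping.single (U a) 1 * minors_prod N (E a)" by metis
  define v where "v a = U a + lexp N (E a)" for a
  have lt: "lt a (v a)" if "a \<in> F" for a
  proof -
    have "rows_incr N (E a)" using E(1)[OF that] by (simp add: standard_def chain_def)
    hence "lt (Poly_Mapping.single (U a) 1 * minors_prod N (E a)) (v a)"
      unfolding v_def by (intro lt_mult lt_single lt_minors_prod)
    thus ?thesis using E(2)[OF that] by metis
  qed
  have inj: "inj_on v F"
  proof (rule inj_onI)
    fix a b assume ab: "a \<in> F" "b \<in> F" "v a = v b"
    have e: "E a k = E b k" if "k < N" for k
      by (rule ext, rule standard_unique[OF E(1)[OF ab(1)] E(1)[OF ab(2)] _ that]) (use ab(3) in \<open>simp add: v_def\<close>)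
    hence "lexp N (E a) = lexp N (E b)" "minors_prod N (E a) = (minors_prod N (E b) :: ('m, 'n, 'k) gpoly)"
      by (simp_all add: lexp_def minors_prod_def)
    moreover from this have "U a = U b" using ab(3) by (simp add: v_def)
    ultimately show "a = b" using E(2)[OF ab(1)] E(2)[OF ab(2)] by metis
  qed
  have le: "wt (v b) \<le> wt w" if "b \<in> F" for b
  proof -
    have "Max ((\<lambda>a. wt (v a)) ` F) \<in> (\<lambda>a. wt (v a)) ` F" using F that by (intro Max_in) auto
    then obtain a where a: "a \<in> F" "Max ((\<lambda>a. wt (v a)) ` F) = wt (v a)" by (elim imageE) simp
    have m: "wt (v b) \<le> wt (v a)" if "b \<in> F" for b
      using Max_ge[of "(\<lambda>a. wt (v a)) ` F" "wt (v b)"] F that by (simp add: a(2))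
    have "lookup g (v a) = r a"
      unfolding gF by (rule lt_combination_lookup(2)[OF F lt inj m a(1) refl])
    hence "wt (v a) \<le> wt w" using r[OF a(1)] by (intro max) simp
    thus ?thesis using m[OF that] by simp
  qed
  have "lookup g w = (\<Sum>a\<in>{a\<in>F. v a = w}. r a)"
    unfolding gF by (rule lt_combination_lookup(1)[OF F lt inj le])
  hence "{a\<in>F. v a = w} \<noteq> {}" using w by (metis sum.empty)
  thus ?thesis using E(1) by (auto simp: v_def)
qed

text \<open>The \<open>rk i\<close> smaller positions take distinct smaller columns. Hence the
  leading monomial of a minor contains no variable strictly below the diagonal.\<close>

lemma incr_ge:
  assumes "incr (f :: 'm::finite \<Rightarrow> 'n::finite)"
  shows "rk i \<le> rk (f i)"
proof -
  have "card {x :: 'm. rk x < rk i} \<le> card {..<rk (f i)}"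
  proof (rule card_inj_on_le[where f = "\<lambda>x. rk (f x)"])
    show "inj_on (\<lambda>x. rk (f x)) {x. rk x < rk i}"
      by (rule inj_onI) (simp add: inj_eq[OF incr_inj[OF assms]])
    show "(\<lambda>x. rk (f x)) ` {x. rk x < rk i} \<subseteq> {..<rk (f i)}" using assms by (auto simp: incr_def)
  qed simp
  thus ?thesis by (simp add: card_rk_less)
qed

text \<open>Descent on the weight of \<open>f\<close>: a heaviest monomial of \<open>f\<close>,
  shifted by \<open>y\<close>, is a heaviest monomial of \<open>d * f\<close>. As \<open>y\<close>
  is coprime to all diagonals, it can be divided out, and the monomial of \<open>f\<close> already
  leads an element of the power.\<close>

lemma ideal_pow_nonzerodivisor:
  fixes d f :: "('m::finite, 'n::finite, 'k::field) gpoly"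
  assumes d: "lt d y" and y: "\<And>i j. lookup y (i, j) \<noteq> 0 \<Longrightarrow> rk j < rk i"
    and df: "d * f \<in> ideal_pow maximal_minors_ideal N"
  shows "f \<in> ideal_pow maximal_minors_ideal N"
proof -
  let ?I = "ideal_pow maximal_minors_ideal N :: ('m, 'n, 'k) gpoly set"
  note I = is_idealD[OF is_ideal_ideal_pow[of maximal_minors_ideal N]]
  have claim: "f \<in> ?I" if "f \<in> low c" "d * f \<in> ?I" for c f
    using that
  proof (induction c arbitrary: f)
    case 0
    hence "f = 0" by (intro poly_mapping_eqI) (auto simp: low_def)
    thus ?case using I(1) by simp
  next
    case (Suc c)
    define U where "U = {v. lookup f v \<noteq> 0 \<and> wt v = c}"
    have U: "finite U" by (rule finite_subset[of _ "keys f"]) (auto simp: U_def in_keys_iff)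
    have top: "lookup (d * f) (y + v) = lookup f v" if "wt v = c" for v
    proof -
      have "f * (d - Poly_Mapping.single y 1) \<in> low (c + wt y)"
        using d Suc.prems(1) by (intro low_mult) (simp_all add: lt_def)
      hence "lookup (f * (d - Poly_Mapping.single y 1)) (y + v) = 0"
        using that unfolding low_def by (auto simp: wt_add)
      moreover have "d * f = Poly_Mapping.single y 1 * f + f * (d - Poly_Mapping.single y 1)" by (simp add: algebra_simps)
      ultimately show ?thesis by (simp add: lookup_add lookup_single_mult)
    qed
    have df_low: "f * d \<in> low (c + Suc (wt y))"
      by (rule low_mult[OF Suc.prems(1) lt_low[OF d]])
    have "\<exists>e. e \<in> ?I \<and> lt e v" if v: "v \<in> U" for v
    proof -
      have "\<exists>u D. standard N u D \<and> y + v = u + lexp N D"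
      proof (rule ideal_pow_leading_monomial[OF Suc.prems(2)])
        show "lookup (d * f) (y + v) \<noteq> 0" using v top by (simp add: U_def)
        show "wt v' \<le> wt (y + v)" if "lookup (d * f) v' \<noteq> 0" for v'
          using df_low that v by (auto simp: low_def wt_add U_def mult.commute)
      qed
      then obtain u D where uD: "standard N u D" "y + v = u + lexp N D" by blast
      have rD: "rows_incr N D" using uD(1) by (simp add: standard_def chain_def)
      \<comment> \<open>The variables of \<open>y\<close> lie strictly below the diagonal and do not
        occur in \<open>lexp N D\<close>, so all of \<open>y\<close> must be contained in
        \<open>u\<close>.\<close>
      have yu: "lookup y x \<le> lookup u x" for x
      proof (cases "lookup y x = 0")
        case False
        obtain i j where x: "x = (i, j)" by (cases x)
        have "D k i \<noteq> j" if "k < N" for k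
        proof -
          have "rk i \<le> rk (D k i)" using rD that by (intro incr_ge) (simp add: rows_incr_def)
          thus ?thesis using y[of i j] False unfolding x by auto
        qed
        hence "{k. k < N \<and> D k i = j} = {}" by blast
        hence "lookup (lexp N D) x = 0" by (simp add: x lookup_lexp)
        thus ?thesis using arg_cong[OF uD(2), of "\<lambda>g. lookup g x"] by (simp add: lookup_add)
      qed simp
      define u' where "u' = u - y"
      have "u = y + u'" using yu by (intro poly_mapping_eqI) (simp add: u'_def lookup_add lookup_minus)
      hence "v = u' + lexp N D" using uD(2) by (simp add: add.assoc)
      moreover have "lt (Poly_Mapping.single u' 1 * minors_prod N D :: ('m, 'n, 'k) gpoly) (u' + lexp N D)"
        by (intro lt_mult lt_single lt_minors_prod rD)
      moreover have "(Poly_Mapping.single u' 1 * minors_prod N D :: ('m, 'n, 'k) gpoly) \<in> ?I"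
        by (rule I(3)[OF minors_prod_in_ideal_pow[OF rD]])
      ultimately show ?thesis by metis
    qed
    hence "\<forall>v\<in>U. \<exists>e. e \<in> ?I \<and> lt e v" by blast
    from bchoice[OF this] obtain e where e: "\<And>v. v \<in> U \<Longrightarrow> e v \<in> ?I" "\<And>v. v \<in> U \<Longrightarrow> lt (e v) v" by blast
    \<comment> \<open>The weight is not a total order, so all monomials of weight \<open>c\<close>
      are removed at once; the lower terms of the \<open>e v\<close> stay below
      \<open>c\<close>.\<close>
    define s where "s = (\<Sum>v\<in>U. Poly_Mapping.single 0 (lookup f v) * e v)"
    have sI: "s \<in> ?I" unfolding s_def by (intro is_ideal_sum[OF is_ideal_ideal_pow] I(3) e(1))
    have "f - s \<in> low c"
    proof -
      have "wt v < c" if "lookup (f - s) v \<noteq> 0" for v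
      proof (rule ccontr)
        assume "\<not> wt v < c"
        hence cv: "c \<le> wt v" by simp
        have "lookup s v = (\<Sum>v'\<in>U. if v' = v then lookup f v' else 0)"
          unfolding s_def lookup_sum lookup_single_zero_mult
          by (intro sum.cong refl) (use cv in \<open>auto simp: lt_lookup[OF e(2)] U_def\<close>)
        also have "\<dots> = (if v \<in> U then lookup f v else 0)" using U by (simp add: sum.delta)
        also have "\<dots> = lookup f v" using cv Suc.prems(1) by (auto simp: U_def low_def)
        finally show False using that by (simp add: lookup_minus)
      qed
      thus ?thesis by (simp add: low_def)
    qed
    moreover have "d * (f - s) \<in> ?I" unfolding right_diff_distrib by (rule I(6)[OF Suc.prems(2) I(3)[OF sI]])
    ultimately have "f - s \<in> ?I" by (rule Suc.IH)
    from I(2)[OF this sI] show ?case by simp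
  qed
  have "f \<in> low (Suc (Max (wt ` keys f)))"
    unfolding low_def by (auto simp: less_Suc_eq_le in_keys_iff intro!: Max_ge)
  thus ?thesis using claim df by blast
qed

text \<open>The minor of the first \<open>m - 1\<close> columns and the last \<open>m - 1\<close> rows; its leading monomial involves only variables
  below the diagonal, which divide no leading monomial of a maximal minor.\<close>

definition corner_minor :: "('m::finite, 'n::finite, 'k::comm_ring_1) gpoly" where
  "corner_minor = coldet (\<lambda>k r. if rk k = 0 then (if r = k then 1 else 0) else var r (unrk (rk k - 1)))"

lemma lt_corner_minor:
  assumes mn: "CARD('m) \<le> CARD('n)"
  shows "\<exists>y. lt (corner_minor :: ('m::finite, 'n::finite, 'k::comm_ring_1) gpoly) y \<and>
    (\<forall>i j. lookup y (i, j) \<noteq> 0 \<longrightarrow> rk j < rk i)"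
proof -
  \<comment> \<open>The unit column of rank 0 borders the minor of size m - 1 to size m, which makes
    the exchange relation with a maximal minor available. The column of rank \<open>k\<close> holds
    column \<open>k - 1\<close> of indeterminates.\<close>
  define V where "V k r = (if rk k = 0 then (if r = k then 1 else 0) else var r (unrk (rk k - 1)) :: ('m, 'n, 'k) gpoly)" for k r
  define z where "z = (unrk 0 :: 'm)"
  have z: "rk k = 0 \<longleftrightarrow> k = z" for k
    by (metis rk_unrk z_def zero_less_card_finite rk_eq_iff)
  define E where "E p = (\<Sum>r\<in>UNIV - {z}. Poly_Mapping.single (r, unrk (rk (p r) - 1) :: 'n) (1::nat))" for p :: "'m \<Rightarrow> 'm"
  have prod: "(\<Prod>r\<in>UNIV. V (p r) r) = (if p z = z then Poly_Mapping.single (E p) 1 else 0)" if p: "p permutes UNIV" for p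
  proof (cases "p z = z")
    case True
    have "p r \<noteq> z" if "r \<noteq> z" for r using permutes_inj[OF p] True that by (metis injD)
    hence "(\<Prod>r\<in>UNIV - {z}. V (p r) r) = (\<Prod>r\<in>UNIV - {z}. Poly_Mapping.single (Poly_Mapping.single (r, unrk (rk (p r) - 1)) 1) 1)"
      by (intro prod.cong refl) (simp add: V_def z var_def)
    also have "\<dots> = Poly_Mapping.single (E p) 1" by (simp add: prod_single E_def)
    moreover have "V (p z) z = 1" using True z by (simp add: V_def)
    ultimately show ?thesis using True by (subst prod.remove[of _ z]) simp_all
  next
    case False
    obtain r where r: "p r = z" using permutes_surj[OF p] by (metis surjD)
    have "r \<noteq> z" using False r by metis
    hence "V (p r) r = 0" using r z by (simp add: V_def)
    hence "\<exists>r\<in>UNIV. V (p r) r = 0" by blast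
    hence "(\<Prod>r\<in>UNIV. V (p r) r) = 0" by (rule prod_zero[OF finite])
    thus ?thesis using False by simp
  qed
  \<comment> \<open>Column \<open>rk (p r) - 1\<close> has weight factor \<open>rk (p r)\<close>,
    which is 0 in the omitted row \<open>z\<close>. The sum may thus run over all rows, as
    \<open>strict_rearrangement\<close> requires.\<close>
  have wtE: "wt (E p) = (\<Sum>r\<in>UNIV. Suc (rk r) * rk (p r))" if p: "p permutes UNIV" "p z = z" for p
  proof -
    have "wt (E p) = (\<Sum>r\<in>UNIV - {z}. Suc (rk r) * rk (p r))"
      unfolding E_def wt_sum
    proof (rule sum.cong[OF refl])
      fix r assume "r \<in> UNIV - {z}"
      hence "p r \<noteq> z" using permutes_inj[OF p(1)] p(2) by (metis DiffD2 injD singletonI)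
      hence "rk (p r) \<noteq> 0" using z by simp
      moreover have "rk (p r) - 1 < CARD('n)" using rk_less[of "p r"] mn by simp
      ultimately show "wt (Poly_Mapping.single (r, unrk (rk (p r) - 1) :: 'n) 1) = Suc (rk r) * rk (p r)"
        by (simp add: wt_single)
    qed
    moreover have "rk (p z) = 0" using p(2) z by simp
    ultimately show ?thesis by (simp add: sum.remove[of UNIV z])
  qed
  let ?t = "\<lambda>p. of_int (sign p) * (\<Prod>r\<in>UNIV. V (p r) r)"
  have "corner_minor = (\<Sum>p | p permutes (UNIV :: 'm set). ?t p)"
    by (simp add: corner_minor_def coldet_def V_def)
  also have "\<dots> = ?t id + (\<Sum>p\<in>{p. p permutes (UNIV :: 'm set)} - {id}. ?t p)"
    by (rule sum.remove) (auto simp: permutes_id)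
  also have "?t id = Poly_Mapping.single (E id) 1" using prod[OF permutes_id] by simp
  finally have expansion: "corner_minor = Poly_Mapping.single (E id) 1 + (\<Sum>p\<in>{p. p permutes (UNIV :: 'm set)} - {id}. ?t p)" .
  have "corner_minor - Poly_Mapping.single (E id) 1 = (\<Sum>p\<in>{p. p permutes (UNIV :: 'm set)} - {id}. ?t p)"
    unfolding expansion by (rule add_diff_cancel_left')
  also have "\<dots> \<in> low (wt (E id))"
  proof (rule low_sum)
    fix p assume "p \<in> {p. p permutes (UNIV :: 'm set)} - {id}"
    hence p: "p permutes UNIV" "p \<noteq> id" by auto
    show "?t p \<in> low (wt (E id))"
    proof (cases "p z = z")
      case True
      have "(\<Sum>r\<in>UNIV. Suc (rk r) * rk (p r)) < (\<Sum>r\<in>(UNIV :: 'm set). Suc (rk r) * rk r)"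
        by (rule strict_rearrangement[of rk, OF _ p])
      hence "wt (E p) < wt (E id)" using wtE[OF p(1) True] wtE[OF permutes_id] by simp
      thus ?thesis using True unfolding of_int_sign_single prod[OF p(1)] by (auto intro: low_single low_uminus)
    next
      case False
      thus ?thesis by (simp add: prod[OF p(1)])
    qed
  qed
  finally have "lt (corner_minor :: ('m, 'n, 'k) gpoly) (E id)" by (simp add: lt_def)
  moreover have "rk j < rk i" if "lookup (E id) (i, j) \<noteq> 0" for i j
  proof -
    have "\<exists>r\<in>UNIV - {z}. lookup (Poly_Mapping.single (r, unrk (rk r - 1) :: 'n) (1::nat)) (i, j) \<noteq> 0"
    proof (rule ccontr)
      assume "\<not> ?thesis"
      hence "lookup (E id) (i, j) = 0" unfolding E_def lookup_sum id_apply by (intro sum.neutral) blast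
      thus False using that by simp
    qed
    then obtain r where r: "r \<noteq> z" "r = i" "j = unrk (rk r - 1)"
      by (auto simp: lookup_single when_def split: if_splits)
    have "rk i \<noteq> 0" using r z by simp
    moreover have "rk i - 1 < CARD('n)" using rk_less[of i] mn by simp
    ultimately show ?thesis using r by simp
  qed
  ultimately show ?thesis by blast
qed

lemma corner_minor_nonzerodivisor:
  fixes f :: "('m::finite, 'n::finite, 'k::field) gpoly"
  assumes "CARD('m) \<le> CARD('n)" "corner_minor * f \<in> ideal_pow maximal_minors_ideal N"
  shows "f \<in> ideal_pow maximal_minors_ideal N"
  using lt_corner_minor[OF assms(1), where 'k = 'k] ideal_pow_nonzerodivisor[OF _ _ assms(2)] by blast

section \<open>Containment in Frobenius powers after localization\<close>

text \<open>The first \<open>m - 1\<close> columns together with column \<open>l\<close>. The resulting \<open>n - m + 1\<close> minors generate the ideal of maximal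
  minors once \<open>corner_minor\<close> is inverted.\<close>

definition edge_columns :: "'n \<Rightarrow> 'm::finite \<Rightarrow> 'n::finite" where
  "edge_columns l k = (if rk k = 0 then l else unrk (rk k - 1))"

definition edge_ideal :: "('m::finite, 'n::finite, 'k::comm_ring_1) gpoly set" where
  "edge_ideal = ideal_gen ((\<lambda>l. max_minor (edge_columns l)) ` {l. CARD('m) - 1 \<le> rk l})"

lemma inj_edge_columns:
  assumes "CARD('m) \<le> CARD('n)" "CARD('m) - 1 \<le> rk l"
  shows "inj (edge_columns l :: 'm::finite \<Rightarrow> 'n::finite)"
proof (rule injI)
  have r: "rk (edge_columns l k :: 'n) = (if rk k = 0 then rk l else rk k - 1)" for k :: 'm
  proof -
    have "rk k - 1 < CARD('n)" using rk_less[of k] assms(1) by simp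
    thus ?thesis by (simp add: edge_columns_def)
  qed
  fix k k' :: 'm assume "edge_columns l k = edge_columns l k'"
  hence e: "rk (edge_columns l k :: 'n) = rk (edge_columns l k' :: 'n)" by simp
  have "rk k < CARD('m)" "rk k' < CARD('m)" by (rule rk_less)+
  hence "rk k = rk k'" using e assms(2) unfolding r by (auto simp del: rk_eq_iff split: if_splits)
  thus "k = k'" by simp
qed

text \<open>In \<open>coldet_single_exchange\<close>, replacing the unit column by column
  \<open>f s\<close> produces an edge minor. Every other exchange puts one of the first m - 1
  columns in place of \<open>f s\<close>.\<close>

lemma corner_minor_mult_max_minor:
  fixes f :: "'m::finite \<Rightarrow> 'n::finite"
  shows "corner_minor * (max_minor f :: ('m, 'n, 'k::comm_ring_1) gpoly) =
    max_minor (edge_columns (f s)) * coldet ((\<lambda>j i. var i (f j))(s := (\<lambda>r. if r = unrk 0 then 1 else 0))) +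
    (\<Sum>k\<in>UNIV - {unrk 0}. coldet ((\<lambda>k r. if rk k = 0 then (if r = k then 1 else 0) else var r (unrk (rk k - 1)))(k := \<lambda>r. var r (f s)))
      * max_minor (f(s := unrk (rk k - 1))))"
proof -
  let ?V = "\<lambda>k r. if rk k = 0 then (if r = k then 1 else 0) else var r (unrk (rk k - 1)) :: ('m, 'n, 'k) gpoly"
  let ?X = "\<lambda>j r. var r (f j) :: ('m, 'n, 'k) gpoly"
  define z where "z = (unrk 0 :: 'm)"
  have z: "rk k = 0 \<longleftrightarrow> k = z" for k :: 'm
    by (metis rk_unrk z_def zero_less_card_finite rk_eq_iff)
  have "corner_minor * max_minor f = (\<Sum>k\<in>UNIV. coldet (?V(k := ?X s)) * coldet (?X(s := ?V k)))"
    unfolding corner_minor_def max_minor_coldet by (rule coldet_single_exchange)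
  also have "\<dots> = coldet (?V(z := ?X s)) * coldet (?X(s := ?V z)) +
     (\<Sum>k\<in>UNIV - {z}. coldet (?V(k := ?X s)) * coldet (?X(s := ?V k)))"
    by (rule sum.remove) auto
  also have "coldet (?V(z := ?X s)) = max_minor (edge_columns (f s))"
    unfolding max_minor_coldet edge_columns_def by (rule arg_cong[where f = coldet]) (auto simp: z fun_eq_iff)
  also have "?V z = (\<lambda>r. if r = z then 1 else 0)" by (rule ext) (simp add: z)
  also have "(\<Sum>k\<in>UNIV - {z}. coldet (?V(k := ?X s)) * coldet (?X(s := ?V k))) =
    (\<Sum>k\<in>UNIV - {z}. coldet (?V(k := ?X s)) * max_minor (f(s := unrk (rk k - 1))))"
  proof (rule sum.cong[OF refl])
    fix k assume "k \<in> UNIV - {z}"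
    hence "coldet (?X(s := ?V k)) = (max_minor (f(s := unrk (rk k - 1))) :: ('m, 'n, 'k) gpoly)"
      unfolding max_minor_coldet by (intro arg_cong[where f = coldet]) (auto simp: z fun_eq_iff)
    thus "coldet (?V(k := ?X s)) * coldet (?X(s := ?V k)) = coldet (?V(k := ?X s)) * max_minor (f(s := unrk (rk k - 1)))" by simp
  qed
  finally show ?thesis by (simp only: z_def)
qed

text \<open>Modulo \<open>edge_ideal\<close>, each factor \<open>corner_minor\<close> removes one
  column outside the first m - 1. When none is left, m columns are chosen among m - 1, two coincide
  and the minor is zero.\<close>

lemma corner_minor_power_mult_max_minor:
  fixes f :: "'m::finite \<Rightarrow> 'n::finite"
  assumes mn: "CARD('m) \<le> CARD('n)"
    and "card {s. CARD('m) - 1 \<le> rk (f s)} \<le> c"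
  shows "corner_minor ^ c * (max_minor f :: ('m, 'n, 'k::comm_ring_1) gpoly) \<in> edge_ideal"
  using assms(2)
proof (induction c arbitrary: f)
  let ?Y = "edge_ideal :: ('m, 'n, 'k) gpoly set"
  have "is_ideal ?Y" unfolding edge_ideal_def by (rule is_ideal_ideal_gen)
  note Y = is_idealD[OF this] is_ideal_sum[OF this]
  {
    case 0
    hence "\<And>s. rk (f s) < CARD('m) - 1" by (simp add: not_le)
    hence "(\<lambda>s. rk (f s)) ` UNIV \<subseteq> {..<CARD('m) - 1}" by auto
    hence "card ((\<lambda>s. rk (f s)) ` UNIV) \<le> CARD('m) - 1" using card_mono[OF finite_lessThan] by fastforce
    hence "card ((\<lambda>s. rk (f s)) ` UNIV) < CARD('m)" using zero_less_card_finite[where 'a = 'm] by linarith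
    hence "\<not> inj f" using card_image[of "\<lambda>s. rk (f s)" UNIV] by (auto simp: inj_on_def)
    thus ?case using Y(1) by (simp add: max_minor_not_inj)
  next
    case (Suc c)
    show ?case
    proof (cases "card {s. CARD('m) - 1 \<le> rk (f s)} \<le> c")
      case True
      from Y(3)[OF Suc.IH[OF this], of corner_minor] show ?thesis by (simp add: mult.assoc)
    next
      case False
      hence "{s. CARD('m) - 1 \<le> rk (f s)} \<noteq> {}" by (metis card.empty zero_le)
      then obtain s where s: "CARD('m) - 1 \<le> rk (f s)" by blast
      have 1: "max_minor (edge_columns (f s)) \<in> ?Y"
        unfolding edge_ideal_def by (rule subsetD[OF ideal_gen_superset]) (use s in blast)
      have 2: "corner_minor ^ c * max_minor (f(s := unrk (rk k - 1))) \<in> ?Y" if k: "k \<in> UNIV - {unrk 0}" for k :: 'm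
      proof (rule Suc.IH)
        have "rk k \<noteq> 0" using k by (metis DiffD2 insertI1 unrk_rk)
        hence "rk k - 1 < CARD('m) - 1" "rk k - 1 < CARD('n)" using rk_less[of k] mn by auto
        hence "\<not> CARD('m) - 1 \<le> rk (unrk (rk k - 1) :: 'n)" by simp
        hence "{s'. CARD('m) - 1 \<le> rk ((f(s := unrk (rk k - 1))) s')} \<subseteq> {s. CARD('m) - 1 \<le> rk (f s)} - {s}"
          by (auto split: if_splits)
        hence "card {s'. CARD('m) - 1 \<le> rk ((f(s := unrk (rk k - 1))) s')} \<le> card ({s. CARD('m) - 1 \<le> rk (f s)} - {s})"
          by (rule card_mono[rotated]) simp
        also have "\<dots> \<le> c" using Suc.prems s by (subst card_Diff_singleton) simp_all
        finally show "card {s'. CARD('m) - 1 \<le> rk ((f(s := unrk (rk k - 1))) s')} \<le> c" .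
      qed
      have "corner_minor ^ Suc c * max_minor f = corner_minor ^ c * (corner_minor * max_minor f)"
        by (simp add: mult_ac)
      also have "\<dots> \<in> ?Y"
        unfolding corner_minor_mult_max_minor[of f s] distrib_left sum_distrib_left mult.left_commute[of "corner_minor ^ c"]
        by (intro Y(2) Y(7) Y(3) 2 Y(4)[OF 1, THEN Y(3)] Y(4)) (auto intro: 1 2 Y(4))
      finally show ?thesis .
    qed
  }
qed

text \<open>A minor has m columns, so m factors \<open>corner_minor\<close> per minor always
  suffice.\<close>

lemma corner_minor_power_mult_ideal_pow:
  fixes u :: "('m::finite, 'n::finite, 'k::comm_ring_1) gpoly"
  assumes mn: "CARD('m) \<le> CARD('n)" and u: "u \<in> ideal_pow maximal_minors_ideal M"
  shows "corner_minor ^ (CARD('m) * M) * u \<in> ideal_pow edge_ideal M"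
  using u
proof (induction M arbitrary: u)
  case 0
  thus ?case by simp
next
  case (Suc M)
  let ?I = "maximal_minors_ideal :: ('m, 'n, 'k) gpoly set"
  let ?Y = "edge_ideal :: ('m, 'n, 'k) gpoly set"
  let ?d = "corner_minor :: ('m, 'n, 'k) gpoly"
  have "is_ideal ?Y" unfolding edge_ideal_def by (rule is_ideal_ideal_gen)
  note Y = is_idealD[OF this]
  have "is_ideal {y. ?d ^ CARD('m) * y \<in> ?Y}"
    unfolding is_ideal_def by (auto simp: distrib_left mult.left_commute intro: Y(1-3))
  moreover have "{max_minor f |f. inj f} \<subseteq> {y. ?d ^ CARD('m) * y \<in> ?Y}"
    using corner_minor_power_mult_max_minor[OF mn card_mono[OF finite subset_UNIV]] by blast
  ultimately have I: "?d ^ CARD('m) * y \<in> ?Y" if "y \<in> ?I" for y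
    using ideal_gen_least that unfolding maximal_minors_ideal_def by blast
  have "is_ideal (ideal_pow ?Y (Suc M))" by (rule is_ideal_ideal_pow)
  note Z = is_idealD[OF this]
  have "is_ideal {u. ?d ^ (CARD('m) * Suc M) * u \<in> ideal_pow ?Y (Suc M)}"
    unfolding is_ideal_def by (auto simp: distrib_left mult.left_commute simp del: ideal_pow.simps intro: Z(1-3))
  moreover have "{x * y |x y. x \<in> ideal_pow ?I M \<and> y \<in> ?I} \<subseteq> {u. ?d ^ (CARD('m) * Suc M) * u \<in> ideal_pow ?Y (Suc M)}"
  proof safe
    fix x y assume "x \<in> ideal_pow ?I M" "y \<in> ?I"
    hence "(?d ^ (CARD('m) * M) * x) * (?d ^ CARD('m) * y) \<in> ideal_pow ?Y (M + 1)"
      by (intro ideal_pow_mult ideal_pow_one Suc.IH I)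
    thus "?d ^ (CARD('m) * Suc M) * (x * y) \<in> ideal_pow ?Y (Suc M)"
      by (simp add: power_add mult_ac del: ideal_pow.simps)
  qed
  ultimately have "ideal_pow ?I (Suc M) \<subseteq> {u. ?d ^ (CARD('m) * Suc M) * u \<in> ideal_pow ?Y (Suc M)}"
    unfolding ideal_pow.simps(2)[of ?I M] by (rule ideal_gen_least)
  thus ?case using Suc.prems by blast
qed

section \<open>Monomials in the generators and the pigeonhole principle\<close>

lemma ideal_pow_power: "x \<in> a \<Longrightarrow> x ^ n \<in> ideal_pow a n"
  using ideal_pow_prod[of "{..<n}" "\<lambda>_. x" a] by simp

lemma ideal_pow_prod_powers:
  assumes "finite S" "\<And>i. i \<in> S \<Longrightarrow> g i \<in> a"
  shows "(\<Prod>i\<in>S. g i ^ e i) \<in> ideal_pow a (\<Sum>i\<in>S. e i)"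
  using assms
proof (induction S rule: finite_induct)
  case (insert i S)
  have "g i ^ e i * (\<Prod>i\<in>S. g i ^ e i) \<in> ideal_pow a (e i + (\<Sum>i\<in>S. e i))"
    using insert by (intro ideal_pow_mult ideal_pow_power) auto
  thus ?case using insert by simp
qed simp

lemma ideal_pow_ideal_pow_power: "x \<in> ideal_pow a n \<Longrightarrow> x ^ q \<in> ideal_pow a (n * q)"
proof (induction q)
  case (Suc q)
  have "x * x ^ q \<in> ideal_pow a (n + n * q)" using Suc by (intro ideal_pow_mult) auto
  thus ?case by simp
qed simp

lemma ideal_pow_gen_subset:
  fixes g :: "'b \<Rightarrow> 'a::comm_ring_1"
  assumes S: "finite S"
  shows "ideal_pow (ideal_gen (g ` S)) M \<subseteq> ideal_gen {\<Prod>i\<in>S. g i ^ e i | e. (\<Sum>i\<in>S. e i) = M}"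
proof (induction M)
  case 0
  have "(\<Prod>i\<in>S. g i ^ 0) \<in> ideal_gen {\<Prod>i\<in>S. g i ^ e i | e. (\<Sum>i\<in>S. e i) = 0}"
    by (rule subsetD[OF ideal_gen_superset]) (rule CollectI, rule exI[of _ "\<lambda>_. 0"], simp)
  from is_idealD(4)[OF is_ideal_ideal_gen this] show ?case by auto
next
  case (Suc M)
  let ?G = "\<lambda>M. {\<Prod>i\<in>S. g i ^ e i | e. (\<Sum>i\<in>S. e i) = M}"
  note G = is_idealD[OF is_ideal_ideal_gen[of "?G (Suc M)"]]
  have 1: "is_ideal {y. x * y \<in> ideal_gen (?G (Suc M))}" for x
    unfolding is_ideal_def by (auto simp: distrib_left mult.left_commute intro: G(1-3))
  have 2: "is_ideal {x. \<forall>y\<in>ideal_gen (g ` S). x * y \<in> ideal_gen (?G (Suc M))}"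
    unfolding is_ideal_def by (auto simp: distrib_right mult.assoc intro: G(1-3))
  have 3: "x * y \<in> ideal_gen (?G (Suc M))" if x: "x \<in> ?G M" and y: "y \<in> ideal_gen (g ` S)" for x y
  proof -
    have "x * g i \<in> ideal_gen (?G (Suc M))" if i: "i \<in> S" for i
    proof -
      obtain e where e: "x = (\<Prod>i\<in>S. g i ^ e i)" "(\<Sum>i\<in>S. e i) = M" using x by blast
      define e' where "e' = e(i := Suc (e i))"
      have e': "e' i = Suc (e i)" "\<And>j. j \<in> S - {i} \<Longrightarrow> e' j = e j" by (auto simp: e'_def)
      have P: "(\<Prod>j\<in>S. h j) = h i * (\<Prod>j\<in>S - {i}. h j)" for h :: "_ \<Rightarrow> 'a" by (rule prod.remove[OF S i])
      have R: "(\<Sum>j\<in>S. h j) = h i + (\<Sum>j\<in>S - {i}. h j)" for h :: "_ \<Rightarrow> nat" by (rule sum.remove[OF S i])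
      have "(\<Prod>j\<in>S - {i}. g j ^ e' j) = (\<Prod>j\<in>S - {i}. g j ^ e j)"
        by (intro prod.cong refl) (simp add: e'(2))
      hence p: "x * g i = (\<Prod>j\<in>S. g j ^ e' j)"
        unfolding e(1) P[of "\<lambda>j. g j ^ e' j"] P[of "\<lambda>j. g j ^ e j"] by (simp add: e'(1) mult_ac)
      have "(\<Sum>j\<in>S - {i}. e' j) = (\<Sum>j\<in>S - {i}. e j)"
        by (intro sum.cong refl) (simp add: e'(2))
      hence "(\<Sum>j\<in>S. e' j) = Suc M"
        unfolding e(2)[symmetric] R[of e'] R[of e] by (simp add: e'(1))
      with p have "x * g i \<in> ?G (Suc M)" by (intro CollectI exI[of _ e'] conjI)
      thus ?thesis by (rule subsetD[OF ideal_gen_superset])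
    qed
    hence "g ` S \<subseteq> {y. x * y \<in> ideal_gen (?G (Suc M))}" by (simp add: image_subset_iff)
    from subsetD[OF ideal_gen_least[OF 1 this] y] show ?thesis by (rule CollectD)
  qed
  have "?G M \<subseteq> {x. \<forall>y\<in>ideal_gen (g ` S). x * y \<in> ideal_gen (?G (Suc M))}"
    by (rule subsetI, rule CollectI, rule ballI, rule 3)
  from subset_trans[OF Suc.IH ideal_gen_least[OF 2 this]]
  have "{x * y |x y. x \<in> ideal_pow (ideal_gen (g ` S)) M \<and> y \<in> ideal_gen (g ` S)} \<subseteq> ideal_gen (?G (Suc M))"
    by fast
  from ideal_gen_least[OF is_ideal_ideal_gen this] show ?case by simp
qed

text \<open>With \<open>c\<close> generators, a monomial of degree \<open>(N + c - 1) q\<close> is divisible by the \<open>q\<close>-th power of a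
  monomial of degree \<open>N\<close>.\<close>

lemma ideal_pow_subset_frob_pow_pigeonhole:
  assumes S: "finite S" "S \<noteq> {}" and g: "\<And>i. i \<in> S \<Longrightarrow> g i \<in> a" and q: "q > 0"
  shows "ideal_pow (ideal_gen (g ` S)) ((N + (card S - 1)) * q) \<subseteq> frob_pow (ideal_pow a N) q"
proof -
  have "(\<Prod>i\<in>S. g i ^ e i) \<in> frob_pow (ideal_pow a N) q" if e: "(\<Sum>i\<in>S. e i) = (N + (card S - 1)) * q" for e
  proof -
    \<comment> \<open>Adding 1 to each exponent makes the inequality strict after summation; this
      saves the one generator in \<open>card S - 1\<close>.\<close>
    have "(\<Sum>i\<in>S. e i) + card S = (\<Sum>i\<in>S. e i + 1)" by (simp only: sum.distrib) simp
    also have "\<dots> \<le> (\<Sum>i\<in>S. q * (e i div q) + q)"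
    proof (rule sum_mono)
      fix i
      have "e i = q * (e i div q) + e i mod q" "e i mod q < q" using q by simp_all
      thus "e i + 1 \<le> q * (e i div q) + q" by linarith
    qed
    also have "\<dots> = q * (\<Sum>i\<in>S. e i div q) + card S * q" by (simp add: sum.distrib sum_distrib_left)
    finally have le: "(N + (card S - 1)) * q + card S \<le> ((\<Sum>i\<in>S. e i div q) + card S) * q"
      unfolding e by (simp add: algebra_simps)
    have c: "card S > 0" using S by (simp add: card_gt_0_iff)
    hence "(N + (card S - 1)) * q < ((\<Sum>i\<in>S. e i div q) + card S) * q" using le by linarith
    hence "N + (card S - 1) < (\<Sum>i\<in>S. e i div q) + card S" by simp
    hence N: "N \<le> (\<Sum>i\<in>S. e i div q)" using c by linarith
    have "(\<Prod>i\<in>S. g i ^ (e i div q)) \<in> ideal_pow a N"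
      using ideal_pow_prod_powers[of S g a "\<lambda>i. e i div q"] S(1) g ideal_pow_antimono[OF N] by blast
    hence "(\<Prod>i\<in>S. g i ^ (e i div q)) ^ q \<in> frob_pow (ideal_pow a N) q"
      unfolding frob_pow_def by (intro subsetD[OF ideal_gen_superset]) blast
    hence "(\<Prod>i\<in>S. g i ^ (e i div q)) ^ q * (\<Prod>i\<in>S. g i ^ (e i mod q)) \<in> frob_pow (ideal_pow a N) q"
      unfolding frob_pow_def by (rule is_idealD(4)[OF is_ideal_ideal_gen])
    also have "(\<Prod>i\<in>S. g i ^ (e i div q)) ^ q * (\<Prod>i\<in>S. g i ^ (e i mod q)) = (\<Prod>i\<in>S. g i ^ e i)"
      by (simp add: prod_power_distrib flip: prod.distrib power_mult power_add)
    finally show ?thesis .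
  qed
  hence "ideal_gen {\<Prod>i\<in>S. g i ^ e i | e. (\<Sum>i\<in>S. e i) = (N + (card S - 1)) * q} \<subseteq> frob_pow (ideal_pow a N) q"
    by (intro ideal_gen_least) (auto simp: frob_pow_def is_ideal_ideal_gen)
  thus ?thesis using ideal_pow_gen_subset[OF S(1)] by blast
qed

lemma edge_ideal_pow_subset_frob_pow:
  assumes mn: "CARD('m) \<le> CARD('n)" and q: "q > 0"
  shows "ideal_pow edge_ideal ((N + (CARD('n) - CARD('m))) * q) \<subseteq>
    frob_pow (ideal_pow (maximal_minors_ideal :: ('m::finite, 'n::finite, 'k::comm_ring_1) gpoly set) N) q"
proof -
  define S where "S = {l :: 'n. CARD('m) - 1 \<le> rk l}"
  have "rk ` S = {CARD('m) - 1..<CARD('n)}"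
  proof
    show "{CARD('m) - 1..<CARD('n)} \<subseteq> rk ` S"
    proof
      fix r assume r: "r \<in> {CARD('m) - 1..<CARD('n)}"
      hence "rk (unrk r :: 'n) = r" by simp
      thus "r \<in> rk ` S" using r unfolding S_def by (metis atLeastLessThan_iff imageI mem_Collect_eq)
    qed
  qed (auto simp: S_def rk_less)
  moreover have "inj_on rk S" by (auto simp: inj_on_def)
  ultimately have "card S = card {CARD('m) - 1..<CARD('n)}" by (metis card_image)
  also have "\<dots> = CARD('n) - CARD('m) + 1" unfolding card_atLeastLessThan using mn zero_less_card_finite[where 'a = 'm] by linarith
  finally have S: "card S = CARD('n) - CARD('m) + 1" .
  hence "S \<noteq> {}" by auto
  from ideal_pow_subset_frob_pow_pigeonhole[OF finite this _ q, of "\<lambda>l. max_minor (edge_columns l)" "maximal_minors_ideal :: ('m, 'n, 'k) gpoly set" N]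
  show ?thesis unfolding edge_ideal_def S_def[symmetric] S
    using inj_edge_columns[OF mn] by (simp add: S_def max_minor_in_ideal)
qed

section \<open>Coordinates over the Frobenius image\<close>

lemma CHAR_poly_mapping: "CHAR('v::monoid_add \<Rightarrow>\<^sub>0 'k::comm_ring_1) = CHAR('k)"
proof (rule CHAR_eqI)
  have *: "(of_nat n :: 'v \<Rightarrow>\<^sub>0 'k) = 0 \<longleftrightarrow> (of_nat n :: 'k) = 0" for n
  proof -
    have e: "(of_nat n :: 'v \<Rightarrow>\<^sub>0 'k) = Poly_Mapping.single 0 (of_nat n)" by (rule single_of_nat[symmetric])
    show ?thesis unfolding e by (metis lookup_single_eq lookup_zero single_zero)
  qed
  show "(of_nat CHAR('k) :: 'v \<Rightarrow>\<^sub>0 'k) = 0" by (simp add: *)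
  show "CHAR('k) dvd n" if "(of_nat n :: 'v \<Rightarrow>\<^sub>0 'k) = 0" for n
    using that by (simp add: * of_nat_eq_0_iff_char_dvd)
qed

definition exp_scale :: "nat \<Rightarrow> ('v \<Rightarrow>\<^sub>0 nat) \<Rightarrow> ('v \<Rightarrow>\<^sub>0 nat)" where
  "exp_scale q v = Poly_Mapping.map ((*) q) v"

definition exp_div :: "('v \<Rightarrow>\<^sub>0 nat) \<Rightarrow> nat \<Rightarrow> ('v \<Rightarrow>\<^sub>0 nat)" where
  "exp_div v q = Poly_Mapping.map (\<lambda>x. x div q) v"

definition exp_mod :: "('v \<Rightarrow>\<^sub>0 nat) \<Rightarrow> nat \<Rightarrow> ('v \<Rightarrow>\<^sub>0 nat)" where
  "exp_mod v q = Poly_Mapping.map (\<lambda>x. x mod q) v"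

lemma lookup_exp_scale [simp]: "lookup (exp_scale q v) x = q * lookup v x"
  by (simp add: exp_scale_def Poly_Mapping.map.rep_eq when_def)

lemma lookup_exp_div [simp]: "lookup (exp_div v q) x = lookup v x div q"
  by (simp add: exp_div_def Poly_Mapping.map.rep_eq when_def)

lemma lookup_exp_mod [simp]: "lookup (exp_mod v q) x = lookup v x mod q"
  by (simp add: exp_mod_def Poly_Mapping.map.rep_eq when_def)

lemma exp_scale_add_eq_iff:
  assumes "\<And>x. lookup \<mu> x < q"
  shows "exp_scale q v + \<mu> = w \<longleftrightarrow> v = exp_div w q \<and> exp_mod w q = \<mu>"
proof
  assume "exp_scale q v + \<mu> = w"
  hence w: "lookup w x = q * lookup v x + lookup \<mu> x" for x by (auto simp: lookup_add)
  have "lookup w x div q = lookup v x" "lookup w x mod q = lookup \<mu> x" for x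
    unfolding w using assms[of x] by simp_all
  thus "v = exp_div w q \<and> exp_mod w q = \<mu>" by (auto intro!: poly_mapping_eqI)
next
  assume "v = exp_div w q \<and> exp_mod w q = \<mu>"
  thus "exp_scale q v + \<mu> = w" by (auto intro!: poly_mapping_eqI simp: lookup_add)
qed

lemma single_power:
  "Poly_Mapping.single v (c :: 'k::comm_ring_1) ^ q = Poly_Mapping.single (exp_scale q v) (c ^ q)"
proof (induction q)
  case 0
  have "exp_scale 0 v = 0" by (rule poly_mapping_eqI) simp
  thus ?case by simp
next
  case (Suc q)
  have "v + exp_scale q v = exp_scale (Suc q) v" by (rule poly_mapping_eqI) (simp add: lookup_add)
  thus ?case using Suc by (simp add: mult_single)
qed

lemma poly_mapping_power_char:
  fixes g :: "('v \<Rightarrow>\<^sub>0 nat) \<Rightarrow>\<^sub>0 'k::comm_ring_1"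
  assumes "prime CHAR('k)" "q = CHAR('k) ^ e"
  shows "g ^ q = (\<Sum>v\<in>keys g. Poly_Mapping.single (exp_scale q v) (lookup g v ^ q))"
proof -
  have "g ^ q = (\<Sum>v\<in>keys g. Poly_Mapping.single v (lookup g v)) ^ q"
    using poly_mapping_sum_single[of g] by simp
  also have "\<dots> = (\<Sum>v\<in>keys g. Poly_Mapping.single v (lookup g v) ^ q)"
    by (rule freshmans_dream_sum'[of _ e]) (simp_all add: CHAR_poly_mapping assms)
  finally show ?thesis by (simp add: single_power)
qed

lemma lookup_power_mult_single:
  fixes g :: "('v \<Rightarrow>\<^sub>0 nat) \<Rightarrow>\<^sub>0 'k::comm_ring_1"
  assumes "prime CHAR('k)" "q = CHAR('k) ^ e" and \<mu>: "\<And>x. lookup \<mu> x < q"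
  shows "lookup (g ^ q * Poly_Mapping.single \<mu> b) w = (if exp_mod w q = \<mu> then lookup g (exp_div w q) ^ q * b else 0)"
proof -
  have q: "q > 0" using assms(1,2) prime_gt_0_nat by auto
  have "lookup (g ^ q * Poly_Mapping.single \<mu> b) w =
    (\<Sum>v\<in>keys g. if v = exp_div w q then (if exp_mod w q = \<mu> then lookup g v ^ q * b else 0) else 0)"
    unfolding poly_mapping_power_char[OF assms(1,2)] sum_distrib_right lookup_sum mult_single
    by (intro sum.cong refl) (auto simp: lookup_single when_def exp_scale_add_eq_iff[OF \<mu>])
  also have "\<dots> = (if exp_mod w q = \<mu> then lookup g (exp_div w q) ^ q * b else 0)"
    using q by (auto simp: sum.delta in_keys_iff zero_power)
  finally show ?thesis .
qed

lemma lookup_single_mult_eq_0: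
  fixes s :: "('v::monoid_add) \<Rightarrow>\<^sub>0 'k::comm_ring_1"
  assumes "\<And>w. v \<noteq> a + w"
  shows "lookup (Poly_Mapping.single a c * s) v = 0"
proof (rule ccontr)
  assume "\<not> ?thesis"
  hence "v \<in> keys (Poly_Mapping.single a c * s)" by (simp add: in_keys_iff)
  then obtain a' w where "v = a' + w" "a' \<in> keys (Poly_Mapping.single a c)" using keys_mult by blast
  thus False using assms[of w] by (simp split: if_splits)
qed

text \<open>The coordinate of \<open>g\<close> at a basis element \<open>b x\<^sup>\<mu>\<close> of \<open>R\<close> over \<open>R\<^sup>q\<close>, already with its \<open>q\<close>-th root taken;
  \<open>\<rho>\<close> is the corresponding coordinate function of \<open>k\<close> over \<open>k\<^sup>q\<close>.\<close>

definition frob_coord :: "('k \<Rightarrow> 'k) \<Rightarrow> nat \<Rightarrow> ('v \<Rightarrow>\<^sub>0 nat) \<Rightarrow> (('v \<Rightarrow>\<^sub>0 nat) \<Rightarrow>\<^sub>0 'k::comm_ring_1) \<Rightarrow> (('v \<Rightarrow>\<^sub>0 nat) \<Rightarrow>\<^sub>0 'k)" where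
  "frob_coord \<rho> q \<mu> g = Abs_poly_mapping (\<lambda>v. \<rho> (lookup g (exp_scale q v + \<mu>)))"

text \<open>A \<open>p^{-e}\<close>-linear map of the coefficient ring; \<open>frob_coord\<close>
  lifts it to polynomials.\<close>

locale frob_functional =
  fixes \<rho> :: "'k::comm_ring_1 \<Rightarrow> 'k" and q :: nat and e :: nat
  assumes prime: "prime CHAR('k)" and q: "q = CHAR('k) ^ e"
    and add: "\<rho> (x + y) = \<rho> x + \<rho> y" and scale: "\<rho> (c ^ q * x) = c * \<rho> x"
begin

lemma zero: "\<rho> 0 = 0"
  using add[of 0 0] by simp

lemma q_pos: "q > 0"
  using q prime prime_gt_0_nat by auto

lemma lookup_frob_coord: "lookup (frob_coord \<rho> q \<mu> g) v = \<rho> (lookup g (exp_scale q v + \<mu>))"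
proof -
  have "inj (\<lambda>v. exp_scale q v + \<mu>)"
  proof (rule injI)
    fix v w assume "exp_scale q v + \<mu> = exp_scale q w + \<mu>"
    hence "exp_scale q v = exp_scale q w" by simp
    hence "lookup (exp_scale q v) x = lookup (exp_scale q w) x" for x by simp
    thus "v = w" using q_pos by (intro poly_mapping_eqI) simp
  qed
  hence "finite ((\<lambda>v. exp_scale q v + \<mu>) -` keys g)" by (intro finite_vimageI) simp_all
  moreover have "{v. \<rho> (lookup g (exp_scale q v + \<mu>)) \<noteq> 0} \<subseteq> (\<lambda>v. exp_scale q v + \<mu>) -` keys g"
    using zero by (auto simp: in_keys_iff)
  ultimately have "finite {v. \<rho> (lookup g (exp_scale q v + \<mu>)) \<noteq> 0}" by (rule finite_subset[rotated])
  thus ?thesis by (simp add: frob_coord_def)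
qed

lemma frob_coord_add: "frob_coord \<rho> q \<mu> (g + h) = frob_coord \<rho> q \<mu> g + frob_coord \<rho> q \<mu> h"
  by (rule poly_mapping_eqI) (simp add: lookup_frob_coord lookup_add add)

lemma frob_coord_zero: "frob_coord \<rho> q \<mu> 0 = 0"
  by (rule poly_mapping_eqI) (simp add: lookup_frob_coord zero)

lemma frob_coord_sum: "frob_coord \<rho> q \<mu> (\<Sum>a\<in>A. g a) = (\<Sum>a\<in>A. frob_coord \<rho> q \<mu> (g a))"
  by (induction A rule: infinite_finite_induct) (simp_all add: frob_coord_add frob_coord_zero)

text \<open>Frobenius is additive, so \<open>g\<close> may be taken to be a single term. The bound
  on \<open>\<mu>\<close> ensures that \<open>q v + \<mu>\<close> dominates \<open>q a\<close> only
  if \<open>v\<close> dominates \<open>a\<close>; otherwise both sides have coefficient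
  zero.\<close>

lemma frob_coord_power_mult:
  assumes \<mu>: "\<And>x. lookup \<mu> x < q"
  shows "frob_coord \<rho> q \<mu> (g ^ q * s) = g * frob_coord \<rho> q \<mu> s"
proof -
  have "frob_coord \<rho> q \<mu> (Poly_Mapping.single (exp_scale q a) (c ^ q) * s) = Poly_Mapping.single a c * frob_coord \<rho> q \<mu> s" for a c
  proof (rule poly_mapping_eqI)
    fix v
    show "lookup (frob_coord \<rho> q \<mu> (Poly_Mapping.single (exp_scale q a) (c ^ q) * s)) v = lookup (Poly_Mapping.single a c * frob_coord \<rho> q \<mu> s) v"
    proof (cases "\<exists>w. v = a + w")
      case True
      then obtain w where v: "v = a + w" by blast
      have "exp_scale q v + \<mu> = exp_scale q a + (exp_scale q w + \<mu>)"
        by (rule poly_mapping_eqI) (simp add: v lookup_add algebra_simps)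
      thus ?thesis by (simp add: lookup_frob_coord v lookup_single_mult scale)
    next
      case False
      have "exp_scale q v + \<mu> \<noteq> exp_scale q a + w" for w
      proof
        assume eq: "exp_scale q v + \<mu> = exp_scale q a + w"
        have "lookup a x \<le> lookup v x" for x
        proof -
          have "q * lookup v x + lookup \<mu> x = q * lookup a x + lookup w x"
            using arg_cong[OF eq, of "\<lambda>g. lookup g x"] by (simp add: lookup_add)
          hence "q * lookup a x < q * lookup v x + q" using \<mu>[of x] by linarith
          hence "q * lookup a x < q * Suc (lookup v x)" by simp
          hence "lookup a x < Suc (lookup v x)" by (simp only: mult_less_cancel1)
          thus ?thesis by simp
        qed
        hence "v = a + (v - a)" by (intro poly_mapping_eqI) (simp add: lookup_add lookup_minus)
        thus False using False by blast
      qed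
      hence "lookup (Poly_Mapping.single (exp_scale q a) (c ^ q) * s) (exp_scale q v + \<mu>) = 0"
        by (rule lookup_single_mult_eq_0)
      moreover have "lookup (Poly_Mapping.single a c * frob_coord \<rho> q \<mu> s) v = 0"
        using False by (intro lookup_single_mult_eq_0) blast
      ultimately show ?thesis by (simp add: lookup_frob_coord zero)
    qed
  qed
  hence "frob_coord \<rho> q \<mu> (g ^ q * s) = (\<Sum>v\<in>keys g. Poly_Mapping.single v (lookup g v) * frob_coord \<rho> q \<mu> s)"
    unfolding poly_mapping_power_char[OF prime q] sum_distrib_right frob_coord_sum by simp
  also have "\<dots> = g * frob_coord \<rho> q \<mu> s"
    by (subst (3) poly_mapping_sum_single[of g]) (simp add: sum_distrib_right)
  finally show ?thesis .
qed

lemma frob_coord_frob_pow: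
  assumes \<mu>: "\<And>x. lookup \<mu> x < q" and J: "is_ideal J" and g: "g \<in> frob_pow J q"
  shows "frob_coord \<rho> q \<mu> g \<in> J"
proof -
  note J' = is_idealD[OF J]
  \<comment> \<open>The quantifier over multipliers \<open>r\<close> makes the set an ideal, since
    coordinates are linear only over \<open>q\<close>-th powers.\<close>
  have "is_ideal {g. \<forall>r. frob_coord \<rho> q \<mu> (r * g) \<in> J}"
    unfolding is_ideal_def
    by (auto simp: distrib_left frob_coord_add frob_coord_zero mult.assoc[symmetric] intro: J'(1,2))
  moreover have "{x ^ q |x. x \<in> J} \<subseteq> {g. \<forall>r. frob_coord \<rho> q \<mu> (r * g) \<in> J}"
  proof (clarify)
    fix x r assume "x \<in> J"
    thus "frob_coord \<rho> q \<mu> (r * x ^ q) \<in> J"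
      using frob_coord_power_mult[OF \<mu>, of x r] J'(4) by (simp add: mult.commute)
  qed
  ultimately have "frob_coord \<rho> q \<mu> (1 * g) \<in> J"
    using ideal_gen_least g unfolding frob_pow_def by blast
  thus ?thesis by simp
qed

end

text \<open>A basis of \<open>k\<close> over \<open>k\<^sup>q\<close> is a basis of \<open>k\<close> as a vector space over itself with the scaling \<open>c \<cdot> x = c\<^sup>q x\<close>.\<close>

lemma ex_frob_basis:
  assumes p: "prime CHAR('k::field)" and q: "q = CHAR('k) ^ e"
  shows "\<exists>\<rho> :: 'k \<Rightarrow> 'k \<Rightarrow> 'k. (\<forall>b. frob_functional (\<rho> b) q e) \<and> \<rho> 1 1 = 1 \<and>
    (\<forall>x. finite {b. \<rho> b x \<noteq> 0} \<and> (\<Sum>b | \<rho> b x \<noteq> 0. \<rho> b x ^ q * b) = x)"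
proof -
  interpret F: vector_space "\<lambda>c x :: 'k. c ^ q * x"
    by standard (simp_all add: algebra_simps freshmans_dream'[OF p q] power_mult_distrib)
  \<comment> \<open>Placing 1 in the basis provides a coordinate function with value 1 at 1, which
    the lower bound needs.\<close>
  have ind: "F.independent {1}" by (simp add: F.dependent_single)
  define B where "B = F.extend_basis {1}"
  have B: "F.independent B" "F.span B = UNIV" "1 \<in> B"
    using F.independent_extend_basis[OF ind] F.span_extend_basis[OF ind] F.extend_basis_superset[OF ind]
    by (auto simp: B_def)
  define \<rho> where "\<rho> b x = F.representation B x b" for b x
  have "frob_functional (\<rho> b) q e" for b
    by (unfold_locales; (rule p | rule q |
      simp add: \<rho>_def F.representation_add[OF B(1)] F.representation_scale[OF B(1)] B(2)))
  moreover have "\<rho> 1 1 = 1" using F.representation_basis[OF B(1) B(3)] by (simp add: \<rho>_def)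
  moreover have "finite {b. \<rho> b x \<noteq> 0} \<and> (\<Sum>b | \<rho> b x \<noteq> 0. \<rho> b x ^ q * b) = x" for x
    using F.finite_representation[of B x] F.sum_nonzero_representation_eq[OF B(1), of x] B(2)
    by (simp add: \<rho>_def)
  ultimately show ?thesis by blast
qed

text \<open>Flatness of Frobenius in coordinates: those of \<open>h ^ q * u\<close> are
  \<open>h\<close> times those of \<open>u\<close> and lie in \<open>J\<close>, so those of
  \<open>u\<close> do too. Since \<open>u\<close> is a combination of \<open>q\<close>-th powers of
  its coordinates, it lies in the Frobenius power.\<close>

lemma frob_pow_cancel_power:
  fixes J :: "(('v \<Rightarrow>\<^sub>0 nat) \<Rightarrow>\<^sub>0 'k::field) set"
  assumes p: "prime CHAR('k)" and q: "q = CHAR('k) ^ e" and J: "is_ideal J"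
    and h: "\<And>g. h * g \<in> J \<Longrightarrow> g \<in> J" and u: "h ^ q * u \<in> frob_pow J q"
  shows "u \<in> frob_pow J q"
proof -
  obtain \<rho> :: "'k \<Rightarrow> 'k \<Rightarrow> 'k" where ff: "\<And>b. frob_functional (\<rho> b) q e"
    and \<rho>: "\<And>x. finite {b. \<rho> b x \<noteq> 0}" "\<And>x. (\<Sum>b | \<rho> b x \<noteq> 0. \<rho> b x ^ q * b) = x"
    using ex_frob_basis[OF p q] by blast
  have qpos: "q > 0" using p q prime_gt_0_nat by auto
  have coord: "frob_coord (\<rho> b) q \<mu> u \<in> J" if \<mu>: "\<And>x. lookup \<mu> x < q" for b \<mu>
  proof -
    interpret frob_functional "\<rho> b" q e by (rule ff)
    have "frob_coord (\<rho> b) q \<mu> (h ^ q * u) \<in> J" by (rule frob_coord_frob_pow[OF \<mu> J u])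
    thus ?thesis unfolding frob_coord_power_mult[OF \<mu>] by (rule h)
  qed
  \<comment> \<open>The basis of \<open>k\<close> may be infinite; only the remainders and basis
    elements that occur in \<open>u\<close> enter the expansion.\<close>
  define M where "M = (\<lambda>w. exp_mod w q) ` keys u"
  define Bs where "Bs = (\<Union>w\<in>keys u. {b. \<rho> b (lookup u w) \<noteq> 0})"
  have fin: "finite M" "finite Bs" using \<rho>(1) by (auto simp: M_def Bs_def)
  have M: "lookup \<mu> x < q" if "\<mu> \<in> M" for \<mu> x using that qpos by (auto simp: M_def)
  have "u = (\<Sum>\<mu>\<in>M. \<Sum>b\<in>Bs. frob_coord (\<rho> b) q \<mu> u ^ q * Poly_Mapping.single \<mu> b)"
  proof (rule poly_mapping_eqI)
    fix w :: "'v \<Rightarrow>\<^sub>0 nat"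
    have w: "exp_scale q (exp_div w q) + exp_mod w q = w"
      by (rule poly_mapping_eqI) (simp add: lookup_add)
    have "lookup (\<Sum>\<mu>\<in>M. \<Sum>b\<in>Bs. frob_coord (\<rho> b) q \<mu> u ^ q * Poly_Mapping.single \<mu> b) w =
      (\<Sum>\<mu>\<in>M. if \<mu> = exp_mod w q then (\<Sum>b\<in>Bs. \<rho> b (lookup u w) ^ q * b) else 0)"
      unfolding lookup_sum
    proof (rule sum.cong[OF refl])
      fix \<mu> assume \<mu>: "\<mu> \<in> M"
      have "(\<Sum>b\<in>Bs. lookup (frob_coord (\<rho> b) q \<mu> u ^ q * Poly_Mapping.single \<mu> b) w) =
        (\<Sum>b\<in>Bs. if \<mu> = exp_mod w q then \<rho> b (lookup u w) ^ q * b else 0)"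
        by (intro sum.cong refl)
          (auto simp: lookup_power_mult_single[OF p q M[OF \<mu>]] frob_functional.lookup_frob_coord[OF ff] w)
      thus "(\<Sum>b\<in>Bs. lookup (frob_coord (\<rho> b) q \<mu> u ^ q * Poly_Mapping.single \<mu> b) w) =
        (if \<mu> = exp_mod w q then (\<Sum>b\<in>Bs. \<rho> b (lookup u w) ^ q * b) else 0)" by simp
    qed
    also have "\<dots> = (if exp_mod w q \<in> M then (\<Sum>b\<in>Bs. \<rho> b (lookup u w) ^ q * b) else 0)"
      using fin(1) by (simp add: sum.delta)
    also have "\<dots> = lookup u w"
    proof (cases "w \<in> keys u")
      case True
      hence "exp_mod w q \<in> M" by (simp add: M_def)
      moreover have "(\<Sum>b\<in>Bs. \<rho> b (lookup u w) ^ q * b) = (\<Sum>b | \<rho> b (lookup u w) \<noteq> 0. \<rho> b (lookup u w) ^ q * b)"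
        by (rule sum.mono_neutral_right[OF fin(2)]) (use True qpos in \<open>auto simp: Bs_def\<close>)
      ultimately show ?thesis by (simp add: \<rho>(2))
    next
      case False
      hence "lookup u w = 0" by (simp add: in_keys_iff)
      thus ?thesis using frob_functional.zero[OF ff] qpos by (simp add: zero_power)
    qed
    finally show "lookup u w = lookup (\<Sum>\<mu>\<in>M. \<Sum>b\<in>Bs. frob_coord (\<rho> b) q \<mu> u ^ q * Poly_Mapping.single \<mu> b) w" ..
  qed
  also have "\<dots> \<in> frob_pow J q"
  proof -
    have K: "is_ideal (frob_pow J q)" unfolding frob_pow_def by (rule is_ideal_ideal_gen)
    have "frob_coord (\<rho> b) q \<mu> u ^ q \<in> frob_pow J q" if "\<mu> \<in> M" for b \<mu>
      unfolding frob_pow_def by (rule subsetD[OF ideal_gen_superset]) (use coord M[OF that] in blast)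
    thus ?thesis by (intro is_ideal_sum[OF K] is_idealD(4)[OF K])
  qed
  finally show ?thesis .
qed

section \<open>Test ideals\<close>

text \<open>A power of \<open>corner_minor\<close> carries the element into
  \<open>edge_ideal\<close>, where pigeonhole works; \<open>frob_pow_cancel_power\<close> removes it
  again.\<close>

lemma ideal_pow_subset_frob_pow:
  assumes mn: "CARD('m) \<le> CARD('n)" and p: "prime CHAR('k)" and q: "q = CHAR('k) ^ e"
  shows "ideal_pow maximal_minors_ideal ((N + (CARD('n) - CARD('m))) * q) \<subseteq>
    frob_pow (ideal_pow (maximal_minors_ideal :: ('m::finite, 'n::finite, 'k::field) gpoly set) N) q"
proof
  let ?I = "maximal_minors_ideal :: ('m, 'n, 'k) gpoly set"
  let ?d = "corner_minor :: ('m, 'n, 'k) gpoly"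
  define M where "M = (N + (CARD('n) - CARD('m))) * q"
  define t where "t = CARD('m) * M"
  have qpos: "q > 0" using p q prime_gt_0_nat by auto
  have K: "is_ideal (frob_pow (ideal_pow ?I N) q)" unfolding frob_pow_def by (rule is_ideal_ideal_gen)
  fix u assume "u \<in> ideal_pow ?I ((N + (CARD('n) - CARD('m))) * q)"
  hence "?d ^ t * u \<in> ideal_pow edge_ideal M"
    unfolding t_def M_def by (rule corner_minor_power_mult_ideal_pow[OF mn])
  hence "?d ^ t * u \<in> frob_pow (ideal_pow ?I N) q"
    unfolding M_def using edge_ideal_pow_subset_frob_pow[OF mn qpos] by blast
  \<comment> \<open>The exponent \<open>t\<close> is padded to \<open>t * q\<close>, because only
    \<open>q\<close>-th powers can be cancelled.\<close>
  hence "?d ^ (t * q - t) * (?d ^ t * u) \<in> frob_pow (ideal_pow ?I N) q" by (rule is_idealD(3)[OF K])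
  moreover have "?d ^ (t * q - t) * (?d ^ t * u) = (?d ^ t) ^ q * u"
    using qpos by (simp flip: mult.assoc power_add power_mult)
  ultimately have "(?d ^ t) ^ q * u \<in> frob_pow (ideal_pow ?I N) q" by simp
  moreover have "g \<in> ideal_pow ?I N" if "?d ^ s * g \<in> ideal_pow ?I N" for s g
    using that
  proof (induction s)
    case (Suc s)
    hence "?d * (?d ^ s * g) \<in> ideal_pow ?I N" by (simp add: mult.assoc)
    thus ?case using Suc.IH corner_minor_nonzerodivisor[OF mn] by blast
  qed simp
  ultimately show "u \<in> frob_pow (ideal_pow ?I N) q"
    using frob_pow_cancel_power[OF p q is_ideal_ideal_pow, of "?d ^ t"] by blast
qed

text \<open>The product \<open>f\<close> of the minors on consecutive columns has a squarefree leading monomial, so the coordinate of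
  \<open>f\<^bsup>q-1\<^esup>\<close> at the leading monomial of \<open>f\<^bsup>q-1\<^esup>\<close> is \<open>1\<close>.\<close>

lemma ideal_pow_subset_root_ideal:
  assumes mn: "CARD('m) \<le> CARD('n)" and p: "prime CHAR('k)" and q: "q = CHAR('k) ^ e"
    and K: "K \<le> N * q + (CARD('n) - CARD('m) + 1) * (q - 1)"
  shows "ideal_pow maximal_minors_ideal N \<subseteq>
    root_ideal (ideal_pow (maximal_minors_ideal :: ('m::finite, 'n::finite, 'k::field) gpoly set) K) q"
proof
  let ?I = "maximal_minors_ideal :: ('m, 'n, 'k) gpoly set"
  define c where "c = CARD('n) - CARD('m) + 1"
  define D where "D t i = (unrk (rk i + t) :: 'n)" for t and i :: 'm
  have rD: "rk (D t i) = rk i + t" if "t < c" for t i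
  proof -
    have "rk i + t < CARD('n)" using rk_less[of i] that mn by (simp add: c_def)
    thus ?thesis by (simp add: D_def)
  qed
  have D: "rows_incr c D" by (simp add: rows_incr_def incr_def rD)
  define f where "f = (minors_prod c D :: ('m, 'n, 'k) gpoly)"
  define \<mu> where "\<mu> = (\<Sum>i<q - 1. lexp c D)"
  have ltf: "lt (f ^ (q - 1)) \<mu>" unfolding f_def \<mu>_def by (intro lt_power lt_minors_prod D)
  have fI: "f ^ (q - 1) \<in> ideal_pow ?I (c * (q - 1))"
    unfolding f_def by (intro ideal_pow_ideal_pow_power minors_prod_in_ideal_pow D)
  have qpos: "q > 0" using p q prime_gt_0_nat by auto
  have \<mu>: "lookup \<mu> x < q" for x
  proof -
    \<comment> \<open>The variable \<open>(i, j)\<close> lies on the diagonal of at most one window,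
      the one shifted by \<open>rk j - rk i\<close>. Its exponent in \<open>\<mu>\<close> is
      therefore at most \<open>q - 1\<close>.\<close>
    obtain i j where x: "x = (i, j)" by (cases x)
    have "card {k. k < c \<and> D k i = j} \<le> card {rk j - rk i}"
      by (rule card_mono) (auto simp: rD)
    hence "lookup (lexp c D) x \<le> 1" by (simp add: x lookup_lexp)
    hence "lookup \<mu> x \<le> (q - 1) * 1" unfolding \<mu>_def lookup_sum by simp
    thus ?thesis using qpos by simp
  qed
  obtain \<rho> :: "'k \<Rightarrow> 'k \<Rightarrow> 'k" where ff: "frob_functional (\<rho> 1) q e" and \<rho>1: "\<rho> 1 1 = 1"
    using ex_frob_basis[OF p q] by blast
  interpret frob_functional "\<rho> 1" q e by (rule ff)
  have one: "frob_coord (\<rho> 1) q \<mu> (f ^ (q - 1)) = 1"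
  proof (rule poly_mapping_eqI)
    fix v
    \<comment> \<open>No exponent \<open>q v + \<mu>\<close> is lighter than \<open>\<mu>\<close>,
      so the leading term of \<open>f ^ (q - 1)\<close> determines all coefficients involved: 1 at
      \<open>v = 0\<close> and 0 elsewhere.\<close>
    have "exp_scale q v + \<mu> = \<mu> \<longleftrightarrow> v = 0"
    proof
      assume "exp_scale q v + \<mu> = \<mu>"
      hence "exp_scale q v = 0" by simp
      hence "lookup (exp_scale q v) x = 0" for x by simp
      thus "v = 0" using qpos by (intro poly_mapping_eqI) simp
    next
      assume "v = 0"
      thus "exp_scale q v + \<mu> = \<mu>" by (intro poly_mapping_eqI) (simp add: lookup_add)
    qed
    thus "lookup (frob_coord (\<rho> 1) q \<mu> (f ^ (q - 1))) v = lookup 1 v"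
      unfolding lookup_frob_coord
      by (subst lt_lookup[OF ltf]) (auto simp: wt_add lookup_one when_def \<rho>1 zero)
  qed
  fix h assume h: "h \<in> ideal_pow ?I N"
  have "h ^ q * f ^ (q - 1) \<in> ideal_pow ?I (N * q + c * (q - 1))"
    by (intro ideal_pow_mult ideal_pow_ideal_pow_power h fI)
  hence hf: "h ^ q * f ^ (q - 1) \<in> ideal_pow ?I K" using ideal_pow_antimono[OF K] by (auto simp: c_def)
  show "h \<in> root_ideal (ideal_pow ?I K) q"
    unfolding root_ideal_def
  proof (clarify)
    fix b assume b: "is_ideal b" "ideal_pow ?I K \<subseteq> frob_pow b q"
    have "frob_coord (\<rho> 1) q \<mu> (h ^ q * f ^ (q - 1)) \<in> b"
      by (rule frob_coord_frob_pow[OF \<mu> b(1)]) (use hf b(2) in blast)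
    thus "h \<in> b" unfolding frob_coord_power_mult[OF \<mu>] one by simp
  qed
qed

text \<open>For every \<open>e\<close> the power with exponent \<open>N\<close> is a competitor in
  the intersection that defines the root ideal, so the whole union stays inside it.\<close>

lemma test_ideal_subset_ideal_pow:
  assumes mn: "CARD('m) \<le> CARD('n)" and p: "prime CHAR('k)" and lam: "real (N + (CARD('n) - CARD('m))) \<le> lam"
  shows "test_ideal lam (maximal_minors_ideal :: ('m::finite, 'n::finite, 'k::field) gpoly set) \<subseteq>
    ideal_pow maximal_minors_ideal N"
proof -
  let ?I = "maximal_minors_ideal :: ('m, 'n, 'k) gpoly set"
  have "root_ideal (ideal_pow ?I (nat \<lceil>lam * real (CHAR('k) ^ e)\<rceil>)) (CHAR('k) ^ e) \<subseteq> ideal_pow ?I N" for e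
  proof -
    define q where "q = CHAR('k) ^ e"
    define K where "K = nat \<lceil>lam * real q\<rceil>"
    have "real ((N + (CARD('n) - CARD('m))) * q) \<le> lam * real q"
      unfolding of_nat_mult by (rule mult_right_mono[OF lam]) simp
    also have "\<dots> \<le> real K" unfolding K_def by (rule real_nat_ceiling_ge)
    finally have "(N + (CARD('n) - CARD('m))) * q \<le> K" by (simp only: of_nat_le_iff)
    hence "ideal_pow ?I K \<subseteq> frob_pow (ideal_pow ?I N) q"
      using ideal_pow_antimono ideal_pow_subset_frob_pow[OF mn p q_def] by blast
    thus ?thesis unfolding root_ideal_def K_def[symmetric] q_def[symmetric]
      using is_ideal_ideal_pow by blast
  qed
  thus ?thesis unfolding test_ideal_def CHAR_poly_mapping by blast
qed

text \<open>One member of the union suffices, so \<open>e\<close> may be taken large enough to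
  absorb the rounding.\<close>

lemma ideal_pow_subset_test_ideal:
  assumes mn: "CARD('m) \<le> CARD('n)" and p: "prime CHAR('k)" and lam: "lam < real (N + (CARD('n) - CARD('m) + 1))"
  shows "ideal_pow maximal_minors_ideal N \<subseteq>
    test_ideal lam (maximal_minors_ideal :: ('m::finite, 'n::finite, 'k::field) gpoly set)"
proof -
  let ?I = "maximal_minors_ideal :: ('m, 'n, 'k) gpoly set"
  define c where "c = CARD('n) - CARD('m) + 1"
  define d where "d = real (N + c) - lam"
  have d: "d > 0" using lam by (simp add: d_def c_def)
  have "1 < real CHAR('k)" using prime_gt_1_nat[OF p] by simp
  \<comment> \<open>The gap, multiplied by \<open>q\<close>, has to cover \<open>c\<close> for
    having \<open>q - 1\<close> instead of \<open>q\<close> in each of the \<open>c\<close> windows,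
    and 1 for the ceiling.\<close>
  then obtain e where e: "(real c + 1) / d < real CHAR('k) ^ e" using real_arch_pow by blast
  define q where "q = CHAR('k) ^ e"
  have qpos: "q > 0" using p q_def prime_gt_0_nat by auto
  have "real c + 1 < real q * d" using e d by (simp add: q_def field_simps)
  hence le: "lam * real q + 1 \<le> real N * real q + real c * real q - real c" by (simp add: d_def algebra_simps)
  define K where "K = nat \<lceil>lam * real q\<rceil>"
  have Kle: "K \<le> N * q + c * (q - 1)"
  proof -
    have "real_of_int \<lceil>lam * real q\<rceil> \<le> lam * real q + 1" by (rule of_int_ceiling_le_add_one)
    also have "\<dots> \<le> real N * real q + real c * (real q - 1)" using le by (simp add: algebra_simps)
    also have "\<dots> = real (N * q + c * (q - 1))" using qpos by (simp add: of_nat_diff)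
    finally have "\<lceil>lam * real q\<rceil> \<le> int (N * q + c * (q - 1))"
      by (metis of_int_le_iff of_int_of_nat_eq)
    thus ?thesis unfolding K_def by linarith
  qed
  have "ideal_pow ?I N \<subseteq> root_ideal (ideal_pow ?I K) q"
    by (rule ideal_pow_subset_root_ideal[OF mn p q_def]) (use Kle in \<open>simp add: c_def\<close>)
  thus ?thesis unfolding test_ideal_def CHAR_poly_mapping K_def q_def by blast
qed

lemma row_degree_lexp: "(\<Sum>j\<in>UNIV. lookup (lexp N D) (i, j)) = N"
proof -
  have "(\<Sum>j\<in>UNIV. lookup (lexp N D) (i, j)) = (\<Sum>k<N. \<Sum>j\<in>UNIV. lookup (expm (D k)) (i, j))"
    unfolding lexp_def lookup_sum by (rule sum.swap)
  also have "\<dots> = N" by (simp add: lookup_expm sum.delta)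
  finally show ?thesis .
qed

text \<open>Every diagonal has one variable in each matrix row, so the degree in the variables of a
  fixed row separates products of \<open>N\<close> and of \<open>Suc N\<close> diagonals.\<close>

lemma ideal_pow_not_subset_Suc:
  assumes mn: "CARD('m) \<le> CARD('n)"
  shows "\<not> ideal_pow (maximal_minors_ideal :: ('m::finite, 'n::finite, 'k::field) gpoly set) N \<subseteq>
    ideal_pow maximal_minors_ideal (Suc N)"
proof
  assume sub: "ideal_pow (maximal_minors_ideal :: ('m, 'n, 'k) gpoly set) N \<subseteq> ideal_pow maximal_minors_ideal (Suc N)"
  define D where "D k i = (unrk (rk i) :: 'n)" for k :: nat and i :: 'm
  have "rk (D k i) = rk i" for k i using rk_less[of i] mn by (simp add: D_def)
  hence D: "rows_incr N D" by (simp add: rows_incr_def incr_def)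
  define g where "g = (minors_prod N D :: ('m, 'n, 'k) gpoly)"
  have lt: "lt g (lexp N D)" unfolding g_def by (rule lt_minors_prod[OF D])
  have "\<exists>u E. standard (Suc N) u E \<and> lexp N D = u + lexp (Suc N) E"
  proof (rule ideal_pow_leading_monomial)
    show "g \<in> ideal_pow maximal_minors_ideal (Suc N)"
      using sub minors_prod_in_ideal_pow[OF D] unfolding g_def by blast
    show "lookup g (lexp N D) \<noteq> 0" using lt_lookup[OF lt order.refl] by simp
    show "wt v \<le> wt (lexp N D)" if "lookup g v \<noteq> 0" for v
      using lt_low[OF lt] that by (auto simp: low_def)
  qed
  then obtain u E where "lexp N D = u + lexp (Suc N) E" by blast
  hence "(\<Sum>j\<in>UNIV. lookup (lexp N D) (undefined, j)) =
    (\<Sum>j\<in>UNIV. lookup u (undefined, j)) + (\<Sum>j\<in>UNIV. lookup (lexp (Suc N) E) (undefined, j))"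
    by (simp add: lookup_add sum.distrib)
  thus False unfolding row_degree_lexp by simp
qed

theorem mainTheorem1:
  fixes I :: "('m::finite, 'n::finite, 'k::field) gpoly set"
  assumes "CHAR('k) > 0"
    and "CARD('m) \<le> CARD('n)"
    and "I = maximal_minors_ideal"
  shows "fpt I = real CARD('n) - real CARD('m) + 1
       \<and> {lam. F_jumping_number I lam} = {real_of_int N | N. real_of_int N \<ge> fpt I}
       \<and> (\<forall>lam::real. lam \<ge> fpt I - 1 \<longrightarrow>
            test_ideal lam I = ideal_pow I (nat (\<lfloor>lam\<rfloor> - int CARD('n) + int CARD('m))))"
proof -
  note mn = assms(2)
  have p: "prime CHAR('k)" by (rule prime_CHAR_semidom[OF assms(1)])
  define d where "d = CARD('n) - CARD('m)"
  have d: "real d = real CARD('n) - real CARD('m)" "int d = int CARD('n) - int CARD('m)"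
    using mn by (simp_all add: d_def of_nat_diff)
  have upper: "test_ideal lam I \<subseteq> ideal_pow I N" if "real (N + d) \<le> lam" for lam N
    unfolding assms(3) by (rule test_ideal_subset_ideal_pow[OF mn p]) (use that in \<open>simp add: d_def\<close>)
  have lower: "ideal_pow I N \<subseteq> test_ideal lam I" if "lam < real (N + (d + 1))" for lam N
    unfolding assms(3) by (rule ideal_pow_subset_test_ideal[OF mn p]) (use that in \<open>simp add: d_def\<close>)
  have strict: "\<not> ideal_pow I N \<subseteq> ideal_pow I (Suc N)" for N
    unfolding assms(3) by (rule ideal_pow_not_subset_Suc[OF mn])
  \<comment> \<open>The case \<open>N = 0\<close> of the lower bound; it also covers nonpositive
    arguments.\<close>
  have unit: "test_ideal lam I = UNIV" if "lam < real (d + 1)" for lam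
    using lower[of lam 0] that by auto
  have formula: "test_ideal lam I = ideal_pow I (nat (\<lfloor>lam\<rfloor> - int d))" if "real d \<le> lam" for lam
  proof -
    have "int d \<le> \<lfloor>lam\<rfloor>" using that by (simp add: le_floor_iff)
    define N where "N = nat (\<lfloor>lam\<rfloor> - int d)"
    have N: "int N = \<lfloor>lam\<rfloor> - int d" using \<open>int d \<le> \<lfloor>lam\<rfloor>\<close> by (simp add: N_def)
    have "real (N + d) = real_of_int \<lfloor>lam\<rfloor>"
      using arg_cong[OF N, of real_of_int] by simp
    hence "real (N + d) \<le> lam" "lam < real (N + (d + 1))" by linarith+
    hence "test_ideal lam I = ideal_pow I N" using upper lower by blast
    thus ?thesis by (simp add: N_def)
  qed
  have fpt: "fpt I = real (d + 1)"
    unfolding fpt_def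
  proof (rule Least_equality)
    have "test_ideal (real (d + 1)) I \<subseteq> ideal_pow I (Suc 0)" by (rule upper) simp
    thus "real (d + 1) > 0 \<and> test_ideal (real (d + 1)) I \<noteq> UNIV" using strict[of 0] by auto
    show "real (d + 1) \<le> lam" if "lam > 0 \<and> test_ideal lam I \<noteq> UNIV" for lam
      using that unit[of lam] by (meson not_le)
  qed
  have jump: "F_jumping_number I lam \<longleftrightarrow> (\<exists>N. lam = real_of_int N \<and> real_of_int N \<ge> fpt I)" for lam
  proof
    assume J: "F_jumping_number I lam"
    have ge: "lam \<ge> real (d + 1)"
    proof (rule ccontr)
      assume "\<not> ?thesis"
      hence "test_ideal lam I = UNIV" "test_ideal (lam - 1) I = UNIV" using unit by simp_all
      thus False using J unfolding F_jumping_number_def by (metis zero_less_one)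
    qed
    \<comment> \<open>By \<open>formula\<close> the test ideal depends only on the floor, so at a
      non-integer \<open>lam\<close> the distance to the floor is a step without a jump.\<close>
    have "lam = real_of_int \<lfloor>lam\<rfloor>"
    proof (rule ccontr)
      assume "lam \<noteq> real_of_int \<lfloor>lam\<rfloor>"
      hence pos: "lam - real_of_int \<lfloor>lam\<rfloor> > 0" using of_int_floor_le[of lam] by linarith
      have fl: "int (d + 1) \<le> \<lfloor>lam\<rfloor>" using ge by (simp add: le_floor_iff)
      have "real d \<le> real_of_int \<lfloor>lam\<rfloor>" using fl by linarith
      hence "test_ideal (real_of_int \<lfloor>lam\<rfloor>) I = test_ideal lam I"
        using formula[of lam] formula[of "real_of_int \<lfloor>lam\<rfloor>"] ge by simp
      moreover have "lam - (lam - real_of_int \<lfloor>lam\<rfloor>) = real_of_int \<lfloor>lam\<rfloor>" by simp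
      ultimately show False using J pos unfolding F_jumping_number_def by metis
    qed
    thus "\<exists>N. lam = real_of_int N \<and> real_of_int N \<ge> fpt I" using ge fpt by metis
  next
    assume "\<exists>N. lam = real_of_int N \<and> real_of_int N \<ge> fpt I"
    then obtain N where N: "lam = real_of_int N" "real_of_int N \<ge> real (d + 1)" unfolding fpt by blast
    have Nd: "N \<ge> int (d + 1)" using N(2) by linarith
    define s where "s = nat (N - int (d + 1))"
    have s: "N = int (Suc s + d)" using Nd by (simp add: s_def)
    have lam: "lam = real (Suc s + d)" unfolding N(1) s by simp
    \<comment> \<open>At \<open>lam = s + 1 + d\<close> the upper bound gives exponent
      \<open>Suc s\<close>, while any smaller argument, however far below, still admits the lower
      bound with \<open>s\<close>.\<close>
    have "test_ideal lam I \<noteq> test_ideal (lam - \<delta>) I" if "\<delta> > 0" for \<delta>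
    proof
      assume eq: "test_ideal lam I = test_ideal (lam - \<delta>) I"
      have "ideal_pow I s \<subseteq> test_ideal (lam - \<delta>) I" by (rule lower) (use that in \<open>simp add: lam\<close>)
      also have "\<dots> \<subseteq> ideal_pow I (Suc s)" unfolding eq[symmetric] by (rule upper) (simp add: lam)
      finally show False using strict by blast
    qed
    thus "F_jumping_number I lam" unfolding F_jumping_number_def using lam by simp
  qed
  have "{lam. F_jumping_number I lam} = {real_of_int N | N. real_of_int N \<ge> fpt I}"
    unfolding jump by blast
  moreover have "test_ideal lam I = ideal_pow I (nat (\<lfloor>lam\<rfloor> - int CARD('n) + int CARD('m)))"
    if "lam \<ge> fpt I - 1" for lam
    using formula[of lam] that unfolding fpt by (simp add: d(2) algebra_simps)
  ultimately show ?thesis using fpt d(1) by simp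
qed

end
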